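(* Let $\mathfrak g$ be a complex simple Lie algebra with Cartan subalgebra $\mathfrak h$, let $U\subset\mathfrak h^*$ be a connected open subset and let $A=TU\times\mathfrak g$ be the gauge Lie algebroid. Let $\tau:U\to\wedge^2\mathfrak g$ be a holomorphic function, considered as a section of $\wedge^2A$, and let $\theta=\sum_{i=1}^nh_i\wedge\frac{\partial}{\partial\lambda_i}\in\Gamma(\wedge^2A)$. Then $\theta+\tau$ is a Hamiltonian operator of the Lie bialgebroid $(A,A^*,r_0)$ if and only if $r=r_0+\tau$ is a dynamical $r$-matrix.
   Context: $\Delta_+$ is a choice of positive roots of $(\mathfrak g,\mathfrak h)$ and $\alpha_1,\dots,\alpha_n$ are the simple roots. $\langle\cdot,\cdot\rangle$ is the Killing form; root vectors $E_\alpha\in\mathfrak g_\alpha$ satisfy $\langle E_\alpha,E_{-\alpha}\rangle=1$. Put $h_i=[E_{\alpha_i},E_{-\alpha_i}]$ (a basis of $\mathfrak h$), $h_i^*$ the dual basis of $\mathfrak h^*$, $\lambda=\sum\lambda_ih_i^*$ the corresponding coordinates on $\mathfrak h^*$. Let $r_0=\sum_{\alpha\in\Delta_+}E_\alpha\wedge E_{-\alpha}$, regarded as a constant section of $\wedge^2A$. $A=TU\times\mathfrak g$ has as anchor the projection to $TU$ and bracket $[X+\xi,Y+\eta]=[X,Y]+[\xi,\eta]+L_X\eta-L_Y\xi$ for vector fields $X,Y$ and $\mathfrak g$-valued functions $\xi,\eta$ on $U$ (with $[\xi,\eta]$ pointwise). $A^*\cong T^*U\times\mathfrak g^*$ carries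 the product Lie algebroid structure in which $T^*U$ is the trivial (zero) Lie algebroid and $\mathfrak g^*$ has the Lie algebra structure induced by $r_0$; then $(A,A^*,r_0)$ is a coboundary Lie bialgebroid, and the differential on $\Gamma(\wedge^*A)$ induced by $A^*$ is $d_*=[r_0,\cdot]$, where $[\cdot,\cdot]$ is the Schouten bracket of $A$. A section $H\in\Gamma(\wedge^2A)$ is a Hamiltonian operator if $d_*H+\frac12[H,H]=0$ (equivalently, the graph of $H^\#:A^*\to A$ is a Dirac structure in $A\oplus A^*$). A dynamical $r$-matrix is a function $r:U\to\wedge^2\mathfrak g$ (here holomorphic) with (i) $[h,r(\lambda)]=0$ for all $h\in\mathfrak h$, and (ii) $\mathrm{Alt}(dr)+\frac12[r,r]=[\Omega^{12},\Omega^{23}]$, where $\mathrm{Alt}(dr)=\sum_ih_i\wedge\frac{\partial r}{\partial\lambda_i}$, $[r,r]$ is the Schouten bracket on $\wedge^*\mathfrak g$ and $\Omega\in(S^2\mathfrak g)^{\mathfrak g}$ is the Casimir element of the Killing form (coupling constant $2$; with the normalization used, $[\Omega^{12},\Omega^{23}]=\frac12[r_0,r_0]$). *)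

theory Defs
  imports "HOL-Analysis.Analysis" "HOL-Library.Function_Algebras"
begin

section \<open>Lie algebras\<close>

locale complex_lie_algebra = vector_space sc
  for sc :: "complex \<Rightarrow> 'g::ab_group_add \<Rightarrow> 'g" +
  fixes br :: "'g \<Rightarrow> 'g \<Rightarrow> 'g"
  assumes finite_dim: "\<exists>B. finite B \<and> span B = UNIV"
    and linear_left: "Vector_Spaces.linear sc sc (\<lambda>x. br x y)"
    and linear_right: "Vector_Spaces.linear sc sc (br x)"
    and alternating: "br x x = 0"
    and jacobi: "br x (br y z) + br y (br z x) + br z (br x y) = 0"

definition lie_ideal :: "(complex \<Rightarrow> 'g::ab_group_add \<Rightarrow> 'g) \<Rightarrow> ('g \<Rightarrow> 'g \<Rightarrow> 'g) \<Rightarrow> 'g set \<Rightarrow> bool" where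
  "lie_ideal sc br I \<longleftrightarrow> module.subspace sc I \<and> (\<forall>x. \<forall>y\<in>I. br x y \<in> I)"

definition simple_lie_algebra :: "(complex \<Rightarrow> 'g::ab_group_add \<Rightarrow> 'g) \<Rightarrow> ('g \<Rightarrow> 'g \<Rightarrow> 'g) \<Rightarrow> bool" where
  "simple_lie_algebra sc br \<longleftrightarrow> complex_lie_algebra sc br \<and> (\<exists>x y. br x y \<noteq> 0) \<and>
     (\<forall>I. lie_ideal sc br I \<longrightarrow> I = {0} \<or> I = UNIV)"

primrec lower_central :: "(complex \<Rightarrow> 'g::ab_group_add \<Rightarrow> 'g) \<Rightarrow> ('g \<Rightarrow> 'g \<Rightarrow> 'g) \<Rightarrow> 'g set \<Rightarrow> nat \<Rightarrow> 'g set" where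
  "lower_central sc br L 0 = L"
| "lower_central sc br L (Suc k) = module.span sc {br x y | x y. x \<in> L \<and> y \<in> lower_central sc br L k}"

text \<open>A Cartan subalgebra is a nilpotent subalgebra equal to its own normalizer.\<close>
definition cartan_subalgebra :: "(complex \<Rightarrow> 'g::ab_group_add \<Rightarrow> 'g) \<Rightarrow> ('g \<Rightarrow> 'g \<Rightarrow> 'g) \<Rightarrow> 'g set \<Rightarrow> bool" where
  "cartan_subalgebra sc br H \<longleftrightarrow> module.subspace sc H \<and> (\<forall>x\<in>H. \<forall>y\<in>H. br x y \<in> H) \<and>
     (\<exists>k. lower_central sc br H k = {0}) \<and> {x. \<forall>y\<in>H. br x y \<in> H} = H"

definition endo_trace :: "(complex \<Rightarrow> 'g::ab_group_add \<Rightarrow> 'g) \<Rightarrow> ('g \<Rightarrow> 'g) \<Rightarrow> complex" where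
  "endo_trace sc f = (let B = vector_space.extend_basis sc {} in
     \<Sum>b\<in>B. module.representation sc B (f b) b)"

definition killing :: "(complex \<Rightarrow> 'g::ab_group_add \<Rightarrow> 'g) \<Rightarrow> ('g \<Rightarrow> 'g \<Rightarrow> 'g) \<Rightarrow> 'g \<Rightarrow> 'g \<Rightarrow> complex" where
  "killing sc br x y = endo_trace sc (\<lambda>z. br x (br y z))"

section \<open>Roots\<close>

text \<open>The dual of a subspace \<open>H\<close>. A functional on \<open>H\<close> is represented by the function that
  vanishes outside \<open>H\<close>, so that equality of functionals is equality of functions.
  The (unique Hausdorff) vector space topology of the dual of a finite-dimensional \<open>H\<close> is the
  subspace topology of the product topology on functions.\<close>
definition dual_of :: "(complex \<Rightarrow> 'g::ab_group_add \<Rightarrow> 'g) \<Rightarrow> 'g set \<Rightarrow> ('g \<Rightarrow> complex) set" where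
  "dual_of sc H = {\<alpha>. (\<forall>x\<in>H. \<forall>y\<in>H. \<alpha> (x + y) = \<alpha> x + \<alpha> y) \<and>
     (\<forall>c. \<forall>x\<in>H. \<alpha> (sc c x) = c * \<alpha> x) \<and> (\<forall>x. x \<notin> H \<longrightarrow> \<alpha> x = 0)}"

definition root_space :: "(complex \<Rightarrow> 'g::ab_group_add \<Rightarrow> 'g) \<Rightarrow> ('g \<Rightarrow> 'g \<Rightarrow> 'g) \<Rightarrow> 'g set \<Rightarrow> ('g \<Rightarrow> complex) \<Rightarrow> 'g set" where
  "root_space sc br H \<alpha> = {x. \<forall>t\<in>H. br t x = sc (\<alpha> t) x}"

definition roots :: "(complex \<Rightarrow> 'g::ab_group_add \<Rightarrow> 'g) \<Rightarrow> ('g \<Rightarrow> 'g \<Rightarrow> 'g) \<Rightarrow> 'g set \<Rightarrow> ('g \<Rightarrow> complex) set" where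
  "roots sc br H = {\<alpha> \<in> dual_of sc H. \<alpha> \<noteq> 0 \<and> root_space sc br H \<alpha> \<noteq> {0}}"

definition positive_system :: "('g \<Rightarrow> complex) set \<Rightarrow> ('g \<Rightarrow> complex) set \<Rightarrow> bool" where
  "positive_system R P \<longleftrightarrow> P \<subseteq> R \<and> (\<forall>\<alpha>\<in>R. (\<alpha> \<in> P) \<noteq> (- \<alpha> \<in> P)) \<and>
     (\<forall>\<alpha>\<in>P. \<forall>\<beta>\<in>P. \<alpha> + \<beta> \<in> R \<longrightarrow> \<alpha> + \<beta> \<in> P)"

definition simple_roots :: "('g \<Rightarrow> complex) set \<Rightarrow> ('g \<Rightarrow> complex) set" where
  "simple_roots P = {\<alpha> \<in> P. \<not> (\<exists>\<beta>\<in>P. \<exists>\<gamma>\<in>P. \<alpha> = \<beta> + \<gamma>)}"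

definition root_vectors ::
  "(complex \<Rightarrow> 'g::ab_group_add \<Rightarrow> 'g) \<Rightarrow> ('g \<Rightarrow> 'g \<Rightarrow> 'g) \<Rightarrow> 'g set \<Rightarrow> (('g \<Rightarrow> complex) \<Rightarrow> 'g) \<Rightarrow> bool" where
  "root_vectors sc br H E \<longleftrightarrow> (\<forall>\<alpha>\<in>roots sc br H.
     E \<alpha> \<in> root_space sc br H \<alpha> \<and> killing sc br (E \<alpha>) (E (- \<alpha>)) = 1)"

definition simple_coroot :: "('g \<Rightarrow> 'g \<Rightarrow> 'g) \<Rightarrow> (('g \<Rightarrow> complex) \<Rightarrow> 'g) \<Rightarrow> ('n \<Rightarrow> 'g \<Rightarrow> complex) \<Rightarrow> 'n \<Rightarrow> 'g" where
  "simple_coroot br E \<alpha> i = br (E (\<alpha> i)) (E (- \<alpha> i))"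

text \<open>The functional \<open>h_i\<^sup>*\<close> of the basis of the dual of \<open>H\<close> that is dual to the basis \<open>h\<close> of \<open>H\<close>,
  and the parametrization \<open>z \<mapsto> \<Sum>\<^sub>i z_i h_i\<^sup>*\<close> of the dual of \<open>H\<close>.\<close>
definition dual_basis :: "(complex \<Rightarrow> 'g::ab_group_add \<Rightarrow> 'g) \<Rightarrow> 'g set \<Rightarrow> ('n \<Rightarrow> 'g) \<Rightarrow> 'n \<Rightarrow> 'g \<Rightarrow> complex" where
  "dual_basis sc H h i = (\<lambda>x. if x \<in> H then module.representation sc (range h) x (h i) else 0)"

definition coord_point :: "(complex \<Rightarrow> 'g::ab_group_add \<Rightarrow> 'g) \<Rightarrow> 'g set \<Rightarrow> ('n::finite \<Rightarrow> 'g) \<Rightarrow> complex ^ 'n \<Rightarrow> 'g \<Rightarrow> complex" where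
  "coord_point sc H h z = (\<lambda>x. \<Sum>i\<in>UNIV. z $ i * dual_basis sc H h i x)"

section \<open>Exterior and tensor powers\<close>

text \<open>For a finite-dimensional vector space \<open>V\<close>, the \<open>k\<close>-th tensor power is identified with the space
  of \<open>k\<close>-linear forms on the dual of \<open>V\<close>, and the \<open>k\<close>-th exterior power with the alternating ones.
  Such a form is a function on lists of functionals, extended by \<open>0\<close> to lists that do not consist
  of \<open>k\<close> linear functionals. The convention is
  \<open>x\<^sub>1 \<and> \<dots> \<and> x\<^sub>k = \<Sum>\<^sub>\<sigma> sgn(\<sigma>) x\<^sub>\<sigma>\<^sub>(\<^sub>1\<^sub>) \<otimes> \<dots> \<otimes> x\<^sub>\<sigma>\<^sub>(\<^sub>k\<^sub>)\<close>, without the factor \<open>1/k!\<close>; this is the normalization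
  for which \<open>[\<Omega>\<^sup>1\<^sup>2,\<Omega>\<^sup>2\<^sup>3] = 1/2 [r\<^sub>0,r\<^sub>0]\<close>.\<close>

type_synonym 'v tensor = "('v \<Rightarrow> complex) list \<Rightarrow> complex"

abbreviation lin_functional :: "(complex \<Rightarrow> 'v::ab_group_add \<Rightarrow> 'v) \<Rightarrow> ('v \<Rightarrow> complex) \<Rightarrow> bool" where
  "lin_functional s \<xi> \<equiv> Vector_Spaces.linear s (*) \<xi>"

definition delete_nth :: "nat \<Rightarrow> 'a list \<Rightarrow> 'a list" where
  "delete_nth i xs = take i xs @ drop (Suc i) xs"

definition tensor_prod :: "(complex \<Rightarrow> 'v::ab_group_add \<Rightarrow> 'v) \<Rightarrow> 'v list \<Rightarrow> 'v tensor" where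
  "tensor_prod s xs = (\<lambda>\<xi>s. if length \<xi>s = length xs \<and> (\<forall>\<xi>\<in>set \<xi>s. lin_functional s \<xi>)
     then \<Prod>i<length xs. (\<xi>s ! i) (xs ! i) else 0)"

text \<open>Left exterior multiplication \<open>P \<mapsto> x \<and> P\<close>, i.e. the expansion of a determinant along the
  row belonging to \<open>x\<close>.\<close>
definition ext_mult :: "(complex \<Rightarrow> 'v::ab_group_add \<Rightarrow> 'v) \<Rightarrow> 'v \<Rightarrow> 'v tensor \<Rightarrow> 'v tensor" where
  "ext_mult s x P = (\<lambda>\<xi>s. if \<forall>\<xi>\<in>set \<xi>s. lin_functional s \<xi>
     then \<Sum>j<length \<xi>s. (- 1) ^ j * (\<xi>s ! j) x * P (delete_nth j \<xi>s) else 0)"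

definition wedge :: "(complex \<Rightarrow> 'v::ab_group_add \<Rightarrow> 'v) \<Rightarrow> 'v list \<Rightarrow> 'v tensor" where
  "wedge s xs = foldr (ext_mult s) xs (\<lambda>\<xi>s. if \<xi>s = [] then 1 else 0)"

definition ext_power :: "(complex \<Rightarrow> 'v::ab_group_add \<Rightarrow> 'v) \<Rightarrow> nat \<Rightarrow> 'v tensor set" where
  "ext_power s k = {P. \<exists>F. (\<forall>xs\<in>set F. length xs = k) \<and> P = (\<Sum>xs\<leftarrow>F. wedge s xs)}"

text \<open>The map of tensor powers induced by a linear map \<open>f\<close> into the space with scaling \<open>s\<close>.\<close>
definition tensor_map :: "(complex \<Rightarrow> 'w::ab_group_add \<Rightarrow> 'w) \<Rightarrow> ('v \<Rightarrow> 'w) \<Rightarrow> 'v tensor \<Rightarrow> 'w tensor" where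
  "tensor_map s f P = (\<lambda>\<xi>s. if \<forall>\<xi>\<in>set \<xi>s. lin_functional s \<xi> then P (map (\<lambda>\<xi>. \<xi> \<circ> f) \<xi>s) else 0)"

section \<open>The Schouten bracket\<close>

text \<open>The extension of a Lie bracket \<open>br\<close> on \<open>S\<close> to multivectors of degrees \<open>p, q \<ge> 1\<close>,
  \<open>[x\<^sub>1 \<and> \<dots> \<and> x\<^sub>p, y\<^sub>1 \<and> \<dots> \<and> y\<^sub>q] = \<Sum>\<^sub>i\<^sub>,\<^sub>j (-1)\<^sup>i\<^sup>+\<^sup>j [x\<^sub>i,y\<^sub>j] \<and> x\<^sub>1 \<and> \<dots> (omit x\<^sub>i) \<dots> \<and> x\<^sub>p \<and> y\<^sub>1 \<and> \<dots> (omit y\<^sub>j) \<dots> \<and> y\<^sub>q\<close>,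
  continued biadditively. The argument \<open>w\<close> is the map \<open>[x\<^sub>1,\<dots>,x\<^sub>k] \<mapsto> x\<^sub>1 \<and> \<dots> \<and> x\<^sub>k\<close>; scalar factors are
  absorbed in the \<open>x\<^sub>i\<close>. The value is independent of the decompositions \<open>F, G\<close> for a Lie algebra and
  for the sections of a Lie algebroid.\<close>
definition schouten ::
  "'x set \<Rightarrow> ('x \<Rightarrow> 'x \<Rightarrow> 'x) \<Rightarrow> ('x list \<Rightarrow> 'm::ab_group_add) \<Rightarrow> nat \<Rightarrow> nat \<Rightarrow> 'm \<Rightarrow> 'm \<Rightarrow> 'm" where
  "schouten S br w p q P Q = (THE R. \<exists>F G.
     (\<forall>xs\<in>set F. length xs = p \<and> set xs \<subseteq> S) \<and> (\<forall>ys\<in>set G. length ys = q \<and> set ys \<subseteq> S) \<and>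
     P = (\<Sum>xs\<leftarrow>F. w xs) \<and> Q = (\<Sum>ys\<leftarrow>G. w ys) \<and>
     R = (\<Sum>xs\<leftarrow>F. \<Sum>ys\<leftarrow>G. \<Sum>i<p. \<Sum>j<q.
       (let T = w (br (xs ! i) (ys ! j) # delete_nth i xs @ delete_nth j ys)
        in if even (i + j) then T else - T)))"

abbreviation schouten_alg ::
  "(complex \<Rightarrow> 'g::ab_group_add \<Rightarrow> 'g) \<Rightarrow> ('g \<Rightarrow> 'g \<Rightarrow> 'g) \<Rightarrow> nat \<Rightarrow> nat \<Rightarrow> 'g tensor \<Rightarrow> 'g tensor \<Rightarrow> 'g tensor" where
  "schouten_alg sc br \<equiv> schouten UNIV br (wedge sc)"

section \<open>Holomorphic maps\<close>

definition holo_fun :: "(complex ^ 'n::finite) set \<Rightarrow> (complex ^ 'n \<Rightarrow> complex) \<Rightarrow> bool" where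
  "holo_fun V f \<longleftrightarrow> (\<forall>z\<in>V. \<exists>D. (f has_derivative D) (at z) \<and> (\<forall>c v. D (c *s v) = c * D v))"

definition holo_map ::
  "(complex \<Rightarrow> 'v::ab_group_add \<Rightarrow> 'v) \<Rightarrow> (complex ^ 'n::finite) set \<Rightarrow> (complex ^ 'n \<Rightarrow> 'v) \<Rightarrow> bool" where
  "holo_map s V f \<longleftrightarrow> (\<forall>\<xi>. lin_functional s \<xi> \<longrightarrow> holo_fun V (\<xi> \<circ> f))"

definition holo_multivector ::
  "(complex \<Rightarrow> 'v::ab_group_add \<Rightarrow> 'v) \<Rightarrow> nat \<Rightarrow> (complex ^ 'n::finite) set \<Rightarrow> (complex ^ 'n \<Rightarrow> 'v tensor) \<Rightarrow> bool" where
  "holo_multivector s k V P \<longleftrightarrow> (\<forall>z\<in>V. P z \<in> ext_power s k) \<and> (\<forall>\<xi>s. holo_fun V (\<lambda>z. P z \<xi>s))"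

text \<open>The derivative \<open>L\<^sub>v f (z)\<close> of a function with values in a finite-dimensional vector space.\<close>
definition dir_deriv ::
  "(complex \<Rightarrow> 'v::ab_group_add \<Rightarrow> 'v) \<Rightarrow> (complex ^ 'n::finite \<Rightarrow> 'v) \<Rightarrow> complex ^ 'n \<Rightarrow> complex ^ 'n \<Rightarrow> 'v" where
  "dir_deriv s f v z = (THE w. \<forall>\<xi>. lin_functional s \<xi> \<longrightarrow>
     ((\<lambda>t. \<xi> (f (z + t *s v))) has_field_derivative \<xi> w) (at 0))"

section \<open>The gauge Lie algebroid\<close>

text \<open>Everything is written in the coordinates \<open>\<lambda>\<^sub>i\<close>, so that \<open>V\<close> is an open subset of
  \<open>complex ^ 'n\<close> and the fibre of \<open>A = TV \<times> g\<close> is \<open>complex ^ 'n \<times> 'g\<close>, the pair \<open>(axis i 1, 0)\<close>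
  being \<open>\<partial>/\<partial>\<lambda>\<^sub>i\<close>. A section is a map \<open>z \<mapsto> (X z, \<xi> z)\<close> on \<open>V\<close>.\<close>

definition fibre_scale ::
  "(complex \<Rightarrow> 'g \<Rightarrow> 'g) \<Rightarrow> complex \<Rightarrow> (complex ^ 'n) \<times> 'g \<Rightarrow> (complex ^ 'n::finite) \<times> 'g" where
  "fibre_scale sc c = (\<lambda>(v, x). (c *s v, sc c x))"

definition gauge_sections ::
  "(complex \<Rightarrow> 'g::ab_group_add \<Rightarrow> 'g) \<Rightarrow> (complex ^ 'n::finite) set \<Rightarrow> (complex ^ 'n \<Rightarrow> (complex ^ 'n) \<times> 'g) set" where
  "gauge_sections sc V = {X. holo_map (fibre_scale sc) V X}"

text \<open>The bracket \<open>[X+\<xi>, Y+\<eta>] = [X,Y] + [\<xi>,\<eta>] + L\<^sub>X \<eta> - L\<^sub>Y \<xi>\<close>; in coordinates \<open>[X,Y] = L\<^sub>X Y - L\<^sub>Y X\<close>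
  componentwise.\<close>
definition gauge_bracket ::
  "(complex \<Rightarrow> 'g::ab_group_add \<Rightarrow> 'g) \<Rightarrow> ('g \<Rightarrow> 'g \<Rightarrow> 'g) \<Rightarrow> (complex ^ 'n::finite \<Rightarrow> (complex ^ 'n) \<times> 'g) \<Rightarrow>
   (complex ^ 'n \<Rightarrow> (complex ^ 'n) \<times> 'g) \<Rightarrow> (complex ^ 'n \<Rightarrow> (complex ^ 'n) \<times> 'g)" where
  "gauge_bracket sc br A B = (\<lambda>z.
     (dir_deriv (*s) (fst \<circ> B) (fst (A z)) z - dir_deriv (*s) (fst \<circ> A) (fst (B z)) z,
      br (snd (A z)) (snd (B z))
        + dir_deriv sc (snd \<circ> B) (fst (A z)) z - dir_deriv sc (snd \<circ> A) (fst (B z)) z))"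

text \<open>Multivector fields on \<open>V\<close> are compared after extension by \<open>0\<close> outside \<open>V\<close>.\<close>
definition on_dom :: "'z set \<Rightarrow> ('z \<Rightarrow> 'm::zero) \<Rightarrow> 'z \<Rightarrow> 'm" where
  "on_dom V P = (\<lambda>z. if z \<in> V then P z else 0)"

definition gauge_schouten ::
  "(complex \<Rightarrow> 'g::ab_group_add \<Rightarrow> 'g) \<Rightarrow> ('g \<Rightarrow> 'g \<Rightarrow> 'g) \<Rightarrow> (complex ^ 'n::finite) set \<Rightarrow> nat \<Rightarrow> nat \<Rightarrow>
   (complex ^ 'n \<Rightarrow> ((complex ^ 'n) \<times> 'g) tensor) \<Rightarrow> (complex ^ 'n \<Rightarrow> ((complex ^ 'n) \<times> 'g) tensor) \<Rightarrow>
   (complex ^ 'n \<Rightarrow> ((complex ^ 'n) \<times> 'g) tensor)" where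
  "gauge_schouten sc br V p q P Q =
     schouten (gauge_sections sc V) (gauge_bracket sc br)
       (\<lambda>Xs. on_dom V (\<lambda>z. wedge (fibre_scale sc) (map (\<lambda>X. X z) Xs))) p q (on_dom V P) (on_dom V Q)"

text \<open>An element of the exterior algebra of \<open>g\<close> as an element of that of the fibre of \<open>A\<close>.\<close>
definition to_gauge :: "(complex \<Rightarrow> 'g::ab_group_add \<Rightarrow> 'g) \<Rightarrow> 'g tensor \<Rightarrow> ((complex ^ 'n::finite) \<times> 'g) tensor" where
  "to_gauge sc P = tensor_map (fibre_scale sc) (\<lambda>x. (0, x)) P"

text \<open>The differential \<open>d\<^sub>* = [r\<^sub>0, \<cdot>]\<close> of the coboundary Lie bialgebroid \<open>(A, A\<^sup>*, r\<^sub>0)\<close>, on sections of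
  the \<open>k\<close>-th exterior power.\<close>
definition d_star ::
  "(complex \<Rightarrow> 'g::ab_group_add \<Rightarrow> 'g) \<Rightarrow> ('g \<Rightarrow> 'g \<Rightarrow> 'g) \<Rightarrow> 'g tensor \<Rightarrow> (complex ^ 'n::finite) set \<Rightarrow> nat \<Rightarrow>
   (complex ^ 'n \<Rightarrow> ((complex ^ 'n) \<times> 'g) tensor) \<Rightarrow> (complex ^ 'n \<Rightarrow> ((complex ^ 'n) \<times> 'g) tensor)" where
  "d_star sc br r0 V k P = gauge_schouten sc br V 2 k (\<lambda>_. to_gauge sc r0) P"

definition hamiltonian_operator ::
  "(complex \<Rightarrow> 'g::ab_group_add \<Rightarrow> 'g) \<Rightarrow> ('g \<Rightarrow> 'g \<Rightarrow> 'g) \<Rightarrow> 'g tensor \<Rightarrow> (complex ^ 'n::finite) set \<Rightarrow>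
   (complex ^ 'n \<Rightarrow> ((complex ^ 'n) \<times> 'g) tensor) \<Rightarrow> bool" where
  "hamiltonian_operator sc br r0 V P \<longleftrightarrow> holo_multivector (fibre_scale sc) 2 V P \<and>
     (\<forall>z\<in>V. \<forall>\<xi>s. d_star sc br r0 V 2 P z \<xi>s + 1/2 * gauge_schouten sc br V 2 2 P P z \<xi>s = 0)"

definition theta ::
  "(complex \<Rightarrow> 'g::ab_group_add \<Rightarrow> 'g) \<Rightarrow> ('n \<Rightarrow> 'g) \<Rightarrow> complex ^ 'n::finite \<Rightarrow> ((complex ^ 'n) \<times> 'g) tensor" where
  "theta sc h = (\<lambda>z. \<Sum>i\<in>UNIV. wedge (fibre_scale sc) [(0, h i), (axis i 1, 0)])"

section \<open>Dynamical r-matrices\<close>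

definition r_zero ::
  "(complex \<Rightarrow> 'g::ab_group_add \<Rightarrow> 'g) \<Rightarrow> ('g \<Rightarrow> complex) set \<Rightarrow> (('g \<Rightarrow> complex) \<Rightarrow> 'g) \<Rightarrow> 'g tensor" where
  "r_zero sc P E = (\<Sum>\<alpha>\<in>P. wedge sc [E \<alpha>, E (- \<alpha>)])"

text \<open>The Casimir element \<open>\<Sum> x \<otimes> x'\<close> for a basis \<open>(x)\<close> and its dual basis \<open>(x')\<close> with respect to
  the Killing form.\<close>
definition casimir :: "(complex \<Rightarrow> 'g::ab_group_add \<Rightarrow> 'g) \<Rightarrow> ('g \<Rightarrow> 'g \<Rightarrow> 'g) \<Rightarrow> 'g tensor" where
  "casimir sc br = (let B = vector_space.extend_basis sc {} in
     \<Sum>x\<in>B. tensor_prod sc [x, THE x'. \<forall>y\<in>B. killing sc br x' y = (if y = x then 1 else 0)])"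

text \<open>\<open>[S\<^sup>1\<^sup>2, T\<^sup>2\<^sup>3] = \<Sum> a \<otimes> [b,c] \<otimes> d\<close> for \<open>S = \<Sum> a \<otimes> b\<close> and \<open>T = \<Sum> c \<otimes> d\<close>.\<close>
definition comm_12_23 ::
  "(complex \<Rightarrow> 'g::ab_group_add \<Rightarrow> 'g) \<Rightarrow> ('g \<Rightarrow> 'g \<Rightarrow> 'g) \<Rightarrow> 'g tensor \<Rightarrow> 'g tensor \<Rightarrow> 'g tensor" where
  "comm_12_23 sc br S T = (THE R. \<exists>F G.
     S = (\<Sum>(a, b)\<leftarrow>F. tensor_prod sc [a, b]) \<and> T = (\<Sum>(c, d)\<leftarrow>G. tensor_prod sc [c, d]) \<and>
     R = (\<Sum>(a, b)\<leftarrow>F. \<Sum>(c, d)\<leftarrow>G. tensor_prod sc [a, br b c, d]))"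

definition partial_tensor ::
  "(complex ^ 'n::finite \<Rightarrow> 'g tensor) \<Rightarrow> 'n \<Rightarrow> complex ^ 'n \<Rightarrow> 'g tensor" where
  "partial_tensor r i z = (\<lambda>\<xi>s. deriv (\<lambda>t. r (z + t *s axis i 1) \<xi>s) 0)"

definition Alt_d ::
  "(complex \<Rightarrow> 'g::ab_group_add \<Rightarrow> 'g) \<Rightarrow> ('n \<Rightarrow> 'g) \<Rightarrow> (complex ^ 'n::finite \<Rightarrow> 'g tensor) \<Rightarrow> complex ^ 'n \<Rightarrow> 'g tensor" where
  "Alt_d sc h r z = (\<Sum>i\<in>UNIV. ext_mult sc (h i) (partial_tensor r i z))"

definition dynamical_r_matrix ::
  "(complex \<Rightarrow> 'g::ab_group_add \<Rightarrow> 'g) \<Rightarrow> ('g \<Rightarrow> 'g \<Rightarrow> 'g) \<Rightarrow> 'g set \<Rightarrow> ('n \<Rightarrow> 'g) \<Rightarrow> (complex ^ 'n::finite) set \<Rightarrow>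
   (complex ^ 'n \<Rightarrow> 'g tensor) \<Rightarrow> bool" where
  "dynamical_r_matrix sc br H h V r \<longleftrightarrow> holo_multivector sc 2 V r \<and>
     (\<forall>t\<in>H. \<forall>z\<in>V. schouten_alg sc br 1 2 (wedge sc [t]) (r z) = 0) \<and>
     (\<forall>z\<in>V. \<forall>\<xi>s. Alt_d sc h r z \<xi>s + 1/2 * schouten_alg sc br 2 2 (r z) (r z) \<xi>s
        = comm_12_23 sc br (casimir sc br) (casimir sc br) \<xi>s)"

end

theory Submission
  imports Defs "HOL-Computational_Algebra.Fundamental_Theorem_Algebra"
begin

text \<open>
  In \<open>d\<^sub>* (\<theta> + \<tau>) + 1/2 [\<theta> + \<tau>, \<theta> + \<tau>]\<close> the brackets \<open>[\<theta>, \<theta>]\<close> and \<open>[r\<^sub>0, \<theta>]\<close> vanish because the Cartan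
  subalgebra is abelian and \<open>r\<^sub>0\<close> is invariant under it, and \<open>[\<theta>, \<tau>]\<close> is the sum of \<open>Alt (d\<tau>)\<close> and of
  terms with a factor \<open>\<partial>/\<partial>\<lambda>\<^sub>i\<close> whose coefficient is \<open>[h\<^sub>i, \<tau>]\<close>. Hence the component tangential to the base
  expresses invariance of \<open>\<tau>\<close>, as the \<open>h\<^sub>i\<close> span the Cartan subalgebra, and the component in \<open>\<And>\<^sup>3 g\<close>
  is \<open>Alt (d\<tau>) + [r\<^sub>0, \<tau>] + 1/2 [\<tau>, \<tau>]\<close>, which is \<open>Alt (dr) + 1/2 [r, r] - 1/2 [r\<^sub>0, r\<^sub>0]\<close>. The identity
  \<open>1/2 [r\<^sub>0, r\<^sub>0] = [\<Omega>\<^sup>1\<^sup>2, \<Omega>\<^sup>2\<^sup>3]\<close> is the modified Yang--Baxter equation for the operator with eigenvalues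
  \<open>1, -1, 0\<close> on the positive part, the negative part and the Cartan subalgebra.

  A root exists, so the Killing form is nonzero and therefore nondegenerate by simplicity. The root
  space decomposition then follows from traces of commutators on sums of generalized weight spaces.
\<close>

section \<open>Linear maps, traces and generalized eigenspaces\<close>

text \<open>Two features of the statement shape the work. A Cartan subalgebra is only given as
  nilpotent and self-normalizing, so weight spaces have to start as generalized eigenspaces, and
  sl_2 representation theory is bypassed: on any subspace invariant under \<open>E a\<close> and
  \<open>E (- a)\<close> the vector \<open>coroot a\<close> acts as a commutator, hence with trace
  zero, and suitable choices of the subspace yield reality and positivity of the pairings, root
  strings and one-dimensional root spaces. On the geometric side both Schouten brackets are definite
  descriptions over all decompositions into wedge products. They become usable through a closed
  formula in the contractions \<open>contr P \<xi>\<close>, which does not refer to a decomposition;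
  evaluated on triples of functionals it reduces the theorem to identities between numbers. A
  functional on the fibre is the sum of a horizontal and a vertical part, and functionals for which
  one part vanishes separate the two components of the Hamiltonian condition. The factor 1/2 cancels
  the 2 produced by the symmetry of the bracket on bivectors.\<close>

lemma lin_add: "Vector_Spaces.linear s1 s2 f \<Longrightarrow> f (x + y) = f x + f y"
  and lin_scale: "Vector_Spaces.linear s1 s2 f \<Longrightarrow> f (s1 c x) = s2 c (f x)"
  by (simp_all add: Vector_Spaces.linear_iff)

lemma lin_zero: "Vector_Spaces.linear s1 s2 f \<Longrightarrow> f 0 = 0"
  and lin_neg: "Vector_Spaces.linear s1 s2 f \<Longrightarrow> f (- x) = - f x"
  and lin_diff: "Vector_Spaces.linear s1 s2 f \<Longrightarrow> f (x - y) = f x - f y"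
  and lin_sum: "Vector_Spaces.linear s1 s2 f \<Longrightarrow> f (sum g A) = (\<Sum>a\<in>A. f (g a))"
  unfolding Vector_Spaces.linear_iff_module_hom
  by (rule module_hom.zero module_hom.neg module_hom.diff module_hom.sum, assumption)+

lemma lin_compose:
  "Vector_Spaces.linear s1 s2 f \<Longrightarrow> Vector_Spaces.linear s2 s3 g \<Longrightarrow> Vector_Spaces.linear s1 s3 (\<lambda>x. g (f x))"
  by (simp add: Vector_Spaces.linear_iff)

lemma lin_funpow:
  "Vector_Spaces.linear s s f \<Longrightarrow> Vector_Spaces.linear s s (f ^^ n)"
  by (induction n) (auto simp: Vector_Spaces.linear_iff)

lemma vector_space_times: "vector_space ((*) :: complex \<Rightarrow> complex \<Rightarrow> complex)"
  by unfold_locales (auto simp: algebra_simps)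

section \<open>Traces on invariant subspaces of a finite-dimensional space\<close>

locale fin_dim_cspace = vector_space sc
  for sc :: "complex \<Rightarrow> 'v::ab_group_add \<Rightarrow> 'v" +
  assumes finite_dim: "\<exists>B. finite B \<and> span B = UNIV"
begin

abbreviation "basis \<equiv> extend_basis {}"

lemma independent_basis: "independent basis" and span_basis: "span basis = UNIV"
  using independent_extend_basis[OF independent_empty] span_extend_basis[OF independent_empty] by auto

lemma finite_basis: "finite basis"
proof -
  obtain B where B: "finite B" "span B = UNIV" using finite_dim by blast
  show ?thesis using independent_span_bound[OF B(1) independent_basis] B(2) by auto
qed

sublocale finite_dimensional_vector_space sc basis
  by unfold_locales (auto simp: independent_basis span_basis finite_basis)

abbreviation "linop f \<equiv> Vector_Spaces.linear sc sc f"
abbreviation "linfun f \<equiv> Vector_Spaces.linear sc (*) f"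

text \<open>The trace of the restriction of \<open>f\<close> to \<open>span B\<close>, for
  independent \<open>B\<close> with invariant span. Proper subspaces are essential, because the root
  arguments compare traces over different sums of weight spaces.\<close>

definition tr :: "'v set \<Rightarrow> ('v \<Rightarrow> 'v) \<Rightarrow> complex" where
  "tr B f = (\<Sum>b\<in>B. representation B (f b) b)"

lemma endo_trace_eq: "endo_trace sc f = tr basis f"
  by (simp add: endo_trace_def tr_def Let_def)

lemma span_expand:
  assumes "independent B" "v \<in> span B"
  shows "v = (\<Sum>b\<in>B. sc (representation B v b) b)"
  using sum_representation_eq[OF assms finiteI_independent[OF assms(1)]] by auto

lemma representation_combination:
  assumes B: "independent B" and I: "\<And>i. i \<in> I \<Longrightarrow> x i \<in> span B"
  shows "representation B (\<Sum>i\<in>I. sc (c i) (x i)) b = (\<Sum>i\<in>I. c i * representation B (x i) b)"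
  by (subst representation_sum) (auto simp: representation_scale[OF B] I span_scale B)

lemma linop_span:
  assumes f: "linop f" and B: "\<And>b. b \<in> B \<Longrightarrow> f b \<in> S" and S: "subspace S" and v: "v \<in> span B"
  shows "f v \<in> S"
  using v
proof (induction rule: span_induct_alt)
  case base then show ?case using f S by (simp add: lin_zero subspace_0)
next
  case (step c x y)
  then show ?case using S B by (simp add: lin_add[OF f] lin_scale[OF f] subspace_add subspace_scale)
qed

lemma representation_linop:
  assumes B: "independent B" and f: "linop f" and fB: "\<And>b. b \<in> B \<Longrightarrow> f b \<in> span B" and v: "v \<in> span B"
  shows "representation B (f v) d = (\<Sum>b\<in>B. representation B v b * representation B (f b) d)"
proof -
  have "f v = f (\<Sum>b\<in>B. sc (representation B v b) b)" using span_expand[OF B v] by simp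
  also have "\<dots> = (\<Sum>b\<in>B. sc (representation B v b) (f b))" by (simp add: lin_sum[OF f] lin_scale[OF f])
  finally show ?thesis using representation_combination[OF B, of B f] fB by simp
qed

lemma tr_comm:
  assumes B: "independent B" and f: "linop f" "\<And>b. b \<in> B \<Longrightarrow> f b \<in> span B"
    and g: "linop g" "\<And>b. b \<in> B \<Longrightarrow> g b \<in> span B"
  shows "tr B (\<lambda>x. f (g x)) = tr B (\<lambda>x. g (f x))"
proof -
  have "tr B (\<lambda>x. f (g x)) = (\<Sum>b\<in>B. \<Sum>c\<in>B. representation B (g b) c * representation B (f c) b)"
    by (auto simp: tr_def representation_linop[OF B f g(2)] intro!: sum.cong)
  also have "\<dots> = (\<Sum>c\<in>B. \<Sum>b\<in>B. representation B (f c) b * representation B (g b) c)"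
    by (subst sum.swap) (simp add: mult.commute)
  also have "\<dots> = tr B (\<lambda>x. g (f x))"
    by (auto simp: tr_def representation_linop[OF B g f(2)] intro!: sum.cong)
  finally show ?thesis .
qed

text \<open>Both traces equal the double sum of
  \<open>representation C b c * representation B (f c) b\<close>, so the trace depends only on the
  common span.\<close>

lemma tr_basis_change:
  assumes B: "independent B" and C: "independent C" and BC: "span B = span C"
    and f: "linop f" "\<And>b. b \<in> B \<Longrightarrow> f b \<in> span B"
  shows "tr B f = tr C f"
proof -
  have fs: "f v \<in> span B" if "v \<in> span B" for v
    using linop_span[OF f(1,2) subspace_span that] by blast
  have CB: "c \<in> span B" if "c \<in> C" for c using that BC span_base by blast
  have b1: "representation B (f b) b = (\<Sum>c\<in>C. representation C b c * representation B (f c) b)"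
    if "b \<in> B" for b
  proof -
    have bC: "b \<in> span C" using that BC span_base by blast
    have "f b = f (\<Sum>c\<in>C. sc (representation C b c) c)" using span_expand[OF C bC] by simp
    also have "\<dots> = (\<Sum>c\<in>C. sc (representation C b c) (f c))" by (simp add: lin_sum[OF f(1)] lin_scale[OF f(1)])
    finally show ?thesis using representation_combination[OF B, of C f] fs CB by simp
  qed
  have "tr B f = (\<Sum>b\<in>B. \<Sum>c\<in>C. representation C b c * representation B (f c) b)"
    unfolding tr_def using b1 by (auto intro!: sum.cong)
  also have "\<dots> = (\<Sum>c\<in>C. \<Sum>b\<in>B. representation B (f c) b * representation C b c)"
    by (subst sum.swap) (simp add: mult.commute)
  also have "\<dots> = (\<Sum>c\<in>C. representation C (f c) c)"
  proof (rule sum.cong[OF refl])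
    fix c assume c: "c \<in> C"
    have "f c = (\<Sum>b\<in>B. sc (representation B (f c) b) b)" using span_expand[OF B] fs CB c by blast
    then have "representation C (f c) c = representation C (\<Sum>b\<in>B. sc (representation B (f c) b) b) c" by simp
    also have "\<dots> = (\<Sum>b\<in>B. representation B (f c) b * representation C b c)"
      by (subst representation_combination[OF C, of B "\<lambda>x. x"]) (use BC span_base in auto)
    finally show "(\<Sum>b\<in>B. representation B (f c) b * representation C b c) = representation C (f c) c" by simp
  qed
  finally show ?thesis by (simp add: tr_def)
qed

lemma tr_add:
  assumes "independent B" "\<And>b. b \<in> B \<Longrightarrow> f b \<in> span B" "\<And>b. b \<in> B \<Longrightarrow> g b \<in> span B"
  shows "tr B (\<lambda>x. f x + g x) = tr B f + tr B g"
  using assms by (simp add: tr_def representation_add sum.distrib)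

lemma tr_diff:
  assumes "independent B" "\<And>b. b \<in> B \<Longrightarrow> f b \<in> span B" "\<And>b. b \<in> B \<Longrightarrow> g b \<in> span B"
  shows "tr B (\<lambda>x. f x - g x) = tr B f - tr B g"
  using assms by (simp add: tr_def representation_diff sum_subtractf)

lemma tr_scale:
  assumes "independent B" "\<And>b. b \<in> B \<Longrightarrow> f b \<in> span B"
  shows "tr B (\<lambda>x. sc c (f x)) = c * tr B f"
  using assms by (simp add: tr_def representation_scale sum_distrib_left)

text \<open>Basis vectors outside \<open>C\<close> have no diagonal entry, because the image of
  \<open>f\<close> lies in \<open>span C\<close>.\<close>

lemma tr_subset:
  assumes B: "independent B" and CB: "C \<subseteq> B" and f: "\<And>b. b \<in> B \<Longrightarrow> f b \<in> span C"
  shows "tr B f = tr C f"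
proof -
  have rep: "representation B (f b) = representation C (f b)" if "b \<in> B" for b
    by (rule representation_extend[OF B f[OF that] CB])
  have "tr B f = (\<Sum>b\<in>B. representation C (f b) b)" by (simp add: tr_def rep)
  also have "\<dots> = (\<Sum>b\<in>C. representation C (f b) b)"
    using representation_ne_zero CB finiteI_independent[OF B]
    by (intro sum.mono_neutral_right) auto
  finally show ?thesis by (simp add: tr_def)
qed

lemma tr_Union:
  assumes B: "independent (\<Union>i\<in>I. B i)" and I: "finite I"
    and disj: "\<And>i j. i \<in> I \<Longrightarrow> j \<in> I \<Longrightarrow> i \<noteq> j \<Longrightarrow> B i \<inter> B j = {}"
    and f: "\<And>i b. i \<in> I \<Longrightarrow> b \<in> B i \<Longrightarrow> f b \<in> span (B i)"
  shows "tr (\<Union>i\<in>I. B i) f = (\<Sum>i\<in>I. tr (B i) f)"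
proof -
  have fin: "finite (B i)" if "i \<in> I" for i
    using finiteI_independent[OF B] that by (meson UN_upper finite_subset)
  have rep: "representation (\<Union>i\<in>I. B i) (f b) = representation (B i) (f b)" if "i \<in> I" "b \<in> B i" for i b
    by (rule representation_extend[OF B f[OF that]]) (use that in auto)
  show ?thesis unfolding tr_def
    by (subst sum.UNION_disjoint) (use I fin disj rep in \<open>auto intro!: sum.cong\<close>)
qed

text \<open>Induction on the exponent: the image of \<open>span B\<close> carries the whole trace by
  \<open>tr_subset\<close>, and the exponent drops by one on it.\<close>

lemma tr_nilpotent_uniform:
  assumes "independent B" "linop f" "\<And>b. b \<in> B \<Longrightarrow> f b \<in> span B" "\<And>v. v \<in> span B \<Longrightarrow> (f ^^ n) v = 0"
  shows "tr B f = 0"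
  using assms
proof (induction n arbitrary: B)
  case 0
  have "B = {}"
  proof (rule ccontr)
    assume "B \<noteq> {}"
    then obtain b where b: "b \<in> B" by auto
    then have "b = 0" using 0(4)[of b] span_base by auto
    then show False using b dependent_zero 0(1) by blast
  qed
  then show ?case by (simp add: tr_def)
next
  case (Suc n)
  have f: "linop f" by fact
  define N where "N = f ` span B"
  have NB: "N \<subseteq> span B" unfolding N_def
    using linop_span[OF f Suc.prems(3) subspace_span] by blast
  have sN: "subspace N" unfolding N_def
    using f by (simp add: Vector_Spaces.linear_iff_module_hom module_hom.subspace_image)
  obtain C where C: "C \<subseteq> N" "independent C" "span C = N"
    using basis_subspace_exists[OF sN] by metis
  have CB: "C \<subseteq> span B" using C NB by auto
  obtain D where D: "C \<subseteq> D" "D \<subseteq> span B" "independent D" "span B \<subseteq> span D"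
    using maximal_independent_subset_extend[OF CB C(2)] by blast
  have BD: "span B = span D" using D span_minimal[OF D(2) subspace_span] by blast
  have "tr B f = tr D f" by (rule tr_basis_change[OF Suc.prems(1) D(3) BD f Suc.prems(3)])
  also have "\<dots> = tr C f"
    by (rule tr_subset[OF D(3) D(1)]) (use C D N_def in auto)
  also have "\<dots> = 0"
  proof (rule Suc.IH[OF C(2) f])
    show "f b \<in> span C" if "b \<in> C" for b using C(3) CB that unfolding N_def by auto
    show "(f ^^ n) v = 0" if "v \<in> span C" for v
    proof -
      obtain u where "u \<in> span B" "v = f u" using C(3) \<open>v \<in> span C\<close> by (auto simp: N_def)
      then show ?thesis using Suc.prems(4)[of u] by (simp add: funpow_swap1)
    qed
  qed
  finally show ?case .
qed

section \<open>Nilpotent operators\<close>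

lemma funpow_zero_mono:
  assumes f: "linop f" and "(f ^^ n) v = 0" "n \<le> m"
  shows "(f ^^ m) v = 0"
proof -
  have "(f ^^ m) v = (f ^^ (m - n)) ((f ^^ n) v)"
    using assms(3) by (metis funpow_add comp_apply le_add_diff_inverse2)
  then show ?thesis using assms(2) lin_zero[OF lin_funpow[OF f]] by simp
qed

lemma subspace_nilpotent:
  assumes f: "linop f" shows "subspace {v. \<exists>n. (f ^^ n) v = 0}"
proof (rule subspaceI)
  show "0 \<in> {v. \<exists>n. (f ^^ n) v = 0}" by (auto intro: exI[of _ 0])
  fix x y assume "x \<in> {v. \<exists>n. (f ^^ n) v = 0}" "y \<in> {v. \<exists>n. (f ^^ n) v = 0}"
  then obtain n m where n: "(f ^^ n) x = 0" "(f ^^ m) y = 0" by auto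
  have "(f ^^ (max n m)) (x + y) = 0"
    using funpow_zero_mono[OF f n(1), of "max n m"] funpow_zero_mono[OF f n(2), of "max n m"]
    by (simp add: lin_add[OF lin_funpow[OF f]])
  then show "x + y \<in> {v. \<exists>n. (f ^^ n) v = 0}" by auto
next
  fix c x assume "x \<in> {v. \<exists>n. (f ^^ n) v = 0}"
  then show "sc c x \<in> {v. \<exists>n. (f ^^ n) v = 0}" by (auto simp: lin_scale[OF lin_funpow[OF f]])
qed

lemma nilpotent_uniform:
  assumes f: "linop f" and B: "finite B" "\<And>b. b \<in> B \<Longrightarrow> \<exists>n. (f ^^ n) b = 0"
  shows "\<exists>n. \<forall>v\<in>span B. (f ^^ n) v = 0"
proof -
  have "\<exists>n. \<forall>b\<in>B. (f ^^ n) b = 0" using B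
  proof (induction rule: finite_induct)
    case empty then show ?case by auto
  next
    case (insert x F)
    have "\<exists>n. \<forall>b\<in>F. (f ^^ n) b = 0" using insert.IH insert.prems by blast
    then obtain n where n: "\<forall>b\<in>F. (f ^^ n) b = 0" ..
    obtain m where m: "(f ^^ m) x = 0" using insert.prems by blast
    note nm = n m
    then have "\<forall>b\<in>insert x F. (f ^^ max n m) b = 0"
      using funpow_zero_mono[OF f, of n _ "max n m"] funpow_zero_mono[OF f, of m _ "max n m"] by auto
    then show ?case by blast
  qed
  then obtain n where n: "\<forall>b\<in>B. (f ^^ n) b = 0" by blast
  have "\<forall>v\<in>span B. (f ^^ n) v = 0"
    using linop_span[OF lin_funpow[OF f], of B n "{0}"] n by auto
  then show ?thesis by blast
qed

lemma tr_nilpotent: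
  assumes B: "independent B" and f: "linop f" "\<And>b. b \<in> B \<Longrightarrow> f b \<in> span B"
    and nil: "\<And>b. b \<in> B \<Longrightarrow> \<exists>n. (f ^^ n) b = 0"
  shows "tr B f = 0"
proof -
  obtain n where "\<forall>v\<in>span B. (f ^^ n) v = 0"
    using nilpotent_uniform[OF f(1) finiteI_independent[OF B] nil] by blast
  then show ?thesis using tr_nilpotent_uniform[OF B f] by blast
qed

section \<open>Generalized eigenspaces of a single operator\<close>

definition shift :: "('v \<Rightarrow> 'v) \<Rightarrow> complex \<Rightarrow> 'v \<Rightarrow> 'v" where
  "shift T c v = T v - sc c v"

definition gen_eigenspace :: "('v \<Rightarrow> 'v) \<Rightarrow> complex \<Rightarrow> 'v set" where
  "gen_eigenspace T c = {v. \<exists>n. (shift T c ^^ n) v = 0}"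

lemma linop_shift: "linop T \<Longrightarrow> linop (shift T c)"
  by (auto simp: Vector_Spaces.linear_iff shift_def algebra_simps)

lemma shift_0 [simp]: "shift T 0 = T" by (auto simp: shift_def)

lemma subspace_gen: "linop T \<Longrightarrow> subspace (gen_eigenspace T c)"
  unfolding gen_eigenspace_def by (rule subspace_nilpotent[OF linop_shift])

lemma gen_shift: assumes T: "linop T" shows "shift T c v \<in> gen_eigenspace T c \<longleftrightarrow> v \<in> gen_eigenspace T c"
proof
  assume "shift T c v \<in> gen_eigenspace T c"
  then obtain n where "(shift T c ^^ n) (shift T c v) = 0" by (auto simp: gen_eigenspace_def)
  then have "(shift T c ^^ Suc n) v = 0" by (simp add: funpow_swap1)
  then show "v \<in> gen_eigenspace T c" unfolding gen_eigenspace_def by blast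
next
  assume "v \<in> gen_eigenspace T c"
  then obtain n where "(shift T c ^^ n) v = 0" by (auto simp: gen_eigenspace_def)
  then have "(shift T c ^^ n) (shift T c v) = 0"
    using lin_zero[OF linop_shift[OF T]] by (metis funpow_swap1)
  then show "shift T c v \<in> gen_eigenspace T c" unfolding gen_eigenspace_def by blast
qed

lemma gen_invariant: assumes T: "linop T" and v: "v \<in> gen_eigenspace T c" shows "T v \<in> gen_eigenspace T c"
proof -
  have "T v = shift T c v + sc c v" by (simp add: shift_def)
  then show ?thesis using gen_shift[OF T] v subspace_gen[OF T] by (metis subspace_add subspace_scale)
qed

text \<open>On the generalized eigenspace of \<mu> the operator \<open>T - \<nu>\<close> is a
  nonzero scalar plus a nilpotent, hence invertible. The preimage is built by induction on the
  exponent and therefore never leaves the invariant subspace \<open>M\<close>.\<close>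

lemma gen_invert:
  assumes T: "linop T" and M: "subspace M" "\<And>v. v \<in> M \<Longrightarrow> T v \<in> M" and ne: "\<mu> \<noteq> \<nu>"
    and w: "w \<in> gen_eigenspace T \<mu>" "w \<in> M"
  shows "\<exists>u \<in> gen_eigenspace T \<mu> \<inter> M. shift T \<nu> u = w"
proof -
  obtain n where "(shift T \<mu> ^^ n) w = 0" using w by (auto simp: gen_eigenspace_def)
  then show ?thesis using w
  proof (induction n arbitrary: w)
    case 0
    have "shift T \<nu> 0 = w" using 0 by (simp add: lin_zero[OF linop_shift[OF T]])
    moreover have "0 \<in> gen_eigenspace T \<mu> \<inter> M" using subspace_gen[OF T] M by (simp add: subspace_0)
    ultimately show ?case by blast
  next
    case (Suc n)
    let ?w = "shift T \<mu> w" and ?d = "inverse (\<mu> - \<nu>)"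
    have "?w \<in> M" using Suc.prems M by (simp add: shift_def subspace_diff subspace_scale)
    moreover have "?w \<in> gen_eigenspace T \<mu>" using Suc.prems gen_shift[OF T] by blast
    moreover have "(shift T \<mu> ^^ n) ?w = 0" using Suc.prems(1) by (simp add: funpow_swap1)
    ultimately obtain u where u: "u \<in> gen_eigenspace T \<mu> \<inter> M" "shift T \<nu> u = ?w" using Suc.IH by blast
    \<comment> \<open>Solves the equation because \<open>shift T \<nu> w\<close> is
      \<open>?w\<close> plus \<open>(\<mu> - \<nu>)\<close> times \<open>w\<close>, and
      \<open>u\<close> was chosen to cancel \<open>?w\<close>.\<close>
    let ?u = "sc ?d (w - u)"
    have "?u \<in> gen_eigenspace T \<mu> \<inter> M" using u Suc.prems subspace_gen[OF T] M
      by (simp add: subspace_diff subspace_scale)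
    moreover have "shift T \<nu> ?u = w"
    proof -
      have "shift T \<nu> w = ?w + sc (\<mu> - \<nu>) w" by (simp add: shift_def scale_left_diff_distrib)
      then have "shift T \<nu> ?u = sc ?d (sc (\<mu> - \<nu>) w)"
        using u(2) by (simp add: lin_scale[OF linop_shift[OF T]] lin_diff[OF linop_shift[OF T]])
      then show ?thesis using ne by simp
    qed
    ultimately show ?case by blast
  qed
qed

text \<open>The last nonzero vector among the iterates of \<open>w\<close> under
  \<open>shift T c\<close> is an eigenvector.\<close>

lemma shift_kernel_exists:
  assumes T: "linop T" and M: "subspace M" "\<And>v. v \<in> M \<Longrightarrow> T v \<in> M" and w: "w \<in> gen_eigenspace T c" "w \<in> M" "w \<noteq> 0"
  shows "\<exists>u\<in>M. u \<noteq> 0 \<and> T u = sc c u"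
proof -
  define n where "n = (LEAST n. (shift T c ^^ n) w = 0)"
  obtain k where "(shift T c ^^ k) w = 0" using w by (auto simp: gen_eigenspace_def)
  then have n: "(shift T c ^^ n) w = 0" unfolding n_def by (rule LeastI)
  then obtain m where m: "n = Suc m" using \<open>w \<noteq> 0\<close> by (cases n) auto
  define u where "u = (shift T c ^^ m) w"
  have u0: "u \<noteq> 0" using not_less_Least[of m "\<lambda>n. (shift T c ^^ n) w = 0"] m unfolding u_def n_def by auto
  have su: "shift T c u = 0" using n m by (simp add: u_def)
  have "(shift T c ^^ j) w \<in> M" for j
    by (induction j) (use w M in \<open>auto simp: shift_def subspace_diff subspace_scale\<close>)
  then show ?thesis using u0 su by (auto simp: shift_def u_def)
qed

text \<open>A common nonzero vector would produce an eigenvector for \<nu> on which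
  \<open>shift T \<mu>\<close> is multiplication by the nonzero scalar \<open>\<nu> - \<mu>\<close>,
  which is not nilpotent.\<close>

lemma gen_injective:
  assumes T: "linop T" and ne: "\<mu> \<noteq> \<nu>" and w: "w \<in> gen_eigenspace T \<mu>" and z: "w \<in> gen_eigenspace T \<nu>"
  shows "w = 0"
proof (rule ccontr)
  assume "w \<noteq> 0"
  then obtain u where u: "u \<in> gen_eigenspace T \<mu>" "u \<noteq> 0" "T u = sc \<nu> u"
    using shift_kernel_exists[OF T subspace_gen[OF T] gen_invariant[OF T] z w] by blast
  have "shift T \<mu> u = sc (\<nu> - \<mu>) u" using u(3) by (simp add: shift_def scale_left_diff_distrib)
  then have "(shift T \<mu> ^^ j) u = sc ((\<nu> - \<mu>) ^ j) u" for j
    by (induction j) (auto simp: lin_scale[OF linop_shift[OF T]] mult.commute)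
  then show False using u ne by (auto simp: gen_eigenspace_def)
qed

section \<open>Annihilating polynomials and the primary decomposition\<close>

definition poly_app :: "('v \<Rightarrow> 'v) \<Rightarrow> complex poly \<Rightarrow> 'v \<Rightarrow> 'v" where
  "poly_app T p v = (\<Sum>i\<le>degree p. sc (coeff p i) ((T ^^ i) v))"

lemma papp_bound: assumes "degree p \<le> n" shows "poly_app T p v = (\<Sum>i\<le>n. sc (coeff p i) ((T ^^ i) v))"
  unfolding poly_app_def using assms
  by (intro sum.mono_neutral_left) (auto simp: coeff_eq_0)

lemma papp_linear_factor:
  assumes T: "linop T"
  shows "poly_app T ([:-c, 1:] * q) v = poly_app T q (shift T c v)"
proof -
  define n where "n = degree q"
  have cq: "coeff q (Suc n) = 0" by (simp add: n_def coeff_eq_0)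
  have "poly_app T ([:-c, 1:] * q) v = (\<Sum>i\<le>Suc n. sc (coeff ([:-c, 1:] * q) i) ((T ^^ i) v))"
    by (rule papp_bound, rule order.trans[OF degree_mult_le]) (simp add: n_def)
  also have "\<dots> = (\<Sum>i\<le>Suc n. sc (coeff (pCons 0 q) i) ((T ^^ i) v)) - (\<Sum>i\<le>Suc n. sc (c * coeff q i) ((T ^^ i) v))"
  proof -
    have "coeff ([:-c, 1:] * q) i = coeff (pCons 0 q) i - c * coeff q i" for i by simp
    then show ?thesis by (simp only: scale_left_diff_distrib sum_subtractf)
  qed
  also have "(\<Sum>i\<le>Suc n. sc (coeff (pCons 0 q) i) ((T ^^ i) v)) = (\<Sum>i\<le>n. sc (coeff q i) ((T ^^ i) (T v)))"
    by (subst sum.atMost_Suc_shift) (simp add: funpow_swap1)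
  also have "(\<Sum>i\<le>Suc n. sc (c * coeff q i) ((T ^^ i) v)) = (\<Sum>i\<le>n. sc (coeff q i) ((T ^^ i) (sc c v)))"
    using cq by (simp add: lin_scale[OF lin_funpow[OF T]] mult.commute)
  finally show ?thesis
    by (simp add: poly_app_def n_def shift_def lin_diff[OF lin_funpow[OF T]] scale_right_diff_distrib sum_subtractf)
qed

text \<open>The vectors \<open>v\<close>, \<open>T v\<close>, ... up to the power given by the
  dimension are one too many to be independent.\<close>

lemma annihilating_poly:
  assumes T: "linop T" shows "\<exists>p. p \<noteq> 0 \<and> poly_app T p v = 0"
proof -
  define n where "n = card basis"
  let ?f = "\<lambda>i. (T ^^ i) v"
  show ?thesis
  \<comment> \<open>Dependence is a property of sets, so a repetition among the powers is invisible
    to it and has to be turned into a polynomial separately.\<close>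
  proof (cases "inj_on ?f {..n}")
    case False
    then obtain i j where ij: "i < j" "?f i = ?f j" unfolding inj_on_def by (metis linorder_neqE_nat)
    let ?p = "monom 1 j - monom 1 i :: complex poly"
    have "coeff ?p j = 1" using ij by simp
    then have "?p \<noteq> 0" by (metis coeff_0 zero_neq_one)
    moreover have "poly_app T ?p v = 0"
    proof -
      have "degree ?p \<le> j" using ij by (intro degree_diff_le) (auto simp: degree_monom_eq)
      then have "poly_app T ?p v = (\<Sum>k\<le>j. sc (coeff ?p k) (?f k))" by (rule papp_bound)
      also have "\<dots> = (\<Sum>k\<le>j. (if k = j then ?f j else 0) - (if k = i then ?f i else 0))"
        by (intro sum.cong) (auto simp: coeff_monom)
      also have "\<dots> = 0" using ij by (simp add: sum_subtractf)
      finally show ?thesis .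
    qed
    ultimately show ?thesis by blast
  next
    case True
    then have "card (?f ` {..n}) = Suc n" by (simp add: card_image)
    then have "dependent (?f ` {..n})"
      using dependent_biggerset_general[of "?f ` {..n}"] dim_subset_UNIV[of "?f ` {..n}"]
      by (simp add: n_def dimension_def)
    then obtain u w where u: "(\<Sum>w\<in>?f ` {..n}. sc (u w) w) = 0" "w \<in> ?f ` {..n}" "u w \<noteq> 0"
      using dependent_finite[of "?f ` {..n}"] by auto
    let ?p = "\<Sum>i\<le>n. monom (u (?f i)) i"
    have c: "coeff ?p k = (if k \<le> n then u (?f k) else 0)" for k
      by (simp add: coeff_sum coeff_monom)
    obtain i where i: "i \<le> n" "w = ?f i" using u by auto
    have "?p \<noteq> 0" using c[of i] i u by (metis coeff_0)
    moreover have "poly_app T ?p v = (\<Sum>i\<le>n. sc (u (?f i)) (?f i))"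
      by (subst papp_bound[of _ n]) (auto simp: c intro!: degree_le)
    then have "poly_app T ?p v = 0" using u(1) True by (simp add: sum.reindex)
    ultimately show ?thesis by blast
  qed
qed

text \<open>Over the complex numbers an annihilating polynomial of \<open>v\<close> has a linear
  factor. Removing it with \<open>papp_linear_factor\<close> replaces \<open>v\<close> by
  \<open>shift T c v\<close>, so it suffices to lift membership in the span back from
  \<open>shift T c v\<close> to \<open>v\<close>.\<close>

lemma gen_span:
  assumes T: "linop T" and M: "subspace M" "\<And>v. v \<in> M \<Longrightarrow> T v \<in> M" and v: "v \<in> M"
  shows "v \<in> span (\<Union>c. gen_eigenspace T c \<inter> M)"
proof -
  let ?S = "\<Union>c. gen_eigenspace T c \<inter> M"
  obtain p where p: "p \<noteq> 0" "poly_app T p v = 0" using annihilating_poly[OF T] by blast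
  have lift: "v \<in> span ?S" if w: "shift T c v \<in> span ?S" and vM: "v \<in> M" for c v
  proof -
    \<comment> \<open>Modulo the generalized eigenspace of \<open>c\<close>, every element of the
      span is an image under \<open>shift T c\<close>: parts for other eigenvalues have preimages by
      \<open>gen_invert\<close>, and the part for \<open>c\<close> goes into the remainder.\<close>
    have ex: "\<exists>u\<in>span ?S. w - shift T c u \<in> gen_eigenspace T c \<inter> M" if "w \<in> span ?S" for w using that
    proof (induction rule: span_induct_alt)
      case base
      show ?case using span_zero subspace_0[OF M(1)] subspace_0[OF subspace_gen[OF T]]
        by (intro bexI[of _ 0]) (auto simp: lin_zero[OF linop_shift[OF T]])
    next
      case (step k x y)
      then obtain u where u: "u \<in> span ?S" "y - shift T c u \<in> gen_eigenspace T c \<inter> M" by blast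
      obtain \<mu> where mu: "x \<in> gen_eigenspace T \<mu>" "x \<in> M" using step by auto
      show ?case
      proof (cases "\<mu> = c")
        case True
        have "sc k x + y - shift T c u = sc k x + (y - shift T c u)" by simp
        also have "\<dots> \<in> gen_eigenspace T c \<inter> M"
          using u mu True M subspace_gen[OF T] by (auto intro!: subspace_add subspace_scale)
        finally show ?thesis using u by blast
      next
        case False
        then obtain x' where x': "x' \<in> gen_eigenspace T \<mu> \<inter> M" "shift T c x' = x"
          using gen_invert[OF T M _ mu] by blast
        have eq: "sc k x + y - shift T c (sc k x' + u) = y - shift T c u"
          using x' by (simp add: lin_add[OF linop_shift[OF T]] lin_scale[OF linop_shift[OF T]])
        have "x' \<in> span ?S" by (rule span_base) (use x' in blast)
        then have "sc k x' + u \<in> span ?S" using u by (intro span_add span_scale)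
        then show ?thesis using u(2) unfolding eq[symmetric] by (rule bexI[rotated])
      qed
    qed
    from ex[OF w] obtain u where u: "u \<in> span ?S" "shift T c v - shift T c u \<in> gen_eigenspace T c \<inter> M" by (elim bexE)
    have "v - u \<in> gen_eigenspace T c" using u gen_shift[OF T] by (simp add: lin_diff[OF linop_shift[OF T], symmetric])
    moreover have "?S \<subseteq> M" by blast
    then have "u \<in> M" using u(1) span_minimal[OF _ M(1)] by blast
    then have "v - u \<in> M" using vM M(1) by (simp add: subspace_diff)
    ultimately have "v - u \<in> span ?S" by (intro span_base) blast
    then have "v - u + u \<in> span ?S" using u(1) by (rule span_add)
    then show ?thesis by simp
  qed
  have "\<forall>p v. degree p = n \<longrightarrow> p \<noteq> 0 \<longrightarrow> poly_app T p v = 0 \<longrightarrow> v \<in> M \<longrightarrow> v \<in> span ?S" for n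
  proof (induction n)
    case 0
    show ?case
    proof (intro allI impI)
      fix p v assume p: "degree p = 0" "p \<noteq> 0" "poly_app T p v = 0" "v \<in> M"
      then have "coeff p 0 \<noteq> 0" by (metis leading_coeff_0_iff)
      then have "v = 0" using p by (auto simp: poly_app_def)
      then show "v \<in> span ?S" using span_zero by simp
    qed
  next
    case (Suc n)
    show ?case
    proof (intro allI impI)
      fix p v assume p: "degree p = Suc n" "p \<noteq> 0" "poly_app T p v = 0" "v \<in> M"
      have "\<not> constant (poly p)" using p by (simp add: constant_degree)
      then obtain c where "poly p c = 0" using fundamental_theorem_of_algebra by blast
      then obtain q where q: "p = [:-c, 1:] * q" by (metis poly_eq_0_iff_dvd dvdE)
      then have q0: "q \<noteq> 0" using p by auto
      then have "degree q = n" using p q by (simp add: degree_mult_eq del: mult_pCons_left)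
      moreover have "poly_app T q (shift T c v) = 0" using p q papp_linear_factor[OF T] by metis
      moreover have "shift T c v \<in> M" using p M by (simp add: shift_def subspace_diff subspace_scale)
      ultimately have "shift T c v \<in> span ?S" using Suc.IH q0 by blast
      then show "v \<in> span ?S" using lift p by blast
    qed
  qed
  then show ?thesis using p v by blast
qed

text \<open>\<open>T - c\<close> is nilpotent on \<open>span B\<close>, so it has trace zero and
  only the scalar contributes.\<close>

lemma tr_eigenvalue:
  assumes B: "independent B" and T: "linop T" "\<And>b. b \<in> B \<Longrightarrow> T b \<in> span B"
    and g: "B \<subseteq> gen_eigenspace T c"
  shows "tr B T = c * of_nat (card B)"
proof -
  have "tr B (shift T c) = 0"
    by (rule tr_nilpotent[OF B linop_shift[OF T(1)]])
      (use T(2) g in \<open>auto simp: shift_def gen_eigenspace_def intro: span_diff span_scale span_base\<close>)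
  then have "tr B T = tr B (\<lambda>v. sc c v)"
    unfolding shift_def using tr_diff[OF B, of T "\<lambda>v. sc c v"] T(2) by (simp add: span_scale span_base)
  also have "\<dots> = c * tr B (\<lambda>v. v)" using tr_scale[OF B, of "\<lambda>v. v" c] span_base by blast
  also have "tr B (\<lambda>v. v) = of_nat (card B)"
    by (simp add: tr_def representation_basis[OF B])
  finally show ?thesis .
qed

text \<open>A basis of \<open>S\<close> together with \<open>v\<close> is independent, so a
  functional may be prescribed as 0 on the former and 1 on the latter.\<close>

lemma subspace_proper_functional:
  assumes "subspace S" "v \<notin> S"
  shows "\<exists>f. linfun f \<and> (\<forall>x\<in>S. f x = 0) \<and> f v = 1"
proof -
  obtain B where B: "B \<subseteq> S" "independent B" "span B = S"
    using basis_subspace_exists[OF assms(1)] by metis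
  have ind: "independent (insert v B)" using B assms by (intro independent_insertI) auto
  interpret vp: vector_space_pair sc "(*) :: complex \<Rightarrow> complex \<Rightarrow> complex"
    by (intro vector_space_pair.intro vector_space_times vector_space_axioms)
  obtain g where g: "linfun g" "\<forall>x\<in>insert v B. g x = (if x = v then 1 else 0)"
    using vp.linear_independent_extend[OF ind, of "\<lambda>x. if x = v then 1 else 0"] by blast
  have "g x = 0" if "x \<in> S" for x
  proof -
    have "x \<in> span B" using B that by simp
    then show ?thesis
    proof (induction rule: span_induct_alt)
      case base show ?case by (rule lin_zero[OF g(1)])
    next
      case (step c x y)
      then have "x \<noteq> v" using B assms by auto
      then show ?case using step g by (simp add: lin_add[OF g(1)] lin_scale[OF g(1)])
    qed
  qed
  then show ?thesis using g by auto
qed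

lemma functionals_separate: assumes "\<And>f. linfun f \<Longrightarrow> f x = f y" shows "x = y"
proof (rule ccontr)
  assume "x \<noteq> y"
  then obtain f where f: "linfun f" "f (x - y) = 1"
    using subspace_proper_functional[of "{0}" "x - y"] by auto
  then show False using assms[of f] by (simp add: lin_diff)
qed

end

section \<open>Cartan subalgebras are abelian\<close>

context complex_lie_algebra
begin

sublocale fin_dim_cspace sc
  by unfold_locales (rule finite_dim)

lemma br_left: "br (x + y) z = br x z + br y z" "br (sc c x) z = sc c (br x z)" "br 0 z = 0"
  "br (- x) z = - br x z" "br (x - y) z = br x z - br y z"
  using lin_add[OF linear_left[of z]] lin_scale[OF linear_left[of z]] lin_zero[OF linear_left[of z]]
    lin_neg[OF linear_left[of z]] lin_diff[OF linear_left[of z]] by auto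

lemma br_right: "br x (y + z) = br x y + br x z" "br x (sc c y) = sc c (br x y)" "br x 0 = 0"
  "br x (- y) = - br x y" "br x (y - z) = br x y - br x z"
  using lin_add[OF linear_right[of x]] lin_scale[OF linear_right[of x]] lin_zero[OF linear_right[of x]]
    lin_neg[OF linear_right[of x]] lin_diff[OF linear_right[of x]] by auto

lemma br_antisym: "br x y = - br y x"
proof -
  have "br (x + y) (x + y) = br x y + br y x"
    unfolding br_left br_right by (simp add: alternating)
  then show ?thesis using alternating[of "x + y"] by (simp add: eq_neg_iff_add_eq_0)
qed

lemma br_br: "br (br x y) z = br x (br y z) - br y (br x z)"
proof -
  have "br (br x y) z = - br z (br x y)" by (rule br_antisym)
  also have "\<dots> = br x (br y z) + br y (br z x)"
    using jacobi[of x y z] by (simp add: algebra_simps eq_neg_iff_add_eq_0 neg_eq_iff_add_eq_0)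
  also have "br y (br z x) = - br y (br x z)"
    by (subst br_antisym[of z x]) (simp add: br_right)
  finally show ?thesis by simp
qed

abbreviation "kf \<equiv> killing sc br"

lemma kf_tr: "kf x y = tr basis (\<lambda>z. br x (br y z))"
  by (simp add: killing_def endo_trace_eq)

lemma linop_br: "linop (br x)" by (rule linear_right)

lemma linop_br2: "linop (\<lambda>z. br x (br y z))"
  by (rule lin_compose[OF linop_br linop_br])

lemma span_basis_iff [simp]: "x \<in> span basis" by (simp add: span_basis)

lemma kf_sym: "kf x y = kf y x"
  unfolding kf_tr by (rule tr_comm[OF independent_basis linop_br _ linop_br]) auto

lemma kf_left: "kf (x + y) z = kf x z + kf y z" "kf (sc c x) z = c * kf x z"
  unfolding kf_tr br_left
  by (rule tr_add[OF independent_basis] tr_scale[OF independent_basis]; simp)+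

lemma linfun_kf_left: "linfun (\<lambda>x. kf x y)"
  by (auto simp: Vector_Spaces.linear_iff kf_left vector_space_axioms vector_space_times)

lemma linfun_kf: "linfun (kf x)"
proof -
  have "kf x = (\<lambda>y. kf y x)" by (rule ext) (rule kf_sym)
  then show ?thesis using linfun_kf_left[of x] by simp
qed

lemma kf_right: "kf x (y + z) = kf x y + kf x z" "kf x (sc c y) = c * kf x y" "kf x 0 = 0"
    "kf x (- y) = - kf x y" "kf x (y - z) = kf x y - kf x z"
  using linfun_kf[of x] by (auto simp: lin_add lin_scale lin_zero lin_neg lin_diff)

lemma kf_left': "kf 0 x = 0" "kf (- y) x = - kf y x" "kf (y - z) x = kf y x - kf z x"
  using lin_zero[OF linfun_kf_left[of x]] lin_neg[OF linfun_kf_left[of x]] lin_diff[OF linfun_kf_left[of x]]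
  by auto

lemma kf_invariant: "kf (br x y) z = kf x (br y z)"
proof -
  have X: "kf (br x y) z = tr basis (\<lambda>v. br x (br y (br z v))) - tr basis (\<lambda>v. br y (br x (br z v)))"
    unfolding kf_tr br_br by (rule tr_diff[OF independent_basis]; simp)
  have "kf x (br y z) = tr basis (\<lambda>v. br x (br y (br z v))) - tr basis (\<lambda>v. br x (br z (br y v)))"
    unfolding kf_tr br_br br_right by (rule tr_diff[OF independent_basis]; simp)
  moreover have "tr basis (\<lambda>v. br x (br z (br y v))) = tr basis (\<lambda>v. br y (br x (br z v)))"
    by (rule tr_comm[OF independent_basis linop_br2 _ linop_br]) auto
  ultimately show ?thesis using X by simp
qed

lemma comm_nilpotent:
  assumes f: "linop f" and g: "linop g" and fg: "\<And>v. f (g v) = g (f v)" and n: "(f ^^ n) v = 0"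
  shows "((\<lambda>v. f (g v)) ^^ n) v = 0"
proof -
  have c: "f ((g ^^ k) u) = (g ^^ k) (f u)" for k u
    by (induction k) (auto simp: fg)
  have "((\<lambda>v. f (g v)) ^^ k) u = (g ^^ k) ((f ^^ k) u)" for k u
    by (induction k) (auto simp: fg c)
  then show ?thesis using n lin_zero[OF lin_funpow[OF g]] by simp
qed

end

text \<open>Simplicity enters the structure theory only in the form of nondegeneracy of the Killing
  form.\<close>

locale cartan_algebra = complex_lie_algebra sc br
  for sc :: "complex \<Rightarrow> 'g::ab_group_add \<Rightarrow> 'g" and br :: "'g \<Rightarrow> 'g \<Rightarrow> 'g" +
  fixes H :: "'g set"
  assumes cartan: "cartan_subalgebra sc br H"
    and kf_nondegenerate: "(\<And>y. killing sc br x y = 0) \<Longrightarrow> x = 0"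
begin

lemma subspace_H: "subspace H"
  and H_closed: "x \<in> H \<Longrightarrow> y \<in> H \<Longrightarrow> br x y \<in> H"
  and H_nilpotent: "\<exists>k. lower_central sc br H k = {0}"
  and H_normalizer: "(\<And>y. y \<in> H \<Longrightarrow> br x y \<in> H) \<Longrightarrow> x \<in> H"
  using cartan by (auto simp: cartan_subalgebra_def)

section \<open>Simultaneous generalized eigenspaces of the Cartan subalgebra\<close>

abbreviation "lc \<equiv> lower_central sc br H"

lemma lc_step: "x \<in> H \<Longrightarrow> y \<in> lc k \<Longrightarrow> br x y \<in> lc (Suc k)"
  by (auto intro!: span_base)

lemma lc_subset_H: "lc k \<subseteq> H"
proof (induction k)
  case (Suc k)
  then show ?case unfolding lower_central.simps
    by (intro span_minimal[OF _ subspace_H]) (auto intro: H_closed)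
qed simp

text \<open>Bracketing with \<open>H\<close> moves one step down the lower central series, which
  ends in zero. A property of \<open>y\<close> in \<open>H\<close> may thus be proved assuming it
  for all brackets \<open>br x y\<close>; the auxiliary \<open>d\<close> bounds the distance to the
  end of the series.\<close>

lemma lc_descending_induct [consumes 1, case_names zero step]:
  assumes "y \<in> lc j" and "Q 0" and "\<And>j y. y \<in> lc j \<Longrightarrow> (\<And>x. x \<in> H \<Longrightarrow> Q (br x y)) \<Longrightarrow> Q y"
  shows "Q y"
proof -
  obtain K where K: "lc K = {0}" using H_nilpotent by blast
  have "\<forall>j y. K \<le> j + d \<longrightarrow> y \<in> lc j \<longrightarrow> Q y" for d
  proof (induction d)
    case 0
    have "lc (K + i) = {0}" for i
    proof (induction i)
      case (Suc i)
      have "{br x y | x y. x \<in> H \<and> y \<in> lc (K + i)} \<subseteq> {0}" unfolding Suc by (auto simp: br_right)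
      then have "span {br x y | x y. x \<in> H \<and> y \<in> lc (K + i)} \<subseteq> {0}"
        by (rule span_minimal[OF _ subspace_single_0])
      then show ?case using span_zero by (auto simp del: span_eq_iff)
    qed (use K in simp)
    then have "lc j = {0}" if "K \<le> j" for j using that by (metis le_iff_add)
    then show ?case using assms(2) by auto
  next
    case (Suc d)
    show ?case
    proof (intro allI impI)
      fix j y assume j: "K \<le> j + Suc d" "y \<in> lc j"
      show "Q y"
      proof (rule assms(3)[OF j(2)])
        fix x assume "x \<in> H"
        then have "br x y \<in> lc (Suc j)" using lc_step j by blast
        then show "Q (br x y)" using Suc.IH j(1) by (metis add_Suc_shift)
      qed
    qed
  qed
  then show ?thesis using assms(1) by (metis le_add2)
qed

text \<open>Commuting \<open>br y\<close> past \<open>shift (br x) c\<close> costs a term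
  \<open>br (br x y) v\<close>. The outer induction along the lower central series handles that
  term, the inner one on the exponent handles \<open>shift (br x) c v\<close>.\<close>

lemma gen_H_invariant:
  assumes x: "x \<in> H" and y: "y \<in> H" and v: "v \<in> gen_eigenspace (br x) c"
  shows "br y v \<in> gen_eigenspace (br x) c"
proof -
  have "y \<in> lc 0" using y by simp
  then have "\<forall>v\<in>gen_eigenspace (br x) c. br y v \<in> gen_eigenspace (br x) c"
  proof (induction rule: lc_descending_induct)
    case zero
    show ?case using subspace_0[OF subspace_gen[OF linop_br]] by (simp add: br_left)
  next
    case (step j y)
    have "\<forall>v. (shift (br x) c ^^ n) v = 0 \<longrightarrow> br y v \<in> gen_eigenspace (br x) c" for n
    proof (induction n)
      case 0
      show ?case using subspace_0[OF subspace_gen[OF linop_br]] by (simp add: br_right)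
    next
      case (Suc n)
      show ?case
      proof (intro allI impI)
        fix v assume v: "(shift (br x) c ^^ Suc n) v = 0"
        then have "v \<in> gen_eigenspace (br x) c" unfolding gen_eigenspace_def by blast
        then have 1: "br (br x y) v \<in> gen_eigenspace (br x) c" using step(2)[OF x] by blast
        have 2: "br y (shift (br x) c v) \<in> gen_eigenspace (br x) c"
          using Suc v by (auto simp: funpow_swap1)
        have "shift (br x) c (br y v) = br (br x y) v + br y (shift (br x) c v)"
          by (simp add: shift_def br_right br_br)
        then show "br y v \<in> gen_eigenspace (br x) c"
          using 1 2 gen_shift[OF linop_br] subspace_add[OF subspace_gen[OF linop_br]] by metis
      qed
    qed
    then show ?case unfolding gen_eigenspace_def[of "br x" c] by blast
  qed
  then show ?thesis using v by blast
qed

definition H_invariant :: "'g set \<Rightarrow> bool" where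
  "H_invariant M \<longleftrightarrow> subspace M \<and> (\<forall>x\<in>H. \<forall>v\<in>M. br x v \<in> M)"

text \<open>Each element of \<open>H\<close> has a single generalized eigenvalue on
  \<open>M\<close>. How the eigenvalue depends on the element is left open here; its linearity
  follows later from traces.\<close>

definition primary :: "'g set \<Rightarrow> bool" where
  "primary M \<longleftrightarrow> H_invariant M \<and> (\<forall>x\<in>H. \<exists>c. M \<subseteq> gen_eigenspace (br x) c)"

text \<open>Induction on dimension: if \<open>x\<close> has no single eigenvalue on
  \<open>M\<close>, its generalized eigenspaces in \<open>M\<close> are proper, invariant by
  \<open>gen_H_invariant\<close>, and together span \<open>M\<close>.\<close>

lemma span_primary: "H_invariant M \<Longrightarrow> M \<subseteq> span (\<Union>{N. primary N})"
proof (induction "dim M" arbitrary: M rule: less_induct)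
  case less
  have sM: "subspace M" using less.prems by (simp add: H_invariant_def)
  show ?case
  proof (cases "primary M")
    case True
    then show ?thesis using span_superset[of "\<Union>{N. primary N}"] by blast
  next
    case False
    then obtain x where x: "x \<in> H" "\<And>c. \<not> M \<subseteq> gen_eigenspace (br x) c"
      using less.prems unfolding primary_def by blast
    have "gen_eigenspace (br x) c \<inter> M \<subseteq> span (\<Union>{N. primary N})" for c
    proof (rule less.hyps)
      show inv: "H_invariant (gen_eigenspace (br x) c \<inter> M)"
        using less.prems gen_H_invariant[OF x(1)] subspace_gen[OF linop_br] subspace_inter
        unfolding H_invariant_def by blast
      have "gen_eigenspace (br x) c \<inter> M \<subset> M" using x(2)[of c] by blast
      then show "dim (gen_eigenspace (br x) c \<inter> M) < dim M"
        using inv sM by (intro dim_psubset) (simp only: H_invariant_def span_eq_iff[THEN iffD2])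
    qed
    then have "span (\<Union>c. gen_eigenspace (br x) c \<inter> M) \<subseteq> span (\<Union>{N. primary N})"
      by (intro span_minimal subspace_span) blast
    moreover have "M \<subseteq> span (\<Union>c. gen_eigenspace (br x) c \<inter> M)"
      using gen_span[OF linop_br sM] less.prems x(1) unfolding H_invariant_def by blast
    ultimately show ?thesis by blast
  qed
qed

lemma hinv_UNIV: "H_invariant UNIV" by (simp add: H_invariant_def)

lemma H_gen_0: assumes "x \<in> H" shows "H \<subseteq> gen_eigenspace (br x) 0"
proof
  fix y assume y: "y \<in> H"
  obtain k where k: "lc k = {0}" using H_nilpotent by blast
  have "(br x ^^ j) y \<in> lc j" for j
  proof (induction j)
    case (Suc j)
    show ?case using lc_step[OF assms Suc] by simp
  qed (use y in simp)
  then have "(br x ^^ k) y = 0" using k by blast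
  then show "y \<in> gen_eigenspace (br x) 0" unfolding gen_eigenspace_def by auto
qed

text \<open>Engel's theorem modulo \<open>H\<close>: in a minimal invariant \<open>M\<close> strictly containing \<open>H\<close>, the vectors that an
  element of the lower central series maps into \<open>H\<close> form an invariant subspace, hence all of \<open>M\<close>, by
  induction from the end of the series.\<close>
lemma hinv_nil_subset_H:
  assumes N: "H_invariant N" "\<And>x. x \<in> H \<Longrightarrow> N \<subseteq> gen_eigenspace (br x) 0"
  shows "N \<subseteq> H"
proof (rule ccontr)
  assume nN: "\<not> N \<subseteq> H"
  define Z where "Z = {v. \<forall>x\<in>H. v \<in> gen_eigenspace (br x) 0}"
  have sZ: "subspace Z" using subspace_gen[OF linop_br]
    unfolding Z_def by (auto simp: subspace_def)
  define good where "good M \<longleftrightarrow> H_invariant M \<and> H \<subset> M \<and> M \<subseteq> Z" for M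
  define M0 where "M0 = span (N \<union> H)"
  have NM: "N \<subseteq> M0" "H \<subseteq> M0" unfolding M0_def using span_superset by blast+
  have "H_invariant M0"
    unfolding H_invariant_def
  proof (intro conjI ballI)
    show "subspace M0" by (simp add: M0_def)
    fix x v assume x: "x \<in> H" and v: "v \<in> M0"
    show "br x v \<in> M0"
      by (rule linop_span[OF linop_br _ _ v[unfolded M0_def]])
        (use x N NM H_closed in \<open>auto simp: H_invariant_def M0_def\<close>)
  qed
  moreover have "H \<subset> M0" using NM nN by blast
  moreover have "M0 \<subseteq> Z" unfolding M0_def
    by (rule span_minimal[OF _ sZ]) (use N H_gen_0 in \<open>auto simp: Z_def\<close>)
  ultimately have "good M0" by (simp add: good_def)
  then obtain M where M: "good M" "\<And>M'. good M' \<Longrightarrow> dim M \<le> dim M'"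
    using arg_min_nat_lemma[of good M0 dim] by blast
  have MH: "br y v \<in> H" if y: "y \<in> H" and v: "v \<in> M" for y v
  proof -
    have "y \<in> lc 0" using y by simp
    then have "\<forall>v\<in>M. br y v \<in> H"
    proof (induction rule: lc_descending_induct)
      case zero
      show ?case by (simp add: br_left subspace_0[OF subspace_H])
    next
      case (step j y)
      have yH: "y \<in> H" using step(1) lc_subset_H by blast
      define K where "K = {v\<in>M. br y v \<in> H}"
      have sM: "subspace M" using M(1) by (simp add: good_def H_invariant_def)
      have inv: "br z v \<in> M" if "z \<in> H" "v \<in> M" for z v using M(1) that by (simp add: good_def H_invariant_def)
      have sK: "subspace K" unfolding K_def
        using sM subspace_H by (auto simp: subspace_def br_right)
      have "H_invariant K" unfolding H_invariant_def
      proof (intro conjI ballI sK)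
        fix z v assume z: "z \<in> H" and v: "v \<in> K"
        have "br y (br z v) = br z (br y v) - br (br z y) v" by (simp add: br_br)
        moreover have "br (br z y) v \<in> H" using step(2)[OF z] v by (simp add: K_def)
        ultimately have "br y (br z v) \<in> H"
          using v z H_closed subspace_H by (simp add: K_def subspace_diff)
        then show "br z v \<in> K" using inv z v by (simp add: K_def)
      qed
      moreover have "H \<subset> K"
      proof -
        obtain v where v: "v \<in> M" "v \<notin> H" using M(1) by (auto simp: good_def)
        have "v \<in> gen_eigenspace (br y) 0" using M(1) v yH by (auto simp: good_def Z_def)
        then obtain k where "(br y ^^ k) v = 0" unfolding gen_eigenspace_def by auto
        then have ex: "(br y ^^ k) v \<in> H" using subspace_0[OF subspace_H] by simp
        \<comment> \<open>The first power of \<open>br y\<close> taking \<open>v\<close> into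
          \<open>H\<close>. It is positive since \<open>v\<close> is outside \<open>H\<close>, and
          the vector just before it witnesses that \<open>K\<close> is strictly larger than
          \<open>H\<close>.\<close>
        define n where "n = (LEAST n. (br y ^^ n) v \<in> H)"
        have n: "(br y ^^ n) v \<in> H" unfolding n_def by (rule LeastI[of "\<lambda>n. (br y ^^ n) v \<in> H", OF ex])
        then obtain m where m: "n = Suc m" using v by (cases n) auto
        have u: "(br y ^^ m) v \<notin> H"
          using not_less_Least[of m "\<lambda>n. (br y ^^ n) v \<in> H"] m unfolding n_def by auto
        have "(br y ^^ i) v \<in> M" for i by (induction i) (use v inv yH in auto)
        then have "(br y ^^ m) v \<in> K" using n m by (simp add: K_def)
        moreover have "H \<subseteq> K" using M(1) H_closed yH by (auto simp: K_def good_def)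
        ultimately show ?thesis using u by blast
      qed
      moreover have "K \<subseteq> Z" using M(1) by (auto simp: K_def good_def)
      ultimately have "good K" by (simp add: good_def)
      then have "dim M \<le> dim K" by (rule M(2))
      then have "K = M" using subspace_dim_equal[OF sK sM] by (auto simp: K_def)
      then show ?case by (auto simp: K_def)
    qed
    then show ?thesis using v by blast
  qed
  \<comment> \<open>\<open>M\<close> now normalizes \<open>H\<close>, and this is the place where
    self-normalization gives the contradiction.\<close>
  have "M \<subseteq> H"
  proof
    fix v assume v: "v \<in> M"
    show "v \<in> H"
    proof (rule H_normalizer)
      fix y assume "y \<in> H"
      then have "- br y v \<in> H" using MH v subspace_H subspace_neg by blast
      then show "br v y \<in> H" using br_antisym[of v y] by simp
    qed
  qed
  then show False using M(1) by (auto simp: good_def)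
qed

text \<open>A combination of commutators has trace zero on \<open>N\<close>, while its trace there
  is the single eigenvalue times the dimension. In characteristic zero the eigenvalue must
  vanish.\<close>

lemma primary_nil:
  assumes N: "primary N" and w: "w \<in> span {br x y | x y. x \<in> H \<and> y \<in> H}" and wH: "w \<in> H"
  shows "N \<subseteq> gen_eigenspace (br w) 0"
proof -
  have sN: "subspace N" and inv: "\<And>x v. x \<in> H \<Longrightarrow> v \<in> N \<Longrightarrow> br x v \<in> N"
    using N by (auto simp: primary_def H_invariant_def)
  obtain c where c: "N \<subseteq> gen_eigenspace (br w) c" using N wH by (auto simp: primary_def)
  obtain B where B: "B \<subseteq> N" "independent B" "span B = N"
    using basis_subspace_exists[OF sN] by metis
  have inB: "br x b \<in> span B" if "x \<in> H" "b \<in> B" for x b using inv that B by blast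
  have "tr B (br w) = 0 \<and> (\<forall>b\<in>B. br w b \<in> span B)" using w
  proof (induction rule: span_induct_alt)
    case base
    show ?case by (simp add: br_left tr_def span_zero representation_zero)
  next
    case (step c z y)
    then obtain p q where pq: "z = br p q" "p \<in> H" "q \<in> H" by blast
    have zB: "br z b \<in> span B" if "b \<in> B" for b using pq that inB H_closed by blast
    have "tr B (br z) = tr B (\<lambda>v. br p (br q v)) - tr B (\<lambda>v. br q (br p v))"
      unfolding pq br_br by (rule tr_diff[OF B(2)]) (use pq B inv in auto)
    also have "\<dots> = 0"
      using tr_comm[OF B(2) linop_br _ linop_br, of p q] inB pq by auto
    finally have "tr B (br z) = 0" .
    moreover have "tr B (br (sc c z + y)) = c * tr B (br z) + tr B (br y)"
      unfolding br_left using step zB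
      by (subst tr_add[OF B(2)]) (auto simp: tr_scale[OF B(2)] span_scale)
    ultimately have "tr B (br (sc c z + y)) = 0" using step by simp
    moreover have "\<forall>b\<in>B. br (sc c z + y) b \<in> span B"
      using step zB by (auto simp: br_left intro: span_add span_scale)
    ultimately show ?case by blast
  qed
  then have "c * of_nat (card B) = 0"
    using tr_eigenvalue[OF B(2) linop_br, of w c] B(1) c by auto
  then have "c = 0 \<or> B = {}" using finiteI_independent[OF B(2)] by auto
  then show ?thesis
  proof
    assume "B = {}"
    then have "N = {0}" using B by auto
    then show ?thesis using subspace_0[OF subspace_gen[OF linop_br]] by auto
  qed (use c in simp)
qed

text \<open>A primary subspace on which every element of \<open>H\<close> is nilpotent lies in
  \<open>H\<close>. On any other one some \<open>br x\<close> is invertible, so its vectors have the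
  form \<open>br x u\<close>, and invariance moves \<open>x\<close> onto \<open>w\<close>, which it
  centralizes. Hence \<open>w\<close> is in the radical.\<close>

lemma kf_orth_primary:
  assumes w: "w \<in> H" "\<And>z. z \<in> H \<Longrightarrow> br z w = 0" "\<And>z. z \<in> H \<Longrightarrow> kf w z = 0"
  shows "w = 0"
proof (rule kf_nondegenerate)
  fix z
  have "kf w z = 0" if N: "primary N" "z \<in> N" for N z
  proof (cases "\<forall>x\<in>H. N \<subseteq> gen_eigenspace (br x) 0")
    case True
    then have "N \<subseteq> H" using hinv_nil_subset_H N(1) by (auto simp: primary_def)
    then show ?thesis using w N by blast
  next
    case False
    then obtain x c where x: "x \<in> H" "N \<subseteq> gen_eigenspace (br x) c" "c \<noteq> 0"
      using N(1) unfolding primary_def by metis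
    have "subspace N" "\<And>v. v \<in> N \<Longrightarrow> br x v \<in> N" using N(1) x(1) by (auto simp: primary_def H_invariant_def)
    then obtain u where "u \<in> gen_eigenspace (br x) c \<inter> N" "shift (br x) 0 u = z"
      using gen_invert[OF linop_br, of N x c 0 z] x N by blast
    then have "z = br x u" by simp
    then have "kf w z = kf (br w x) u" by (simp add: kf_invariant)
    also have "br w x = 0" using w(2)[OF x(1)] br_antisym[of w x] by simp
    finally show ?thesis by (simp add: kf_left')
  qed
  moreover have "z \<in> span (\<Union>{N. primary N})" using span_primary[OF hinv_UNIV] by blast
  moreover have "z \<in> span (\<Union>{N. primary N}) \<Longrightarrow> kf w z = 0"
    if "\<And>N z. primary N \<Longrightarrow> z \<in> N \<Longrightarrow> kf w z = 0"
    by (induction rule: span_induct_alt) (use that in \<open>auto simp: kf_right\<close>)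
  ultimately show "kf w z = 0" by blast
qed

text \<open>Otherwise the last nonzero term of the lower central series lies in the radical of the Killing form.\<close>
lemma H_abelian: assumes "x \<in> H" "y \<in> H" shows "br x y = 0"
proof (rule ccontr)
  assume ne: "br x y \<noteq> 0"
  define k where "k = (LEAST k. lc k = {0})"
  have k: "lc k = {0}" unfolding k_def using H_nilpotent by (rule LeastI_ex)
  have "lc 0 \<noteq> {0}" using assms ne br_left(3) by auto
  moreover have "lc 1 \<noteq> {0}" using lc_step[of x y 0] assms ne by auto
  ultimately have "k \<noteq> 0" "k \<noteq> 1" using k by metis+
  \<comment> \<open>With two steps to spare, \<open>lc (Suc m)\<close> is nonzero, central in
    \<open>H\<close>, and still spanned by brackets of elements of \<open>H\<close>;
    \<open>primary_nil\<close> needs the last property.\<close>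
  then obtain m where m: "k = Suc (Suc m)" by (metis One_nat_def not0_implies_Suc)
  have "lc (Suc m) \<noteq> {0}" using not_less_Least[of "Suc m" "\<lambda>k. lc k = {0}"] m unfolding k_def by auto
  moreover have "0 \<in> lc (Suc m)" by (simp add: span_zero)
  ultimately obtain w where w: "w \<in> lc (Suc m)" "w \<noteq> 0" by blast
  have wH: "w \<in> H" using w lc_subset_H by blast
  have central: "br z w = 0" if "z \<in> H" for z using lc_step[OF that w(1)] k m by auto
  have "{br x y |x y. x \<in> H \<and> y \<in> lc m} \<subseteq> {br x y |x y. x \<in> H \<and> y \<in> H}" using lc_subset_H by blast
  then have wc: "w \<in> span {br x y |x y. x \<in> H \<and> y \<in> H}" using w(1) unfolding lower_central.simps by (rule span_mono[THEN subsetD])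
  have nil: "v \<in> gen_eigenspace (br w) 0" for v
  proof -
    have "span (\<Union>{N. primary N}) \<subseteq> gen_eigenspace (br w) 0"
      by (intro span_minimal subspace_gen[OF linop_br]) (use primary_nil[OF _ wc wH] in blast)
    then show ?thesis using span_primary[OF hinv_UNIV] by blast
  qed
  have "kf w z = 0" if z: "z \<in> H" for z
    unfolding kf_tr
  proof (rule tr_nilpotent[OF independent_basis linop_br2])
    fix b
    obtain n where n: "(br w ^^ n) b = 0" using nil[of b] by (auto simp: gen_eigenspace_def)
    \<comment> \<open>Since \<open>w\<close> is central in \<open>H\<close>, the nilpotent operator
      \<open>br w\<close> commutes with \<open>br z\<close>, so their product is nilpotent and has
      trace zero.\<close>
    have "br w (br z v) = br z (br w v)" for v
      using br_br[of z w v] central[OF z] by (simp add: br_left)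
    then show "\<exists>n. ((\<lambda>v. br w (br z v)) ^^ n) b = 0"
      using comm_nilpotent[OF linop_br linop_br _ n] by blast
  qed simp
  then have "w = 0" using kf_orth_primary wH central by blast
  then show False using w by simp
qed

end

section \<open>Weights and roots\<close>

lemma dual_of_add: "l \<in> dual_of sc H \<Longrightarrow> m \<in> dual_of sc H \<Longrightarrow> l + m \<in> dual_of sc H"
  and dual_of_uminus: "l \<in> dual_of sc H \<Longrightarrow> - l \<in> dual_of sc H"
  and dual_of_zero: "0 \<in> dual_of sc H"
  by (auto simp: dual_of_def algebra_simps)

lemma dual_of_diff: "l \<in> dual_of sc H \<Longrightarrow> m \<in> dual_of sc H \<Longrightarrow> l - m \<in> dual_of sc H"
  by (auto simp: dual_of_def algebra_simps)

lemma dual_of_eqI: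
  "l \<in> dual_of sc H \<Longrightarrow> m \<in> dual_of sc H \<Longrightarrow> (\<And>x. x \<in> H \<Longrightarrow> l x = m x) \<Longrightarrow> l = m"
  unfolding dual_of_def fun_eq_iff by (metis (mono_tags, lifting) mem_Collect_eq)

section \<open>The weight space decomposition\<close>

context cartan_algebra
begin

abbreviation "HD \<equiv> dual_of sc H"

text \<open>Generalized eigenvectors, because diagonalizability of the adjoint action of
  \<open>H\<close> is not yet available. Genuine eigenvectors are the subject of
  \<open>root_space\<close>.\<close>

definition weight_space :: "('g \<Rightarrow> complex) \<Rightarrow> 'g set" where
  "weight_space l = {v. \<forall>x\<in>H. v \<in> gen_eigenspace (br x) (l x)}"

lemma subspace_wt: "subspace (weight_space l)"
  using subspace_gen[OF linop_br] by (auto simp: weight_space_def subspace_def)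

lemma hinv_wt: "H_invariant (weight_space l)"
  unfolding H_invariant_def using subspace_wt gen_H_invariant by (auto simp: weight_space_def)

lemma wt_br: "x \<in> H \<Longrightarrow> v \<in> weight_space l \<Longrightarrow> br x v \<in> weight_space l"
  using hinv_wt by (simp add: H_invariant_def)

text \<open>The eigenvalue of \<open>x\<close> is its trace on \<open>N\<close> divided by the
  dimension, which makes it linear in \<open>x\<close>. Outside \<open>H\<close> it is set to 0, the
  convention of \<open>dual_of\<close>.\<close>

lemma primary_subset_wt:
  assumes N: "primary N" "N \<noteq> {0}"
  shows "\<exists>l\<in>HD. N \<subseteq> weight_space l"
proof -
  have sN: "subspace N" and inv: "\<And>x v. x \<in> H \<Longrightarrow> v \<in> N \<Longrightarrow> br x v \<in> N"
    using N by (auto simp: primary_def H_invariant_def)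
  obtain B where B: "B \<subseteq> N" "independent B" "span B = N"
    using basis_subspace_exists[OF sN] by metis
  have inB: "br x b \<in> span B" if "x \<in> H" "b \<in> B" for x b using inv that B by blast
  obtain c where c: "\<And>x. x \<in> H \<Longrightarrow> N \<subseteq> gen_eigenspace (br x) (c x)" using N(1) unfolding primary_def by metis
  have tc: "tr B (br x) = c x * of_nat (card B)" if "x \<in> H" for x
    by (rule tr_eigenvalue[OF B(2) linop_br]) (use inB c[OF that] B(1) that in auto)
  have "B \<noteq> {}" using B N by auto
  then have cB: "of_nat (card B) \<noteq> (0 :: complex)" using finiteI_independent[OF B(2)] by auto
  define l where "l x = (if x \<in> H then c x else 0)" for x
  have "l (x + y) = l x + l y" if "x \<in> H" "y \<in> H" for x y
  proof -
    have "tr B (br (x + y)) = tr B (br x) + tr B (br y)"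
      unfolding br_left by (rule tr_add[OF B(2)]) (use inB that in auto)
    then have "c (x + y) * of_nat (card B) = (c x + c y) * of_nat (card B)"
      using tc that subspace_H by (simp add: subspace_add algebra_simps)
    then show ?thesis using cB that subspace_H by (simp add: l_def subspace_add)
  qed
  moreover have "l (sc k x) = k * l x" if "x \<in> H" for k x
  proof -
    have "tr B (br (sc k x)) = k * tr B (br x)"
      unfolding br_left by (rule tr_scale[OF B(2)]) (use inB that in auto)
    then have "c (sc k x) * of_nat (card B) = (k * c x) * of_nat (card B)"
      using tc that subspace_H by (simp add: subspace_scale algebra_simps)
    then show ?thesis using cB that subspace_H by (simp add: l_def subspace_scale)
  qed
  ultimately have "l \<in> HD" by (simp add: dual_of_def l_def)
  moreover have "N \<subseteq> weight_space l" using c by (auto simp: weight_space_def l_def)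
  ultimately show ?thesis by blast
qed

lemma span_wt: "span (\<Union>l\<in>HD. weight_space l) = UNIV"
proof -
  have "\<Union>{N. primary N} \<subseteq> span (\<Union>l\<in>HD. weight_space l)"
  proof
    fix v assume "v \<in> \<Union>{N. primary N}"
    then obtain N where N: "primary N" "v \<in> N" by blast
    show "v \<in> span (\<Union>l\<in>HD. weight_space l)"
    proof (cases "N = {0}")
      case True then show ?thesis using N span_zero by auto
    next
      case False
      then obtain l where "l \<in> HD" "N \<subseteq> weight_space l" using primary_subset_wt N by blast
      then show ?thesis using N by (intro span_base) blast
    qed
  qed
  then have "span (\<Union>{N. primary N}) \<subseteq> span (\<Union>l\<in>HD. weight_space l)" by (rule span_minimal[OF _ subspace_span])
  then show ?thesis using span_primary[OF hinv_UNIV] by blast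
qed

text \<open>A suitable power of \<open>shift (br x) (m x)\<close> kills the component at
  \<open>m\<close> and preserves the others. By induction it kills them too; if \<open>x\<close>
  separates \<open>l\<close> from \<open>m\<close>, then \<open>v l\<close> lies in two different
  generalized eigenspaces of \<open>br x\<close>.\<close>

lemma wt_sum_zero:
  assumes "finite F" "F \<subseteq> HD" "\<And>l. l \<in> F \<Longrightarrow> v l \<in> weight_space l" "(\<Sum>l\<in>F. v l) = 0" "l \<in> F"
  shows "v l = 0"
  using assms
proof (induction F arbitrary: v l rule: finite_induct)
  case (insert m F)
  have F0: "v l = 0" if l: "l \<in> F" for l
  proof -
    have "l \<noteq> m" using insert l by auto
    then obtain x where x: "x \<in> H" "l x \<noteq> m x" using dual_of_eqI[of l sc H m] insert.prems l by blast
    have vm: "v m \<in> gen_eigenspace (br x) (m x)" using insert.prems x by (auto simp: weight_space_def)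
    then obtain n where n: "(shift (br x) (m x) ^^ n) (v m) = 0" by (auto simp: gen_eigenspace_def)
    let ?S = "shift (br x) (m x) ^^ n"
    have S: "linop ?S" by (rule lin_funpow[OF linop_shift[OF linop_br]])
    have "?S (\<Sum>l\<in>insert m F. v l) = 0" using insert.prems lin_zero[OF S] by simp
    then have "(\<Sum>l\<in>F. ?S (v l)) = 0" using insert.hyps n by (simp add: lin_sum[OF S] lin_add[OF S])
    moreover have inv: "?S u \<in> weight_space k" if "u \<in> weight_space k" for u k
    proof -
      have "(shift (br x) (m x) ^^ j) u \<in> weight_space k" for j
        by (induction j) (use that wt_br[OF x(1)] subspace_wt in \<open>auto simp: shift_def subspace_diff subspace_scale\<close>)
      then show ?thesis by simp
    qed
    ultimately have "?S (v l) = 0"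
      using insert.IH[of "\<lambda>l. ?S (v l)" l] insert.prems l by auto
    then have "v l \<in> gen_eigenspace (br x) (m x)" unfolding gen_eigenspace_def by blast
    moreover have "v l \<in> gen_eigenspace (br x) (l x)" using insert.prems l x by (auto simp: weight_space_def)
    ultimately show ?thesis using gen_injective[OF linop_br x(2)] by blast
  qed
  then have "v m = 0" using insert by simp
  then show ?case using F0 insert.prems by blast
qed simp

lemma wt_inter: assumes "l \<in> HD" "m \<in> HD" "l \<noteq> m" "v \<in> weight_space l" "v \<in> weight_space m" shows "v = 0"
proof -
  obtain x where "x \<in> H" "l x \<noteq> m x" using dual_of_eqI[OF assms(1,2)] assms(3) by blast
  then show ?thesis using gen_injective[OF linop_br, of "l x" "m x"] assms by (auto simp: weight_space_def)
qed

definition weights :: "('g \<Rightarrow> complex) set" where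
  "weights = {l \<in> HD. weight_space l \<noteq> {0}}"

lemma independent_wt_Union:
  assumes F: "finite F" "F \<subseteq> HD" and B: "\<And>l. l \<in> F \<Longrightarrow> independent (B l) \<and> B l \<subseteq> weight_space l"
  shows "independent (\<Union>l\<in>F. B l)"
    and "\<And>l m. l \<in> F \<Longrightarrow> m \<in> F \<Longrightarrow> l \<noteq> m \<Longrightarrow> B l \<inter> B m = {}"
proof -
  show disj: "B l \<inter> B m = {}" if lm: "l \<in> F" "m \<in> F" "l \<noteq> m" for l m
  proof (rule ccontr)
    assume "B l \<inter> B m \<noteq> {}"
    then obtain b where b: "b \<in> B l" "b \<in> B m" by blast
    have "b = 0" by (rule wt_inter[of l m]) (use lm F B b in blast)+
    then show False using b B[OF lm(1)] dependent_zero by blast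
  qed
  have fin: "finite (B l)" if "l \<in> F" for l using B[OF that] finiteI_independent by blast
  show "independent (\<Union>l\<in>F. B l)"
  proof (subst dependent_finite)
    show "finite (\<Union>l\<in>F. B l)" using F fin by blast
    show "\<not> (\<exists>u. (\<exists>v\<in>(\<Union>l\<in>F. B l). u v \<noteq> 0) \<and> (\<Sum>v\<in>(\<Union>l\<in>F. B l). sc (u v) v) = 0)"
    proof clarify
      fix u l b assume u: "(\<Sum>v\<in>(\<Union>l\<in>F. B l). sc (u v) v) = 0" and l: "l \<in> F" "b \<in> B l" "u b \<noteq> 0"
      have "(\<Sum>l\<in>F. \<Sum>v\<in>B l. sc (u v) v) = 0"
        using u by (subst (asm) sum.UNION_disjoint) (use F fin disj in auto)
      then have "(\<Sum>v\<in>B l. sc (u v) v) = 0"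
        by (rule wt_sum_zero[OF F, rotated])
          (use l B subspace_wt in \<open>auto intro!: subspace_sum subspace_scale\<close>)
      then show False using B[OF l(1)] l fin[OF l(1)] dependent_finite[OF fin[OF l(1)]] by blast
    qed
  qed
qed

lemma finite_weights: "finite weights"
proof (rule ccontr)
  assume "infinite weights"
  then obtain F where F: "finite F" "card F = Suc dimension" "F \<subseteq> weights"
    by (meson infinite_arbitrarily_large)
  have "\<exists>v. v \<in> weight_space l \<and> v \<noteq> 0" if "l \<in> F" for l
    using that F subspace_0[OF subspace_wt, of l] by (auto simp: weights_def)
  then obtain v where v: "\<And>l. l \<in> F \<Longrightarrow> v l \<in> weight_space l \<and> v l \<noteq> 0" by metis
  have FH: "F \<subseteq> HD" using F by (auto simp: weights_def)
  have I: "independent (\<Union>l\<in>F. {v l})"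
    by (rule independent_wt_Union(1)[OF F(1) FH]) (use v in auto)
  have "inj_on v F" using wt_inter v FH unfolding inj_on_def by (metis subsetD)
  then have "card (\<Union>l\<in>F. {v l}) = Suc dimension" using F by (simp add: UNION_singleton_eq_range card_image)
  moreover have "card (\<Union>l\<in>F. {v l}) \<le> dimension"
    using independent_bound_general[OF I] dim_subset_UNIV by (metis dimension_def independent_card_le_dim I dim_UNIV subset_UNIV)
  ultimately show False by simp
qed

lemma wt_weightsI: "l \<in> HD \<Longrightarrow> v \<in> weight_space l \<Longrightarrow> v \<noteq> 0 \<Longrightarrow> l \<in> weights"
  by (auto simp: weights_def)

lemma wt_zero: "weight_space 0 = H"
proof
  have "weight_space 0 \<subseteq> gen_eigenspace (br x) 0" if "x \<in> H" for x using that by (auto simp: weight_space_def)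
  then show "weight_space 0 \<subseteq> H" by (rule hinv_nil_subset_H[OF hinv_wt])
  show "H \<subseteq> weight_space 0" using H_gen_0 by (auto simp: weight_space_def)
qed

lemma root_space_subset_wt: "root_space sc br H l \<subseteq> weight_space l"
proof
  fix v assume v: "v \<in> root_space sc br H l"
  have "(shift (br x) (l x) ^^ 1) v = 0" if "x \<in> H" for x
    using v that by (simp add: shift_def root_space_def)
  then show "v \<in> weight_space l" unfolding weight_space_def gen_eigenspace_def by blast
qed

text \<open>In a nonzero invariant subspace of least dimension, the eigenvectors of one
  \<open>t\<close> in \<open>H\<close> form a nonzero subspace, invariant because \<open>H\<close>
  is abelian, hence everything. So all of \<open>H\<close> acts there by scalars.\<close>

lemma root_vector_exists:
  assumes l: "l \<in> weights" shows "root_space sc br H l \<noteq> {0}"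
proof -
  define good where "good M \<longleftrightarrow> H_invariant M \<and> M \<subseteq> weight_space l \<and> M \<noteq> {0}" for M
  have "good (weight_space l)" using l by (auto simp: good_def hinv_wt weights_def)
  then obtain M where M: "good M" "\<And>M'. good M' \<Longrightarrow> dim M \<le> dim M'"
    using arg_min_nat_lemma[of good "weight_space l" dim] by blast
  have sM: "subspace M" and inv: "\<And>x v. x \<in> H \<Longrightarrow> v \<in> M \<Longrightarrow> br x v \<in> M"
    using M by (auto simp: good_def H_invariant_def)
  obtain w where w: "w \<in> M" "w \<noteq> 0" using M(1) subspace_0[OF sM] by (auto simp: good_def)
  have "br t w = sc (l t) w" if t: "t \<in> H" for t
  proof -
    define K where "K = {v\<in>M. br t v = sc (l t) v}"
    have sK: "subspace K" unfolding K_def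
      using sM by (auto simp: subspace_def br_right scale_right_distrib mult.commute)
    have "br y v \<in> K" if "y \<in> H" "v \<in> K" for y v
    proof -
      have "br t (br y v) = br y (br t v)" using br_br[of t y v] H_abelian[OF t that(1)] by (simp add: br_left)
      then show ?thesis using that inv by (simp add: K_def br_right)
    qed
    moreover obtain u where "u \<in> M" "u \<noteq> 0" "br t u = sc (l t) u"
      using shift_kernel_exists[OF linop_br sM inv[OF t] _ w, of "l t"] M(1) w t
      by (auto simp: good_def weight_space_def)
    ultimately have "good K" using sK M(1) by (auto simp: good_def H_invariant_def K_def)
    then have "dim M \<le> dim K" by (rule M(2))
    then have "K = M" using subspace_dim_equal[OF sK sM] by (auto simp: K_def)
    then show ?thesis using w by (auto simp: K_def)
  qed
  then have "w \<in> root_space sc br H l" by (simp add: root_space_def)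
  then show ?thesis using w by blast
qed

lemma roots_eq: "roots sc br H = weights - {0}"
proof
  show "weights - {0} \<subseteq> roots sc br H"
    using root_vector_exists by (auto simp: roots_def weights_def)
  show "roots sc br H \<subseteq> weights - {0}"
  proof
    fix l assume l: "l \<in> roots sc br H"
    have "0 \<in> root_space sc br H l" by (simp add: root_space_def br_right)
    then obtain v where "v \<in> root_space sc br H l" "v \<noteq> 0" using l by (auto simp: roots_def)
    then show "l \<in> weights - {0}" using l root_space_subset_wt[of l] wt_weightsI[of l v] by (auto simp: roots_def)
  qed
qed

text \<open>Since \<open>m x\<close> differs from \<open>- l x\<close>, one can write
  \<open>v\<close> as \<open>br x u\<close> plus \<open>l x\<close> times \<open>u\<close>, and by
  invariance of the form the two contributions cancel.\<close>

lemma kf_root_wt_orth: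
  assumes a: "a \<in> root_space sc br H l" and v: "v \<in> weight_space m" and x: "x \<in> H" "m x \<noteq> - l x"
  shows "kf a v = 0"
proof -
  have "v \<in> gen_eigenspace (br x) (m x)" using v x by (auto simp: weight_space_def)
  then obtain u where u: "shift (br x) (- l x) u = v"
    using gen_invert[OF linop_br subspace_UNIV, of x "m x" "- l x" v] x by blast
  have "kf a (br x u) = - kf (br x a) u"
    using kf_invariant[of a x u] br_antisym[of a x] by (simp add: kf_left')
  also have "br x a = sc (l x) a" using a x by (auto simp: root_space_def)
  finally show ?thesis using u by (auto simp: shift_def kf_right kf_left)
qed

lemma br_root_wt:
  assumes a: "a \<in> root_space sc br H l" and v: "v \<in> weight_space m"
  shows "br a v \<in> weight_space (l + m)"
  unfolding weight_space_def
proof (intro CollectI ballI)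
  fix x assume x: "x \<in> H"
  have s: "shift (br x) ((l + m) x) (br a u) = br a (shift (br x) (m x) u)" for u
    using br_br[of x a u] a x
    by (simp add: shift_def root_space_def br_left br_right scale_left_distrib algebra_simps)
  obtain n where "(shift (br x) (m x) ^^ n) v = 0" using v x by (auto simp: weight_space_def gen_eigenspace_def)
  moreover have "(shift (br x) ((l + m) x) ^^ n) (br a v) = br a ((shift (br x) (m x) ^^ n) v)" for n
    by (induction n) (use s in \<open>auto simp del: plus_fun_apply\<close>)
  ultimately have "(shift (br x) ((l + m) x) ^^ n) (br a v) = 0" by (simp add: br_right)
  then show "br a v \<in> gen_eigenspace (br x) ((l + m) x)" unfolding gen_eigenspace_def by blast
qed

end

section \<open>Root vectors and their coroots\<close>

locale root_vector_algebra = cartan_algebra sc br H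
  for sc :: "complex \<Rightarrow> 'g::ab_group_add \<Rightarrow> 'g" and br :: "'g \<Rightarrow> 'g \<Rightarrow> 'g" and H +
  fixes E :: "('g \<Rightarrow> complex) \<Rightarrow> 'g"
  assumes root_vectors: "root_vectors sc br H E"
begin

abbreviation "R \<equiv> roots sc br H"

lemma E_root: "a \<in> R \<Longrightarrow> E a \<in> root_space sc br H a"
  and kf_E: "a \<in> R \<Longrightarrow> kf (E a) (E (- a)) = 1"
  using root_vectors by (auto simp: root_vectors_def)

lemma br_E: "a \<in> R \<Longrightarrow> t \<in> H \<Longrightarrow> br t (E a) = sc (a t) (E a)"
  using E_root by (auto simp: root_space_def)

lemma E_nonzero: "a \<in> R \<Longrightarrow> E a \<noteq> 0"
  using kf_E kf_left' by fastforce

lemma R_dual: "a \<in> R \<Longrightarrow> a \<in> HD" by (simp add: roots_def)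

lemma E_wt: "a \<in> R \<Longrightarrow> E a \<in> weight_space a" using E_root root_space_subset_wt by blast

lemma kf_span_wt_zero:
  assumes "\<And>l v. l \<in> weights \<Longrightarrow> v \<in> weight_space l \<Longrightarrow> kf a v = 0"
  shows "a = 0"
proof (rule kf_nondegenerate)
  fix y
  have "y \<in> span (\<Union>l\<in>HD. weight_space l)" using span_wt by simp
  then show "kf a y = 0"
  proof (induction rule: span_induct_alt)
    case (step c x y)
    then obtain l where "l \<in> HD" "x \<in> weight_space l" by blast
    then have "kf a x = 0" using assms[of l x] wt_weightsI[of l x] by (cases "x = 0") (auto simp: kf_right)
    then show ?case using step by (simp add: kf_right)
  qed (simp add: kf_right)
qed

text \<open>The hypothesis on \<open>E\<close> places \<open>E (- a)\<close> in a root space only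
  once \<open>- a\<close> is known to be a root. If it were not, \<open>E a\<close> would be
  orthogonal to every weight space.\<close>

lemma R_uminus: assumes "a \<in> R" shows "- a \<in> R"
proof (rule ccontr)
  assume n: "- a \<notin> R"
  have "- a \<noteq> 0" using assms by (auto simp: roots_def)
  then have nw: "- a \<notin> weights" using n roots_eq by blast
  have "E a = 0"
  proof (rule kf_span_wt_zero)
    fix l v assume l: "l \<in> weights" "v \<in> weight_space l"
    then have "l \<in> HD" "l \<noteq> - a" using nw by (auto simp: weights_def)
    then obtain x where "x \<in> H" "l x \<noteq> - a x"
      using dual_of_eqI[of l sc H "- a"] dual_of_uminus[OF R_dual[OF assms]] by (auto simp: fun_Compl_def)
    then show "kf (E a) v = 0" using kf_root_wt_orth[OF E_root[OF assms] l(2)] by blast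
  qed
  then show False using E_nonzero assms by blast
qed

text \<open>The vector representing \<open>a\<close> under the Killing form, by
  \<open>kf_coroot\<close>. It is not rescaled so that \<open>a\<close> takes the value 2 on
  it.\<close>

definition coroot :: "('g \<Rightarrow> complex) \<Rightarrow> 'g" where "coroot a = br (E a) (E (- a))"

lemma coroot_H: assumes a: "a \<in> R" shows "coroot a \<in> H"
proof (rule H_normalizer)
  fix y assume y: "y \<in> H"
  have "br y (coroot a) = br (br y (E a)) (E (- a)) + br (E a) (br y (E (- a)))"
    unfolding coroot_def br_br by simp
  also have "\<dots> = 0" using br_E[OF a y] br_E[OF R_uminus[OF a] y] by (simp add: br_left br_right)
  finally have "br (coroot a) y = 0" using br_antisym[of "coroot a" y] by simp
  then show "br (coroot a) y \<in> H" using subspace_0[OF subspace_H] by simp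
qed

lemma kf_coroot: assumes a: "a \<in> R" and t: "t \<in> H" shows "kf (coroot a) t = a t"
proof -
  have "kf (coroot a) t = kf (E a) (br (E (- a)) t)" by (simp add: coroot_def kf_invariant)
  also have "br (E (- a)) t = sc (a t) (E (- a))"
    using br_E[OF R_uminus[OF a] t] br_antisym[of "E (- a)" t] by simp
  finally show ?thesis using kf_E[OF a] by (simp add: kf_right)
qed

lemma adapted_basis_exists:
  assumes l: "l \<in> HD"
  shows "\<exists>B. independent B \<and> span B = weight_space l \<and> (l \<in> R \<longrightarrow> E l \<in> B)"
proof -
  define S where "S = (if l \<in> R then {E l} else {})"
  have "S \<subseteq> weight_space l" "independent S" using E_wt E_nonzero independent_empty by (auto simp: S_def)
  then obtain B where B: "S \<subseteq> B" "B \<subseteq> weight_space l" "independent B" "weight_space l \<subseteq> span B"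
    using maximal_independent_subset_extend by blast
  then have "span B = weight_space l" using span_minimal[OF B(2) subspace_wt] by blast
  then show ?thesis using B by (auto simp: S_def)
qed

text \<open>A basis through the chosen root vector, so that a dimension bound of one identifies the
  basis as \<open>{E l}\<close>.\<close>

definition wbasis :: "('g \<Rightarrow> complex) \<Rightarrow> 'g set" where
  "wbasis l = (SOME B. independent B \<and> span B = weight_space l \<and> (l \<in> R \<longrightarrow> E l \<in> B))"

lemma wbasis:
  assumes "l \<in> HD"
  shows "independent (wbasis l)" "span (wbasis l) = weight_space l" "l \<in> R \<Longrightarrow> E l \<in> wbasis l"
    "wbasis l \<subseteq> weight_space l" "finite (wbasis l)"
proof -
  note s = someI_ex[OF adapted_basis_exists[OF assms], folded wbasis_def]
  show i: "independent (wbasis l)" and sp: "span (wbasis l) = weight_space l" and "l \<in> R \<Longrightarrow> E l \<in> wbasis l"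
    using s by simp_all
  show "wbasis l \<subseteq> weight_space l" using span_superset[of "wbasis l"] sp by simp
  show "finite (wbasis l)" using i by (rule finiteI_independent)
qed

definition mult_wt :: "('g \<Rightarrow> complex) \<Rightarrow> nat" where "mult_wt l = card (wbasis l)"

lemma mult_wt_pos: assumes "l \<in> weights" shows "mult_wt l > 0"
proof -
  have l: "l \<in> HD" using assms by (simp add: weights_def)
  have "wbasis l \<noteq> {}" using wbasis(2)[OF l] assms by (auto simp: weights_def)
  then show ?thesis using wbasis(5)[OF l] by (simp add: mult_wt_def card_gt_0_iff)
qed

lemma wt_in_span:
  assumes "l \<in> HD" "l \<in> weights \<Longrightarrow> l \<in> S" "v \<in> weight_space l"
  shows "v \<in> span (\<Union>l\<in>S. wbasis l)"
proof (cases "v = 0")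
  case False
  then have "l \<in> S" using assms wt_weightsI by blast
  then have "span (wbasis l) \<subseteq> span (\<Union>l\<in>S. wbasis l)" by (intro span_mono) blast
  then show ?thesis using wbasis(2)[OF assms(1)] assms(3) by blast
qed (simp add: span_zero)

lemma weights_HD: "S \<subseteq> weights \<Longrightarrow> S \<subseteq> HD" by (auto simp: weights_def)

lemma independent_wbasis_Union:
  assumes "S \<subseteq> weights" shows "independent (\<Union>l\<in>S. wbasis l)"
    "\<And>l m. l \<in> S \<Longrightarrow> m \<in> S \<Longrightarrow> l \<noteq> m \<Longrightarrow> wbasis l \<inter> wbasis m = {}"
  using independent_wt_Union[of S wbasis] finite_subset[OF assms finite_weights] weights_HD[OF assms] wbasis(1,4)
  by blast+

lemma span_wbasis: "span (\<Union>l\<in>weights. wbasis l) = UNIV"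
proof -
  have "(\<Union>l\<in>HD. weight_space l) \<subseteq> span (\<Union>l\<in>weights. wbasis l)" using wt_in_span by blast
  then show ?thesis using span_minimal[OF _ subspace_span] span_wt by blast
qed

lemma tr_H:
  assumes "S \<subseteq> weights" and x: "x \<in> H"
  shows "tr (\<Union>l\<in>S. wbasis l) (br x) = (\<Sum>l\<in>S. of_nat (mult_wt l) * l x)"
proof -
  have "tr (\<Union>l\<in>S. wbasis l) (br x) = (\<Sum>l\<in>S. tr (wbasis l) (br x))"
  proof (rule tr_Union[OF independent_wbasis_Union(1)[OF assms(1)] finite_subset[OF assms(1) finite_weights]])
    show "wbasis l \<inter> wbasis m = {}" if "l \<in> S" "m \<in> S" "l \<noteq> m" for l m
      using independent_wbasis_Union(2)[OF assms(1) that] .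
    fix l b assume l: "l \<in> S" "b \<in> wbasis l"
    then have "l \<in> HD" using weights_HD[OF assms(1)] by blast
    then show "br x b \<in> span (wbasis l)" using wbasis(2,4)[of l] wt_br[OF x] l by auto
  qed
  also have "\<dots> = (\<Sum>l\<in>S. of_nat (mult_wt l) * l x)"
  proof (rule sum.cong[OF refl])
    fix l assume "l \<in> S"
    then have l: "l \<in> HD" using weights_HD[OF assms(1)] by blast
    have "tr (wbasis l) (br x) = l x * of_nat (card (wbasis l))"
      by (rule tr_eigenvalue[OF wbasis(1)[OF l] linop_br])
        (use wbasis(2,4)[OF l] wt_br[OF x] x in \<open>auto simp: weight_space_def\<close>)
    then show "tr (wbasis l) (br x) = of_nat (mult_wt l) * l x" by (simp add: mult_wt_def)
  qed
  finally show ?thesis .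
qed

text \<open>On the weight space of \<open>l\<close>, the operator \<open>br x - l x\<close> is
  nilpotent and commutes with \<open>br y\<close>. It therefore contributes no trace, and
  \<open>br x\<close> may be replaced by the scalar \<open>l x\<close>.\<close>

lemma kf_H:
  assumes x: "x \<in> H" and y: "y \<in> H"
  shows "kf x y = (\<Sum>l\<in>weights. of_nat (mult_wt l) * l x * l y)"
proof -
  have I: "independent (\<Union>l\<in>weights. wbasis l)" using independent_wbasis_Union(1)[of weights] by blast
  have "kf x y = tr (\<Union>l\<in>weights. wbasis l) (\<lambda>v. br x (br y v))"
    unfolding kf_tr by (rule tr_basis_change[OF independent_basis I _ linop_br2]) (auto simp: span_wbasis span_basis)
  also have "\<dots> = (\<Sum>l\<in>weights. tr (wbasis l) (\<lambda>v. br x (br y v)))"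
  proof (rule tr_Union[OF I finite_weights])
    show "wbasis l \<inter> wbasis m = {}" if "l \<in> weights" "m \<in> weights" "l \<noteq> m" for l m
      using independent_wbasis_Union(2)[OF subset_refl that] .
    fix l b assume l: "l \<in> weights" "b \<in> wbasis l"
    then have "l \<in> HD" by (simp add: weights_def)
    then show "br x (br y b) \<in> span (wbasis l)" using wbasis(2,4)[of l] wt_br[OF x] wt_br[OF y] l by auto
  qed
  also have "\<dots> = (\<Sum>l\<in>weights. of_nat (mult_wt l) * l x * l y)"
  proof (rule sum.cong[OF refl])
    fix l assume "l \<in> weights"
    then have l: "l \<in> HD" by (simp add: weights_def)
    let ?f = "shift (br x) (l x)"
    have f: "linop ?f" by (rule linop_shift[OF linop_br])
    have fin: "br z b \<in> weight_space l" if "z \<in> H" "b \<in> weight_space l" for z b using wt_br that by blast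
    have bw: "b \<in> weight_space l" if "b \<in> wbasis l" for b using wbasis(4)[OF l] that by blast
    have comm: "?f (br y v) = br y (?f v)" for v
      using br_br[of x y v] H_abelian[OF x y] by (simp add: shift_def br_right br_left)
    have "tr (wbasis l) (\<lambda>v. ?f (br y v)) = 0"
    proof (rule tr_nilpotent[OF wbasis(1)[OF l]])
      show "linop (\<lambda>v. ?f (br y v))" by (rule lin_compose[OF linop_br f])
      show "?f (br y b) \<in> span (wbasis l)" if "b \<in> wbasis l" for b
        unfolding shift_def wbasis(2)[OF l] using fin x y bw[OF that] subspace_wt
        by (simp add: subspace_diff subspace_scale)
      show "\<exists>n. ((\<lambda>v. ?f (br y v)) ^^ n) b = 0" if hyp: "b \<in> wbasis l" for b
      proof -
        obtain n where "(?f ^^ n) b = 0" using bw[OF hyp] x by (auto simp: weight_space_def gen_eigenspace_def)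
        then show ?thesis using comm_nilpotent[OF f linop_br comm] by blast
      qed
    qed
    moreover have "tr (wbasis l) (\<lambda>v. ?f (br y v)) = tr (wbasis l) (\<lambda>v. br x (br y v)) - l x * tr (wbasis l) (br y)"
      unfolding shift_def
      by (subst tr_diff[OF wbasis(1)[OF l]])
        (use bw fin x y subspace_wt in \<open>auto simp: wbasis(2)[OF l] tr_scale[OF wbasis(1)[OF l]] subspace_scale\<close>)
    moreover have "tr (wbasis l) (br y) = l y * of_nat (card (wbasis l))"
      by (rule tr_eigenvalue[OF wbasis(1)[OF l] linop_br])
        (use wbasis(2)[OF l] bw fin y in \<open>auto simp: weight_space_def\<close>)
    ultimately show "tr (wbasis l) (\<lambda>v. br x (br y v)) = of_nat (mult_wt l) * l x * l y"
      by (simp add: mult_wt_def)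
  qed
  finally show ?thesis .
qed

text \<open>By \<open>kf_H\<close> such a \<open>t\<close> is orthogonal to \<open>H\<close>; it has
  weight zero, so it is orthogonal to the nonzero weight spaces as well.\<close>

lemma H_separated:
  assumes t: "t \<in> H" and r: "\<And>a. a \<in> R \<Longrightarrow> a t = 0"
  shows "t = 0"
proof (rule kf_span_wt_zero)
  have z: "l t = 0" if "l \<in> weights" for l using r that roots_eq by (cases "l = 0") auto
  fix l v assume l: "l \<in> weights" "v \<in> weight_space l"
  have tr0: "t \<in> root_space sc br H 0" using H_abelian t by (simp add: root_space_def)
  show "kf t v = 0"
  proof (cases "l = 0")
    case True
    then have "v \<in> H" using l wt_zero by simp
    then show ?thesis using kf_H[OF t] z by (auto intro!: sum.neutral)
  next
    case False
    then obtain x where "x \<in> H" "l x \<noteq> 0"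
      using l dual_of_eqI[of l sc H 0] dual_of_zero[of sc H] by (auto simp: weights_def)
    then show ?thesis using kf_root_wt_orth[OF tr0 l(2)] by simp
  qed
qed

lemma tr_coroot:
  assumes I: "independent B" and e: "\<And>b. b \<in> B \<Longrightarrow> br (E a) b \<in> span B"
    and f: "\<And>b. b \<in> B \<Longrightarrow> br (E (- a)) b \<in> span B"
  shows "tr B (br (coroot a)) = 0"
proof -
  have "tr B (br (coroot a)) = tr B (\<lambda>v. br (E a) (br (E (- a)) v)) - tr B (\<lambda>v. br (E (- a)) (br (E a) v))"
    unfolding coroot_def br_br
    by (rule tr_diff[OF I]) (use e f linop_span[OF linop_br _ subspace_span] in blast)+
  then show ?thesis using tr_comm[OF I linop_br e linop_br f] by simp
qed

text \<open>Closure of \<open>S\<close> under adding and subtracting \<open>a\<close> inside the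
  weights makes the sum of weight spaces invariant under \<open>E a\<close> and
  \<open>E (- a)\<close>, so \<open>coroot a\<close> is traceless on it.\<close>

lemma string_trace:
  assumes a: "a \<in> R" and S: "S \<subseteq> weights"
    and up: "\<And>l. l \<in> S \<Longrightarrow> l + a \<in> weights \<Longrightarrow> l + a \<in> S"
    and down: "\<And>l. l \<in> S \<Longrightarrow> l - a \<in> weights \<Longrightarrow> l - a \<in> S"
  shows "(\<Sum>l\<in>S. of_nat (mult_wt l) * l (coroot a)) = 0"
proof -
  let ?B = "\<Union>l\<in>S. wbasis l"
  note I = independent_wbasis_Union(1)[OF S]
  have e: "br (E a) b \<in> span ?B" if hyp: "b \<in> ?B" for b
  proof -
    obtain l where l: "l \<in> S" "b \<in> wbasis l" using hyp by blast
    then have lH: "l \<in> HD" using weights_HD[OF S] by blast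
    have "br (E a) b \<in> weight_space (a + l)" using br_root_wt[OF E_root[OF a]] wbasis(4)[OF lH] l by blast
    then show ?thesis using wt_in_span[of "a + l" S] up[OF l(1)] dual_of_add[OF R_dual[OF a] lH]
      by (simp add: add.commute)
  qed
  have f: "br (E (- a)) b \<in> span ?B" if hyp: "b \<in> ?B" for b
  proof -
    obtain l where l: "l \<in> S" "b \<in> wbasis l" using hyp by blast
    then have lH: "l \<in> HD" using weights_HD[OF S] by blast
    have "br (E (- a)) b \<in> weight_space (- a + l)"
      using br_root_wt[OF E_root[OF R_uminus[OF a]]] wbasis(4)[OF lH] l by blast
    then have "br (E (- a)) b \<in> weight_space (l - a)" by simp
    then show ?thesis using wt_in_span[of "l - a" S] down[OF l(1)] dual_of_diff[OF lH R_dual[OF a]] by blast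
  qed
  have "tr ?B (br (coroot a)) = 0" by (rule tr_coroot[OF I e f])
  then show ?thesis using tr_H[OF S coroot_H[OF a]] by simp
qed

section \<open>Root strings by trace computations\<close>

definition along :: "('g \<Rightarrow> complex) \<Rightarrow> ('g \<Rightarrow> complex) \<Rightarrow> int \<Rightarrow> 'g \<Rightarrow> complex" where
  "along b a k = (\<lambda>x. b x + of_int k * a x)"

lemma along_shift: "along b a k + a = along b a (k + 1)" "along b a k - a = along b a (k - 1)"
  by (auto simp: along_def fun_eq_iff algebra_simps)

lemma along_0: "along b a 0 = b" by (simp add: along_def)

lemma string_sum:
  assumes a: "a \<in> R" and S: "S = {l \<in> weights. \<exists>k\<in>K. l = along b a k}"
    and K: "\<And>k. k \<in> K \<Longrightarrow> along b a (k + 1) \<in> weights \<Longrightarrow> k + 1 \<in> K"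
      "\<And>k. k \<in> K \<Longrightarrow> along b a (k - 1) \<in> weights \<Longrightarrow> k - 1 \<in> K"
  shows "(\<Sum>l\<in>S. of_nat (mult_wt l) * l (coroot a)) = 0"
  using K along_shift unfolding S by (intro string_trace[OF a]) auto

lemma sum_mult_pos: "finite S \<Longrightarrow> S \<subseteq> weights \<Longrightarrow> b \<in> S \<Longrightarrow> (\<Sum>l\<in>S. real (mult_wt l)) > 0"
  using mult_wt_pos by (intro sum_pos2[of _ b]) (auto simp: subset_iff)

text \<open>Tracelessness over the whole string of weights \<open>b + k a\<close> is a linear
  equation with real coefficients between \<open>b (coroot a)\<close> and
  \<open>a (coroot a)\<close>. The coefficient of the former is a positive dimension.\<close>

lemma coroot_ratio:
  assumes a: "a \<in> R" and b: "b \<in> weights"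
  shows "\<exists>q::real. b (coroot a) = of_real q * a (coroot a)"
proof -
  define S where "S = {l \<in> weights. \<exists>k\<in>UNIV. l = along b a k}"
  have z: "(\<Sum>l\<in>S. of_nat (mult_wt l) * l (coroot a)) = 0"
    by (rule string_sum[OF a S_def]) auto
  have "\<forall>l\<in>S. \<exists>k. l = along b a k" by (auto simp: S_def)
  then obtain k where k: "\<And>l. l \<in> S \<Longrightarrow> l = along b a (k l)" by metis
  have "\<exists>k\<in>UNIV. b = along b a k" by (rule bexI[of _ 0]) (simp_all add: along_0)
  then have bS: "b \<in> S" using b by (simp add: S_def)
  have D: "(\<Sum>l\<in>S. real (mult_wt l)) > 0"
    by (rule sum_mult_pos[OF _ _ bS]) (use finite_weights in \<open>auto simp: S_def\<close>)
  \<comment> \<open>Minus the mean of the positions \<open>k\<close>, weighted by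
    multiplicities.\<close>
  define q where "q = - (\<Sum>l\<in>S. real (mult_wt l) * of_int (k l)) / (\<Sum>l\<in>S. real (mult_wt l))"
  have "(\<Sum>l\<in>S. of_nat (mult_wt l) * l (coroot a)) =
      (\<Sum>l\<in>S. of_nat (mult_wt l) * (b (coroot a) + of_int (k l) * a (coroot a)))"
    by (rule sum.cong[OF refl]) (use k in \<open>metis along_def\<close>)
  also have "\<dots> = of_real (\<Sum>l\<in>S. real (mult_wt l)) * b (coroot a)
      + of_real (\<Sum>l\<in>S. real (mult_wt l) * of_int (k l)) * a (coroot a)"
    by (simp add: distrib_left sum.distrib sum_distrib_right mult.assoc)
  finally have "of_real (\<Sum>l\<in>S. real (mult_wt l)) * b (coroot a) =
      - of_real (\<Sum>l\<in>S. real (mult_wt l) * of_int (k l)) * a (coroot a)"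
    using z by (simp add: eq_neg_iff_add_eq_0)
  moreover have "complex_of_real (\<Sum>l\<in>S. real (mult_wt l)) \<noteq> 0" using D by (simp del: of_real_sum)
  ultimately have "b (coroot a) = of_real q * a (coroot a)"
    unfolding q_def of_real_divide of_real_minus by (simp add: field_simps del: of_real_sum)
  then show ?thesis by blast
qed

text \<open>With \<open>l (coroot a) = q l * a (coroot a)\<close> for real \<open>q l\<close>, the trace formula for \<open>kf\<close> reads
  \<open>a (coroot a) = (a (coroot a))\<^sup>2 * (\<Sum>l. mult_wt l * (q l)\<^sup>2)\<close>.\<close>
lemma coroot_pos: assumes a: "a \<in> R" shows "\<exists>p::real. p > 0 \<and> a (coroot a) = of_real p"
proof -
  let ?A = "a (coroot a)"
  obtain q :: "('g \<Rightarrow> complex) \<Rightarrow> real" where q: "\<And>b. b \<in> weights \<Longrightarrow> b (coroot a) = of_real (q b) * ?A"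
    using coroot_ratio[OF a] by metis
  have nz: "coroot a \<noteq> 0"
  proof
    assume "coroot a = 0"
    then have "a t = 0" if "t \<in> H" for t using kf_coroot[OF a that] by (simp add: kf_left')
    then have "a = 0" using dual_of_eqI[OF R_dual[OF a] dual_of_zero] by simp
    then show False using a by (simp add: roots_def)
  qed
  \<comment> \<open>If \<open>a\<close> vanished on its coroot, \<open>coroot_ratio\<close> would
    make every root vanish there, and \<open>H_separated\<close> would force the coroot to be
    zero.\<close>
  have A0: "?A \<noteq> 0"
  proof
    assume "?A = 0"
    then have "b (coroot a) = 0" if "b \<in> R" for b using q[of b] that roots_eq by auto
    then show False using H_separated[OF coroot_H[OF a]] nz by blast
  qed
  define r where "r = (\<Sum>l\<in>weights. real (mult_wt l) * (q l)\<^sup>2)"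
  have "?A = kf (coroot a) (coroot a)" using kf_coroot[OF a coroot_H[OF a]] by simp
  also have "\<dots> = (\<Sum>l\<in>weights. of_nat (mult_wt l) * l (coroot a) * l (coroot a))"
    by (rule kf_H[OF coroot_H[OF a] coroot_H[OF a]])
  also have "\<dots> = (\<Sum>l\<in>weights. of_nat (mult_wt l) * (of_real (q l))\<^sup>2 * (?A * ?A))"
    by (rule sum.cong[OF refl]) (simp add: q power2_eq_square algebra_simps)
  also have "\<dots> = of_real r * (?A * ?A)" by (simp add: r_def sum_distrib_right)
  finally have "of_real r * ?A = 1" using A0 by simp
  then have "r \<noteq> 0" by auto
  with \<open>of_real r * ?A = 1\<close> have r: "?A = of_real (1 / r)" "r \<noteq> 0" by (simp_all add: field_simps)
  moreover have "r \<ge> 0" unfolding r_def by (intro sum_nonneg) simp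
  ultimately show ?thesis by (intro exI[of _ "1 / r"]) auto
qed

text \<open>If the string stopped at \<open>b\<close>, its lower half would carry a traceless action
  of \<open>coroot a\<close>, although every weight \<open>b + k a\<close> with
  \<open>k \<le> 0\<close> has negative real part there. The conclusion speaks of
  \<open>weights\<close> since \<open>a + b\<close> may be zero.\<close>

lemma root_string:
  assumes a: "a \<in> R" and b: "b \<in> R" and neg: "Re (b (coroot a)) < 0"
  shows "a + b \<in> weights"
proof (rule ccontr)
  assume ab: "a + b \<notin> weights"
  define S where "S = {l \<in> weights. \<exists>k\<in>{..0}. l = along b a k}"
  have ab': "along b a 1 \<notin> weights"
    using ab along_shift(1)[of b a 0] by (simp add: along_0 add.commute)
  have z: "(\<Sum>l\<in>S. of_nat (mult_wt l) * l (coroot a)) = 0"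
  proof (rule string_sum[OF a S_def])
    fix k :: int assume "k \<in> {..0}" "along b a (k + 1) \<in> weights"
    then show "k + 1 \<in> {..0}" using ab' by (cases "k = 0") auto
  qed auto
  obtain p where p: "p > 0" "a (coroot a) = of_real p" using coroot_pos[OF a] by blast
  have "\<exists>k\<in>{..0}. b = along b a k" by (rule bexI[of _ 0]) (simp_all add: along_0)
  then have bS: "b \<in> S" using b roots_eq by (simp add: S_def)
  have "Re (l (coroot a)) < 0" if hyp: "l \<in> S" for l
  proof -
    obtain k where k: "k \<le> 0" "l = along b a k" using hyp by (auto simp: S_def)
    then have "Re (l (coroot a)) = Re (b (coroot a)) + of_int k * p" by (simp add: along_def p)
    moreover have "of_int k * p \<le> 0" using k p by (simp add: mult_nonpos_nonneg)
    ultimately show ?thesis using neg by linarith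
  qed
  then have "real (mult_wt l) * Re (l (coroot a)) < 0" if "l \<in> S" for l
    using that mult_wt_pos[of l] by (simp add: S_def mult_pos_neg)
  moreover have "finite S" using finite_weights by (simp add: S_def)
  ultimately have "(\<Sum>l\<in>S. real (mult_wt l) * Re (l (coroot a))) < (\<Sum>l\<in>S. 0)"
    using bS by (intro sum_strict_mono) blast+
  then have "(\<Sum>l\<in>S. real (mult_wt l) * Re (l (coroot a))) < 0" by simp
  moreover have "(\<Sum>l\<in>S. real (mult_wt l) * Re (l (coroot a))) = Re (\<Sum>l\<in>S. of_nat (mult_wt l) * l (coroot a))"
    by simp
  ultimately show False using z by simp
qed

text \<open>The coroot has trace zero on the sum of the line of \<open>E (- a)\<close>, of \<open>H\<close>, and of the weight spaces of the
  positive multiples of \<open>a\<close>, which is invariant under \<open>E a\<close> and \<open>E (- a)\<close>.\<close>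
lemma wt_root: assumes a: "a \<in> R" shows "weight_space a = span {E a}"
proof -
  let ?m = "- a"
  have maR: "?m \<in> R" by (rule R_uminus[OF a])
  have maH: "?m \<in> HD" and aH: "a \<in> HD" using R_dual maR a by auto
  have a0: "a \<noteq> 0" using a by (simp add: roots_def)
  define S where "S = {l \<in> weights. \<exists>k\<in>{0..}. l = along 0 a k}"
  have S: "S \<subseteq> weights" by (auto simp: S_def)
  have mW: "?m \<in> weights" using maR roots_eq by blast
  have mS: "?m \<notin> S"
  proof
    assume "?m \<in> S"
    then obtain k where k: "k \<ge> 0" "- a = along 0 a k" by (auto simp: S_def)
    have "a x = 0" for x
    proof -
      have "- a x = of_int k * a x" using fun_cong[OF k(2), of x] by (simp add: along_def)
      then have "a x + of_int k * a x = 0" by (metis add.right_inverse)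
      then have "of_int (k + 1) * a x = 0" by (simp add: algebra_simps)
      then show ?thesis using k(1) by (simp del: of_int_add)
    qed
    then show False using a0 by auto
  qed
  \<comment> \<open>For \<open>- a\<close> only the line of the chosen root vector is taken, not the
    full weight space; it enters the trace with multiplicity exactly one.\<close>
  define B' where "B' l = (if l = ?m then {E ?m} else wbasis l)" for l
  let ?I = "insert ?m S" and ?B = "\<Union>l\<in>insert (- a) S. B' l"
  have fS: "finite S" using finite_subset[OF S finite_weights] .
  have IH: "?I \<subseteq> HD" using weights_HD[OF S] maH by blast
  have B'sub: "independent (B' l) \<and> B' l \<subseteq> weight_space l" if "l \<in> ?I" for l
    using wbasis(1,4) IH that E_wt[OF maR] E_nonzero[OF maR] by (auto simp: B'_def)
  note ind = independent_wt_Union[of ?I B', OF _ IH B'sub]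
  have I: "independent ?B" and disj: "\<And>l m. l \<in> ?I \<Longrightarrow> m \<in> ?I \<Longrightarrow> l \<noteq> m \<Longrightarrow> B' l \<inter> B' m = {}"
    using ind fS by blast+
  have sp: "v \<in> span ?B" if "l \<in> HD" "l \<in> weights \<Longrightarrow> l \<in> S" "v \<in> weight_space l" for l v
  proof -
    have "(\<Union>l\<in>S. wbasis l) \<subseteq> ?B" using mS by (auto simp: B'_def)
    then show ?thesis using wt_in_span[OF that] span_mono by blast
  qed
  have Em: "E ?m \<in> span ?B" by (rule span_base) (auto simp: B'_def)
  have along_in: "along 0 a k \<in> S" if "along 0 a k \<in> weights" "k \<ge> 0" for k
    using that by (auto simp: S_def)
  have Hsp: "v \<in> span ?B" if "v \<in> H" for v
    by (rule sp[of 0]) (use that along_in[of 0] along_0[of 0 a] dual_of_zero[of sc H] wt_zero in auto)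
  have e: "br (E a) b \<in> span ?B" if hyp: "b \<in> ?B" for b
  proof (cases "b = E ?m")
    case True
    then show ?thesis using Hsp[OF coroot_H[OF a]] by (simp add: coroot_def)
  next
    case False
    then obtain l where l: "l \<in> S" "b \<in> wbasis l" using hyp by (auto simp: B'_def split: if_splits)
    then have lH: "l \<in> HD" using weights_HD[OF S] by blast
    obtain k where k: "k \<ge> 0" "l = along 0 a k" using l by (auto simp: S_def)
    have "br (E a) b \<in> weight_space (a + l)" using br_root_wt[OF E_root[OF a]] wbasis(4)[OF lH] l by blast
    moreover have "a + l = along 0 a (k + 1)" using along_shift(1)[of 0 a k] k by (simp add: add.commute)
    ultimately show ?thesis using sp[of "a + l"] along_in[of "k + 1"] k dual_of_add[OF aH lH] by auto
  qed
  have f: "br (E ?m) b \<in> span ?B" if hyp: "b \<in> ?B" for b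
  proof (cases "b = E ?m")
    case True
    then show ?thesis by (simp add: alternating span_zero)
  next
    case False
    then obtain l where l: "l \<in> S" "b \<in> wbasis l" using hyp by (auto simp: B'_def split: if_splits)
    then have lH: "l \<in> HD" using weights_HD[OF S] by blast
    obtain k where k: "k \<ge> 0" "l = along 0 a k" using l by (auto simp: S_def)
    show ?thesis
    proof (cases "k = 0")
      case True
      \<comment> \<open>Lowering an element of \<open>H\<close> stays on the line of
        \<open>E ?m\<close>, so this line is enough for invariance.\<close>
      then have "b \<in> H" using l k wbasis(4)[OF lH] wt_zero along_0[of 0 a] by auto
      then have "br (E ?m) b = sc (a b) (E ?m)" using br_E[OF maR] br_antisym[of "E ?m" b] by simp
      then show ?thesis using Em span_scale by simp
    next
      case False
      have "br (E ?m) b \<in> weight_space (- a + l)"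
        using br_root_wt[OF E_root[OF maR]] wbasis(4)[OF lH] l by blast
      moreover have "- a + l = along 0 a (k - 1)" using along_shift(2)[of 0 a k] k by simp
      ultimately show ?thesis using sp[of "- a + l"] along_in[of "k - 1"] k False dual_of_add[OF maH lH] by auto
    qed
  qed
  let ?h = "coroot a"
  have hb: "br ?h b \<in> span (B' l)" if "l \<in> ?I" "b \<in> B' l" for l b
  proof (cases "l = ?m")
    case True
    then have b: "b = E ?m" "B' l = {E ?m}" using that by (auto simp: B'_def)
    show ?thesis unfolding b br_E[OF maR coroot_H[OF a]] by (intro span_scale span_base) simp
  next
    case False
    then show ?thesis using that IH wbasis(2,4)[of l] wt_br[OF coroot_H[OF a]] by (auto simp: B'_def)
  qed
  have "0 = tr ?B (br ?h)" by (rule tr_coroot[OF I e f, symmetric])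
  also have "\<dots> = (\<Sum>l\<in>?I. tr (B' l) (br ?h))"
    by (rule tr_Union[OF I _ disj hb]) (use fS in auto)
  also have "\<dots> = (\<Sum>l\<in>?I. l ?h * of_nat (card (B' l)))"
  proof (rule sum.cong[OF refl])
    fix l assume l: "l \<in> ?I"
    show "tr (B' l) (br ?h) = l ?h * of_nat (card (B' l))"
      by (rule tr_eigenvalue[OF _ linop_br])
        (use B'sub[OF l] hb[OF l] coroot_H[OF a] in \<open>auto simp: weight_space_def\<close>)
  qed
  also have "\<dots> = - a ?h + (\<Sum>l\<in>S. l ?h * of_nat (mult_wt l))"
  proof -
    have "(\<Sum>l\<in>S. l ?h * of_nat (card (B' l))) = (\<Sum>l\<in>S. l ?h * of_nat (mult_wt l))"
      by (rule sum.cong[OF refl]) (use mS in \<open>auto simp: B'_def mult_wt_def\<close>)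
    then show ?thesis using fS mS by (simp add: B'_def)
  qed
  \<comment> \<open>Every weight in \<open>S\<close> is a nonnegative multiple of \<open>a\<close>,
    so no summand has negative real part. The term of \<open>a\<close> alone is its multiplicity
    times the positive right-hand side, so the multiplicity is at most one.\<close>
  finally have main: "(\<Sum>l\<in>S. l ?h * of_nat (mult_wt l)) = a ?h" by (simp add: algebra_simps)
  obtain p where p: "p > 0" "a ?h = of_real p" using coroot_pos[OF a] by blast
  have "\<exists>k\<in>{0..}. a = along 0 a k" by (rule bexI[of _ 1]) (simp_all add: along_def)
  then have aS: "a \<in> S" using a roots_eq by (simp add: S_def)
  have nn: "Re (l ?h) \<ge> 0" if "l \<in> S" for l
    using that p by (auto simp: S_def along_def)
  have "Re (a ?h) * real (mult_wt a) \<le> (\<Sum>l\<in>S. Re (l ?h) * real (mult_wt l))"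
    using member_le_sum[of a S "\<lambda>l. Re (l ?h) * real (mult_wt l)"] nn fS aS by simp
  also have "\<dots> = Re (\<Sum>l\<in>S. l ?h * of_nat (mult_wt l))" by simp
  also have "\<dots> = p" using main p by simp
  finally have "mult_wt a \<le> 1" using p by simp
  moreover have "E a \<in> wbasis a" "finite (wbasis a)" using wbasis[OF aH] a by auto
  ultimately have "wbasis a = {E a}"
    using card_le_Suc0_iff_eq[of "wbasis a"] unfolding mult_wt_def by auto
  then show ?thesis using wbasis(2)[OF aH] by simp
qed

lemma finite_roots: "finite R" using finite_weights roots_eq by simp

lemma span_H_roots: "span (H \<union> E ` R) = UNIV"
proof -
  have "weight_space l \<subseteq> span (H \<union> E ` R)" if lH: "l \<in> HD" for l
  proof
    fix v assume v: "v \<in> weight_space l"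
    consider "v = 0" | "l = 0" | "l \<in> R" using wt_weightsI[OF lH v] roots_eq by blast
    then show "v \<in> span (H \<union> E ` R)"
    proof cases
      case 1 then show ?thesis by (simp add: span_zero)
    next
      case 2 then show ?thesis using v wt_zero by (auto intro: span_base)
    next
      case 3
      then have "span {E l} \<subseteq> span (H \<union> E ` R)" by (intro span_mono) blast
      then show ?thesis using v wt_root[OF 3] by blast
    qed
  qed
  then have "(\<Union>l\<in>HD. weight_space l) \<subseteq> span (H \<union> E ` R)" by blast
  then show ?thesis using span_minimal[OF _ subspace_span] span_wt by blast
qed

end

section \<open>Coroots and the modified Yang--Baxter equation\<close>

lemma sum_list_fun_apply: "(\<Sum>f\<leftarrow>fs. f) x = (\<Sum>f\<leftarrow>fs. f x)"
  by (induction fs) auto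

section \<open>Duality by the Killing form\<close>

context cartan_algebra
begin

text \<open>\<open>\<Phi>\<close> encodes the functional \<open>kf u\<close> by its values on
  \<open>basis\<close>. Nondegeneracy makes it injective, hence surjective by equality of
  dimensions.\<close>

lemma kf_riesz: assumes f: "linfun f" shows "\<exists>u. f = kf u"
proof -
  define \<Phi> where "\<Phi> u = (\<Sum>y\<in>basis. sc (kf u y) y)" for u
  have lin: "linop \<Phi>"
    by (auto simp: Vector_Spaces.linear_iff \<Phi>_def vector_space_axioms kf_left scale_left_distrib sum.distrib
        scale_sum_right)
  have rep: "c y = d y" if "(\<Sum>y\<in>basis. sc (c y) y) = (\<Sum>y\<in>basis. sc (d y) y)" "y \<in> basis" for c d y
  proof -
    have "(\<Sum>y\<in>basis. sc (c y - d y) y) = 0" using that by (simp add: scale_left_diff_distrib sum_subtractf)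
    then show ?thesis using independentD[OF independent_basis finite_basis subset_refl, of "\<lambda>y. c y - d y"] that by auto
  qed
  have ext: "g = h" if "linfun g" "linfun h" "\<And>y. y \<in> basis \<Longrightarrow> g y = h y" for g h
  proof
    fix x
    interpret vp: vector_space_pair sc "(*) :: complex \<Rightarrow> complex \<Rightarrow> complex"
      by (intro vector_space_pair.intro vector_space_times vector_space_axioms)
    show "g x = h x" by (rule vp.linear_eq_on[OF that(1,2), of x basis]) (use that(3) in auto)
  qed
  have "inj \<Phi>"
  proof (rule injI)
    fix u v assume "\<Phi> u = \<Phi> v"
    then have "kf u y = kf v y" if "y \<in> basis" for y using rep[of "kf u" "kf v"] that by (simp add: \<Phi>_def)
    then have "kf u = kf v" by (rule ext[OF linfun_kf linfun_kf])
    then have "u - v = 0" by (intro kf_nondegenerate) (simp add: kf_left')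
    then show "u = v" by simp
  qed
  then have "surj \<Phi>" by (rule linear_inj_imp_surj[OF lin])
  then obtain u where "\<Phi> u = (\<Sum>y\<in>basis. sc (f y) y)" by (metis surjD)
  then have "kf u y = f y" if "y \<in> basis" for y using rep[of "kf u" f] that by (simp add: \<Phi>_def)
  then have "kf u = f" by (rule ext[OF linfun_kf f])
  then show ?thesis by blast
qed

lemma kf_eqI: "(\<And>y. y \<in> basis \<Longrightarrow> kf u y = kf v y) \<Longrightarrow> u = v"
proof -
  assume e: "\<And>y. y \<in> basis \<Longrightarrow> kf u y = kf v y"
  have "kf (u - v) y = 0" for y
  proof -
    have "y \<in> span basis" by simp
    then show ?thesis
      by (induction rule: span_induct_alt) (use e in \<open>auto simp: kf_right kf_left'\<close>)
  qed
  then have "u - v = 0" by (rule kf_nondegenerate)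
  then show "u = v" by simp
qed

definition dual_vec :: "'g \<Rightarrow> 'g" where
  "dual_vec x = (THE x'. \<forall>y\<in>basis. kf x' y = (if y = x then 1 else 0))"

lemma dual_vec: assumes "x \<in> basis" "y \<in> basis" shows "kf (dual_vec x) y = (if y = x then 1 else 0)"
proof -
  obtain u where u: "(\<lambda>v. representation basis v x) = kf u"
    using kf_riesz[OF linear_representation[OF independent_basis span_basis]] by blast
  have "kf u y = (if y = x then 1 else 0)" if "y \<in> basis" for y
    using fun_cong[OF u, of y] representation_basis[OF independent_basis that] by auto
  then have ex: "\<exists>!x'. \<forall>y\<in>basis. kf x' y = (if y = x then 1 else 0)"
    by (intro ex1I[of _ u]) (auto intro!: kf_eqI)
  show ?thesis using theI'[OF ex] assms unfolding dual_vec_def by blast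
qed

text \<open>This expansion and the next one exchange the roles of the two dual bases. They say that
  contracting the Casimir element with \<open>kf u\<close> in either slot returns
  \<open>u\<close>.\<close>

lemma dual_vec_expand: "u = (\<Sum>x\<in>basis. sc (kf u x) (dual_vec x))"
proof (rule kf_eqI)
  fix y assume y: "y \<in> basis"
  have "kf (\<Sum>x\<in>basis. sc (kf u x) (dual_vec x)) y = (\<Sum>x\<in>basis. kf u x * kf (dual_vec x) y)"
    by (simp add: lin_sum[OF linfun_kf_left] kf_left)
  also have "\<dots> = (\<Sum>x\<in>basis. if y = x then kf u x else 0)"
    by (rule sum.cong[OF refl]) (use y dual_vec in auto)
  also have "\<dots> = kf u y" using y finite_basis by simp
  finally show "kf u y = kf (\<Sum>x\<in>basis. sc (kf u x) (dual_vec x)) y" by simp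
qed

lemma dual_vec_expand': "u = (\<Sum>x\<in>basis. sc (kf u (dual_vec x)) x)"
proof -
  have r: "kf u (dual_vec x) = representation basis u x" if x: "x \<in> basis" for x
  proof -
    have "kf u (dual_vec x) = kf (dual_vec x) (\<Sum>y\<in>basis. sc (representation basis u y) y)"
      using span_expand[OF independent_basis, of u] kf_sym[of u] by simp
    also have "\<dots> = (\<Sum>y\<in>basis. if y = x then representation basis u y else 0)"
      by (auto simp: lin_sum[OF linfun_kf] kf_right dual_vec[OF x] intro!: sum.cong)
    finally show ?thesis using x finite_basis by simp
  qed
  have "u = (\<Sum>x\<in>basis. sc (representation basis u x) x)" by (rule span_expand[OF independent_basis]) simp
  also have "\<dots> = (\<Sum>x\<in>basis. sc (kf u (dual_vec x)) x)" by (rule sum.cong[OF refl]) (simp add: r)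
  finally show ?thesis .
qed

end

section \<open>Positive and simple roots\<close>

locale positive_root_algebra = root_vector_algebra sc br H E
  for sc :: "complex \<Rightarrow> 'g::ab_group_add \<Rightarrow> 'g" and br :: "'g \<Rightarrow> 'g \<Rightarrow> 'g" and H E +
  fixes P :: "('g \<Rightarrow> complex) set"
  assumes positive: "positive_system (roots sc br H) P"
begin

lemma P_R: "a \<in> P \<Longrightarrow> a \<in> R" and P_cases: "a \<in> R \<Longrightarrow> a \<in> P \<or> - a \<in> P"
  and P_not_neg: "a \<in> P \<Longrightarrow> - a \<notin> P"
  and P_closed: "a \<in> P \<Longrightarrow> b \<in> P \<Longrightarrow> a + b \<in> R \<Longrightarrow> a + b \<in> P"
  using positive by (auto simp: positive_system_def)

lemma finite_P: "finite P"
  using finite_subset[OF _ finite_roots] P_R by blast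

lemma P_add: assumes "a \<in> P" "b \<in> P" "a + b \<in> weights" shows "a + b \<in> P"
proof -
  have "a + b \<noteq> 0"
  proof
    assume "a + b = 0"
    then have "b = - a" by (metis add_eq_0_iff)
    then show False using assms P_not_neg by blast
  qed
  then show ?thesis using assms P_closed roots_eq by blast
qed

text \<open>A positive system is given by closure alone, without a height function; this lemma takes
  its place. In a vanishing sum containing \<open>a\<close>, positivity of
  \<open>a (coroot a)\<close> forces some other summand to pair negatively with
  \<open>coroot a\<close>; by \<open>root_string\<close> the two merge into one positive root,
  giving a shorter vanishing sum.\<close>

lemma P_sum_nonzero: "xs \<noteq> [] \<Longrightarrow> set xs \<subseteq> P \<Longrightarrow> sum_list xs \<noteq> 0"
proof (induction "length xs" arbitrary: xs rule: less_induct)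
  case less
  then obtain a ys where xs: "xs = a # ys" by (cases xs) auto
  then have a: "a \<in> P" "a \<in> R" and ys: "set ys \<subseteq> P" using less.prems P_R by auto
  show ?case
  proof
    assume z: "sum_list xs = 0"
    obtain p where p: "p > 0" "a (coroot a) = of_real p" using coroot_pos[OF a(2)] by blast
    have "a (coroot a) + (\<Sum>y\<leftarrow>ys. y (coroot a)) = 0"
      using fun_cong[OF z, of "coroot a"] sum_list_fun_apply[of ys "coroot a"] by (simp add: xs)
    then have "Re (a (coroot a) + (\<Sum>y\<leftarrow>ys. y (coroot a))) = 0" by simp
    moreover have "Re (\<Sum>y\<leftarrow>ys. y (coroot a)) = (\<Sum>y\<leftarrow>ys. Re (y (coroot a)))"
      by (induction ys) auto
    ultimately have "(\<Sum>y\<leftarrow>ys. Re (y (coroot a))) < 0" using p by simp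
    then obtain y where y: "y \<in> set ys" "Re (y (coroot a)) < 0"
      by (metis (no_types, lifting) imageE list.set_map not_le sum_list_nonneg)
    then have ay: "a + y \<in> P" using P_add root_string[OF a(2), of y] P_R ys a by blast
    have "sum_list (remove1 y ys) = sum_list ys - y" using y(1)
      by (induction ys) (auto simp: algebra_simps)
    then have "sum_list ((a + y) # remove1 y ys) = 0" using z by (simp add: xs)
    moreover have "length ((a + y) # remove1 y ys) < length xs"
      using length_pos_if_in_set[OF y(1)] y(1) by (simp add: xs length_remove1)
    moreover have "set ((a + y) # remove1 y ys) \<subseteq> P" using ay ys set_remove1_subset[of y ys] by auto
    ultimately show False using less.hyps by blast
  qed
qed

text \<open>\<open>b\<close> is placed below \<open>a\<close> when \<open>a - b\<close> is a
  nonempty sum of positive roots. The relation is finite, and irreflexive by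
  \<open>P_sum_nonzero\<close>, so it is well-founded; a root that is not simple is a sum of two
  smaller ones.\<close>

lemma simple_vanish:
  assumes t: "\<And>a. a \<in> simple_roots P \<Longrightarrow> a t = 0" and a: "a \<in> P"
  shows "a t = 0"
proof -
  define r where "r = {(b, a). b \<in> P \<and> a \<in> P \<and> (\<exists>xs. xs \<noteq> [] \<and> set xs \<subseteq> P \<and> a = b + sum_list xs)}"
  have "r \<subseteq> P \<times> P" by (auto simp: r_def)
  then have fin: "finite r" using finite_P finite_subset by blast
  have "trans r"
  proof (rule transI)
    fix x y z assume "(x, y) \<in> r" "(y, z) \<in> r"
    then obtain xs ys where "x \<in> P" "z \<in> P" "xs \<noteq> []" "set xs \<subseteq> P" "set ys \<subseteq> P"
      "y = x + sum_list xs" "z = y + sum_list ys" by (auto simp: r_def)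
    then show "(x, z) \<in> r" unfolding r_def by (auto intro!: exI[of _ "xs @ ys"] simp: add.assoc)
  qed
  moreover have "(x, x) \<notin> r" for x using P_sum_nonzero by (auto simp: r_def)
  ultimately have "acyclic r" by (simp add: acyclic_def trancl_id)
  then have "wf r" by (rule finite_acyclic_wf[OF fin])
  then show ?thesis using a
  proof (induction a rule: wf_induct_rule)
    case (less a)
    show ?case
    proof (cases "a \<in> simple_roots P")
      case False
      then obtain b c where bc: "b \<in> P" "c \<in> P" "a = b + c" using less.prems by (auto simp: simple_roots_def)
      have 1: "[c] \<noteq> [] \<and> set [c] \<subseteq> P \<and> a = b + sum_list [c]" using bc by simp
      have 2: "[b] \<noteq> [] \<and> set [b] \<subseteq> P \<and> a = c + sum_list [b]" using bc by (simp add: add.commute)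
      have "(b, a) \<in> r" unfolding r_def using 1 bc(1) less.prems by blast
      moreover have "(c, a) \<in> r" unfolding r_def using 2 bc(2) less.prems by blast
      ultimately have "b t = 0" "c t = 0" using less.IH bc by blast+
      then show ?thesis by (simp add: bc(3))
    qed (rule t)
  qed
qed

lemma kf_root_H: assumes "a \<in> R" "t \<in> H" shows "kf (E a) t = 0"
proof -
  have "a \<noteq> 0" using assms(1) by (simp add: roots_def)
  then obtain x where "x \<in> H" "a x \<noteq> 0"
    using dual_of_eqI[OF R_dual[OF assms(1)] dual_of_zero] by auto
  then show ?thesis using kf_root_wt_orth[OF E_root[OF assms(1)], of t 0] wt_zero assms(2) by auto
qed

text \<open>A functional vanishing on the simple coroots is represented on \<open>H\<close> by some
  \<open>u0\<close> in \<open>H\<close> that all simple roots kill. Then all roots kill it, and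
  \<open>H_separated\<close> gives zero.\<close>

lemma span_simple_coroots: "span (coroot ` simple_roots P) = H"
proof
  have sR: "a \<in> R" if "a \<in> simple_roots P" for a using that P_R by (auto simp: simple_roots_def)
  show "span (coroot ` simple_roots P) \<subseteq> H"
    by (rule span_minimal[OF _ subspace_H]) (use sR coroot_H in auto)
  show "H \<subseteq> span (coroot ` simple_roots P)"
  proof
    fix t assume t: "t \<in> H"
    show "t \<in> span (coroot ` simple_roots P)"
    proof (rule ccontr)
      assume "t \<notin> span (coroot ` simple_roots P)"
      then obtain f where f: "linfun f" "\<And>x. x \<in> span (coroot ` simple_roots P) \<Longrightarrow> f x = 0" "f t = 1"
        using subspace_proper_functional[OF subspace_span] by blast
      obtain u where u: "f = kf u" using kf_riesz[OF f(1)] by blast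
      have "u \<in> span (H \<union> E ` R)" using span_H_roots by simp
      \<comment> \<open>Root vectors are orthogonal to \<open>H\<close>, so dropping the root
        components of \<open>u\<close> does not change its pairing with \<open>H\<close>.\<close>
      then have "\<exists>u0\<in>H. \<forall>s\<in>H. kf u s = kf u0 s"
      proof (induction rule: span_induct_alt)
        case base then show ?case using subspace_0[OF subspace_H] by blast
      next
        case (step c x y)
        then obtain y0 where y0: "y0 \<in> H" "\<forall>s\<in>H. kf y s = kf y0 s" by blast
        show ?case
        proof (cases "x \<in> H")
          case True
          then show ?thesis using y0 subspace_H
            by (intro bexI[of _ "sc c x + y0"]) (auto simp: kf_left subspace_add subspace_scale)
        next
          case False
          then show ?thesis using y0 step kf_root_H by (intro bexI[of _ y0]) (auto simp: kf_left)
        qed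
      qed
      then obtain u0 where u0: "u0 \<in> H" "\<And>s. s \<in> H \<Longrightarrow> kf u s = kf u0 s" by blast
      have "a u0 = 0" if "a \<in> simple_roots P" for a
      proof -
        have "a u0 = kf u0 (coroot a)" using kf_coroot[OF sR[OF that] u0(1)] kf_sym by simp
        also have "\<dots> = f (coroot a)" using u0(2) coroot_H[OF sR[OF that]] u by simp
        also have "\<dots> = 0" using f(2) that span_base by blast
        finally show ?thesis .
      qed
      then have "a u0 = 0" if "a \<in> P" for a using simple_vanish that by blast
      then have "a u0 = 0" if "a \<in> R" for a using P_cases[OF that] by fastforce
      then have "u0 = 0" using H_separated u0(1) by blast
      then have "f t = 0" using u0(2)[OF t] u by (simp add: kf_left')
      then show False using f(3) by simp
    qed
  qed
qed

text \<open>The bivector \<open>r_zero\<close> turned into an endomorphism by the Killing form, as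
  \<open>contr_r0_kf\<close> confirms.\<close>

definition rho :: "'g \<Rightarrow> 'g" where
  "rho y = (\<Sum>a\<in>P. sc (kf y (E (- a))) (E a) - sc (kf y (E a)) (E (- a)))"

lemma linop_rho: "linop rho"
  by (auto simp: Vector_Spaces.linear_iff rho_def vector_space_axioms kf_left scale_left_distrib sum.distrib[symmetric]
      scale_sum_right scale_right_diff_distrib intro!: sum.cong)

lemma rho_simps: "rho (x + y) = rho x + rho y" "rho (sc c x) = sc c (rho x)" "rho 0 = 0"
  "rho (- x) = - rho x" "rho (x - y) = rho x - rho y"
  using linop_rho by (auto simp: lin_add lin_scale lin_zero lin_neg lin_diff)

lemma kf_E_E: assumes "a \<in> R" "b \<in> R" shows "kf (E a) (E b) = (if b = - a then 1 else 0)"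
proof (cases "b = - a")
  case True then show ?thesis using kf_E assms by simp
next
  case False
  then obtain x where "x \<in> H" "b x \<noteq> (- a) x"
    using dual_of_eqI[OF R_dual[OF assms(2)] R_dual[OF R_uminus[OF assms(1)]]] by blast
  then show ?thesis using kf_root_wt_orth[OF E_root[OF assms(1)] E_wt[OF assms(2)]] False by simp
qed

lemma rho_pos: assumes a: "a \<in> P" shows "rho (E a) = E a"
proof -
  have "rho (E a) = (\<Sum>b\<in>P. if b = a then E a else 0)"
    unfolding rho_def
  proof (rule sum.cong[OF refl])
    fix b assume b: "b \<in> P"
    have "b \<noteq> - a" using P_not_neg[OF a] b by blast
    then show "sc (kf (E a) (E (- b))) (E b) - sc (kf (E a) (E b)) (E (- b)) = (if b = a then E a else 0)"
      using kf_E_E[OF P_R[OF a] R_uminus[OF P_R[OF b]]] kf_E_E[OF P_R[OF a] P_R[OF b]] by auto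
  qed
  then show ?thesis using a finite_P by simp
qed

lemma rho_neg: assumes a: "a \<in> P" shows "rho (E (- a)) = - E (- a)"
proof -
  have "rho (E (- a)) = (\<Sum>b\<in>P. if b = a then - E (- a) else 0)"
    unfolding rho_def
  proof (rule sum.cong[OF refl])
    fix b assume b: "b \<in> P"
    have "b \<noteq> - a" "- b \<noteq> a" using P_not_neg[OF a] P_not_neg[OF b] a b by auto
    then show "sc (kf (E (- a)) (E (- b))) (E b) - sc (kf (E (- a)) (E b)) (E (- b)) = (if b = a then - E (- a) else 0)"
      using kf_E_E[OF R_uminus[OF P_R[OF a]] R_uminus[OF P_R[OF b]]] kf_E_E[OF R_uminus[OF P_R[OF a]] P_R[OF b]] by auto
  qed
  then show ?thesis using a finite_P by simp
qed

lemma rho_H: "t \<in> H \<Longrightarrow> rho t = 0"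
  unfolding rho_def using kf_root_H[OF P_R] kf_root_H[OF R_uminus[OF P_R]] kf_sym[of t]
  by (intro sum.neutral) simp

lemma br_E_E:
  assumes "a \<in> R" "b \<in> R"
  shows "br (E a) (E b) = 0 \<or> a + b \<in> weights" "a + b \<in> R \<Longrightarrow> \<exists>c. br (E a) (E b) = sc c (E (a + b))"
proof -
  have w: "br (E a) (E b) \<in> weight_space (a + b)" by (rule br_root_wt[OF E_root[OF assms(1)] E_wt[OF assms(2)]])
  then show "br (E a) (E b) = 0 \<or> a + b \<in> weights"
    using wt_weightsI[OF dual_of_add[OF R_dual R_dual]] assms by blast
  show "\<exists>c. br (E a) (E b) = sc c (E (a + b))" if "a + b \<in> R"
    using w wt_root[OF that] by (auto simp: span_singleton)
qed

lemma rho_br_pos: assumes "a \<in> P" "b \<in> P" shows "rho (br (E a) (E b)) = br (E a) (E b)"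
proof (cases "br (E a) (E b) = 0")
  case True then show ?thesis by (simp add: rho_simps)
next
  case False
  then have ab: "a + b \<in> P" using br_E_E(1) P_add P_R assms by blast
  then obtain c where "br (E a) (E b) = sc c (E (a + b))" using br_E_E(2) P_R assms by blast
  then show ?thesis using rho_pos[OF ab] by (simp add: rho_simps)
qed

lemma rho_br_neg: assumes "a \<in> P" "b \<in> P" shows "rho (br (E (- a)) (E (- b))) = - br (E (- a)) (E (- b))"
proof (cases "br (E (- a)) (E (- b)) = 0")
  case True then show ?thesis by (simp add: rho_simps)
next
  case False
  have eq: "- a + - b = - (a + b)" by simp
  have n: "- a \<in> R" "- b \<in> R" using R_uminus P_R assms by auto
  have "- (a + b) \<in> weights" using br_E_E(1)[OF n] False eq by simp
  moreover have "a + b \<noteq> 0" using P_sum_nonzero[of "[a, b]"] assms by simp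
  then have "- (a + b) \<noteq> 0" by (metis neg_equal_0_iff_equal)
  ultimately have "- (a + b) \<in> R" using roots_eq by blast
  then have mR: "- a + - b \<in> R" "a + b \<in> R" using R_uminus[of "- (a + b)"] eq by (simp_all only: minus_minus)
  then have ab: "a + b \<in> P" using P_closed assms by blast
  obtain c where c: "br (E (- a)) (E (- b)) = sc c (E (- a + - b))" using br_E_E(2)[OF n mR(1)] by blast
  show ?thesis unfolding c eq using rho_neg[OF ab] by (simp add: rho_simps)
qed

text \<open>The defect \<open>D\<close> is bilinear, so elements of \<open>H\<close> and root
  vectors suffice. For equal signs the bracket stays on the same side because \<open>P\<close> is
  closed; for opposite signs the two middle brackets cancel; if one argument is in \<open>H\<close>,
  the other is an eigenvector of its bracket.\<close>

lemma rho_modified_yang_baxter: "br (rho x) (rho y) - rho (br (rho x) y + br x (rho y)) = - br x y"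
proof -
  define D where "D x y = br (rho x) (rho y) - rho (br (rho x) y + br x (rho y)) + br x y" for x y
  have l1: "linop (\<lambda>x. D x y)" for y
    by (auto simp: Vector_Spaces.linear_iff D_def vector_space_axioms rho_simps br_left br_right
        scale_right_distrib scale_right_diff_distrib)
  have l2: "linop (D x)" for x
    by (auto simp: Vector_Spaces.linear_iff D_def vector_space_axioms rho_simps br_left br_right
        scale_right_distrib scale_right_diff_distrib)
  have br_H: "br (E a) t = sc (- a t) (E a)" if "a \<in> R" "t \<in> H" for a t
    using br_E[OF that] br_antisym[of "E a" t] by simp
  have base: "D x y = 0" if xy: "x \<in> H \<union> E ` R" "y \<in> H \<union> E ` R" for x y
  proof -
    have cs: "u \<in> H \<or> (\<exists>a\<in>P. u = E a) \<or> (\<exists>a\<in>P. u = E (- a))" if "u \<in> H \<union> E ` R" for u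
    proof -
      { fix a assume a: "a \<in> R" "u = E a"
        then consider "a \<in> P" | "- a \<in> P" using P_cases by blast
        then have "(\<exists>a\<in>P. u = E a) \<or> (\<exists>a\<in>P. u = E (- a))"
        proof cases
          case 2 then show ?thesis using a by (intro disjI2 bexI[of _ "- a"]) simp_all
        qed (use a in blast) }
      then show ?thesis using that by blast
    qed
    show ?thesis
      using cs[OF xy(1)] cs[OF xy(2)]
    proof (elim disjE bexE)
      assume "x \<in> H" "y \<in> H"
      then show ?thesis by (simp add: D_def rho_H br_left br_right rho_simps H_abelian)
    next
      fix b assume b: "x \<in> H" "b \<in> P" "y = E b"
      then show ?thesis by (simp add: D_def rho_H rho_pos br_left br_right rho_simps br_E P_R)
    next
      fix b assume b: "x \<in> H" "b \<in> P" "y = E (- b)"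
      then show ?thesis
        by (simp add: D_def rho_H rho_neg br_left br_right rho_simps br_E[OF R_uminus[OF P_R]])
    next
      fix a assume a: "y \<in> H" "a \<in> P" "x = E a"
      then show ?thesis by (simp add: D_def rho_H rho_pos br_left br_right rho_simps br_H P_R)
    next
      fix a assume a: "y \<in> H" "a \<in> P" "x = E (- a)"
      then show ?thesis
        by (simp add: D_def rho_H rho_neg br_left br_right rho_simps br_H[OF R_uminus[OF P_R]])
    next
      fix a b assume "a \<in> P" "x = E a" "b \<in> P" "y = E b"
      then show ?thesis by (simp add: D_def rho_pos rho_simps rho_br_pos)
    next
      fix a b assume "a \<in> P" "x = E a" "b \<in> P" "y = E (- b)"
      then show ?thesis by (simp add: D_def rho_pos rho_neg rho_simps br_left br_right)
    next
      fix a b assume "a \<in> P" "x = E (- a)" "b \<in> P" "y = E b"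
      then show ?thesis by (simp add: D_def rho_pos rho_neg rho_simps br_left br_right)
    next
      fix a b assume "a \<in> P" "x = E (- a)" "b \<in> P" "y = E (- b)"
      then show ?thesis by (simp add: D_def rho_neg rho_simps br_left br_right rho_br_neg)
    qed
  qed
  have first: "D x y \<in> {0}" if "y \<in> H \<union> E ` R" for y
    by (rule linop_span[OF l1, of "H \<union> E ` R"]) (use base that span_H_roots in auto)
  have "D x y \<in> {0}"
    by (rule linop_span[OF l2 first subspace_single_0, of "H \<union> E ` R"]) (use span_H_roots in auto)
  then show ?thesis by (simp add: D_def eq_neg_iff_add_eq_0)
qed

lemma rho_skew: "kf (rho x) y = - kf x (rho y)"
proof -
  have "kf (rho x) y = (\<Sum>a\<in>P. kf x (E (- a)) * kf (E a) y - kf x (E a) * kf (E (- a)) y)"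
    unfolding rho_def by (simp add: lin_sum[OF linfun_kf_left] kf_left kf_left')
  also have "\<dots> = - (\<Sum>a\<in>P. kf y (E (- a)) * kf x (E a) - kf y (E a) * kf x (E (- a)))"
    unfolding sum_negf[symmetric] by (rule sum.cong[OF refl]) (simp add: kf_sym[of "E _" y] mult.commute)
  also have "\<dots> = - kf x (rho y)"
    unfolding rho_def by (simp add: lin_sum[OF linfun_kf] kf_right)
  finally show ?thesis .
qed

text \<open>Skewness of \<open>rho\<close> and invariance of the form collect the three terms into
  one pairing of \<open>z\<close> with the left side of the modified Yang--Baxter equation. The
  result \<open>kf y (br x z)\<close> is what the Casimir commutator gives on \<open>kf x\<close>,
  \<open>kf y\<close>, \<open>kf z\<close>.\<close>

lemma rho_cyclic:
  "kf x (br (rho y) (rho z)) + kf y (br (rho z) (rho x)) + kf z (br (rho x) (rho y)) = kf y (br x z)"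
proof -
  have 1: "kf x (br (rho y) (rho z)) = - kf z (rho (br x (rho y)))"
  proof -
    have "kf x (br (rho y) (rho z)) = kf (br x (rho y)) (rho z)" by (rule kf_invariant[symmetric])
    also have "\<dots> = - kf (rho (br x (rho y))) z" using rho_skew by simp
    also have "\<dots> = - kf z (rho (br x (rho y)))" by (subst kf_sym) (rule refl)
    finally show ?thesis .
  qed
  have 2: "kf y (br (rho z) (rho x)) = - kf z (rho (br (rho x) y))"
  proof -
    have "kf y (br (rho z) (rho x)) = kf (br (rho z) (rho x)) y" by (rule kf_sym)
    also have "\<dots> = kf (rho z) (br (rho x) y)" by (rule kf_invariant)
    also have "\<dots> = - kf z (rho (br (rho x) y))" by (rule rho_skew)
    finally show ?thesis .
  qed
  have "kf x (br (rho y) (rho z)) + kf y (br (rho z) (rho x)) + kf z (br (rho x) (rho y))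
    = kf z (br (rho x) (rho y) - rho (br (rho x) y + br x (rho y)))"
    by (simp add: 1 2 kf_right rho_simps)
  also have "\<dots> = - kf z (br x y)" by (simp add: rho_modified_yang_baxter kf_right)
  also have "\<dots> = kf y (br x z)"
  proof -
    have "kf y (br x z) = kf (br y x) z" by (simp add: kf_invariant)
    also have "\<dots> = - kf (br x y) z" using br_antisym[of y x] by (simp add: kf_left')
    finally show ?thesis using kf_sym[of "br x y" z] by simp
  qed
  finally show ?thesis .
qed

end

section \<open>Bivectors and the Schouten bracket\<close>

lemma sum_fun_apply: "(\<Sum>i\<in>I. f i) x = (\<Sum>i\<in>I. f i x)" for f :: "'i \<Rightarrow> 'a \<Rightarrow> 'b::comm_monoid_add"
  by (induction I rule: infinite_finite_induct) auto

lemma sum_list_map_nth: "(\<Sum>x\<leftarrow>xs. f x) = (\<Sum>i<length xs. f (xs ! i))"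
  for f :: "'a \<Rightarrow> 'b::comm_monoid_add"
  by (simp add: sum_list_sum_nth atLeast0LessThan)

lemma delete_nth_simps [simp]:
  "delete_nth 0 (x # xs) = xs" "delete_nth (Suc n) (x # xs) = x # delete_nth n xs"
  by (simp_all add: delete_nth_def)

lemma length_delete_nth: "i < length xs \<Longrightarrow> length (delete_nth i xs) = length xs - 1"
  by (simp add: delete_nth_def)

lemma length_2_cases: "length xs = 2 \<Longrightarrow> \<exists>x y. xs = [x, y]"
  by (cases xs; cases "tl xs"; cases "tl (tl xs)") auto

lemma length_3_cases: "length xs = 3 \<Longrightarrow> \<exists>x y z. xs = [x, y, z]"
  by (cases xs; cases "tl xs"; cases "tl (tl xs)"; cases "tl (tl (tl xs))") auto

text \<open>For the definite description, one decomposition must exist and all decompositions must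
  give the same value \<open>R\<close>.\<close>

lemma schouten_eqI:
  assumes "\<forall>xs\<in>set F0. length xs = p \<and> set xs \<subseteq> S" "\<forall>ys\<in>set G0. length ys = q \<and> set ys \<subseteq> S"
    "P = (\<Sum>xs\<leftarrow>F0. w xs)" "Q = (\<Sum>ys\<leftarrow>G0. w ys)"
    and val: "\<And>F G. \<forall>xs\<in>set F. length xs = p \<and> set xs \<subseteq> S \<Longrightarrow> \<forall>ys\<in>set G. length ys = q \<and> set ys \<subseteq> S \<Longrightarrow>
      P = (\<Sum>xs\<leftarrow>F. w xs) \<Longrightarrow> Q = (\<Sum>ys\<leftarrow>G. w ys) \<Longrightarrow>
      (\<Sum>xs\<leftarrow>F. \<Sum>ys\<leftarrow>G. \<Sum>i<p. \<Sum>j<q.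
       (let T = w (br (xs ! i) (ys ! j) # delete_nth i xs @ delete_nth j ys)
        in if even (i + j) then T else - T)) = R"
  shows "schouten S br w p q P Q = R"
  unfolding schouten_def
proof (rule the_equality)
  show "\<exists>F G. (\<forall>xs\<in>set F. length xs = p \<and> set xs \<subseteq> S) \<and> (\<forall>ys\<in>set G. length ys = q \<and> set ys \<subseteq> S) \<and>
     P = (\<Sum>xs\<leftarrow>F. w xs) \<and> Q = (\<Sum>ys\<leftarrow>G. w ys) \<and>
     R = (\<Sum>xs\<leftarrow>F. \<Sum>ys\<leftarrow>G. \<Sum>i<p. \<Sum>j<q.
       (let T = w (br (xs ! i) (ys ! j) # delete_nth i xs @ delete_nth j ys)
        in if even (i + j) then T else - T))"
    using assms(1-4) val[OF assms(1-4)] by blast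
qed (use val in blast)

text \<open>The signed sum over the six permutations, without 1/6, in keeping with the normalization
  of \<open>wedge\<close>.\<close>

definition skew3 :: "('a \<Rightarrow> 'a \<Rightarrow> 'a \<Rightarrow> complex) \<Rightarrow> 'a \<Rightarrow> 'a \<Rightarrow> 'a \<Rightarrow> complex" where
  "skew3 K a b c = K a b c - K a c b + K b c a - K b a c + K c a b - K c b a"

section \<open>Multivectors as forms on functionals\<close>

context fin_dim_cspace
begin

definition supported :: "nat \<Rightarrow> 'v tensor \<Rightarrow> bool" where
  "supported k P \<longleftrightarrow> (\<forall>\<xi>s. \<not> (length \<xi>s = k \<and> (\<forall>\<xi>\<in>set \<xi>s. linfun \<xi>)) \<longrightarrow> P \<xi>s = 0)"

lemma supported_eqI:
  assumes "supported k P" "supported k Q"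
    "\<And>\<xi>s. length \<xi>s = k \<Longrightarrow> \<forall>\<xi>\<in>set \<xi>s. linfun \<xi> \<Longrightarrow> P \<xi>s = Q \<xi>s"
  shows "P = Q"
proof
  fix \<xi>s show "P \<xi>s = Q \<xi>s"
    using assms unfolding supported_def by (cases "length \<xi>s = k \<and> (\<forall>\<xi>\<in>set \<xi>s. linfun \<xi>)") metis+
qed

lemma supported_sum: "(\<And>i. i \<in> I \<Longrightarrow> supported k (P i)) \<Longrightarrow> supported k (\<Sum>i\<in>I. P i)"
  unfolding supported_def by (simp add: sum_fun_apply)

lemma supported_wedge: "supported (length xs) (wedge sc xs)"
proof (induction xs)
  case Nil
  then show ?case by (auto simp: supported_def wedge_def)
next
  case (Cons x xs)
  have "wedge sc (x # xs) \<xi>s = 0"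
    if n: "\<not> (length \<xi>s = length (x # xs) \<and> (\<forall>\<xi>\<in>set \<xi>s. linfun \<xi>))" for \<xi>s
  proof (cases "\<forall>\<xi>\<in>set \<xi>s. linfun \<xi>")
    case False
    then show ?thesis by (auto simp: wedge_def ext_mult_def)
  next
    case True
    then have "length \<xi>s \<noteq> Suc (length xs)" using n by simp
    have "wedge sc xs (delete_nth j \<xi>s) = 0" if "j < length \<xi>s" for j
    proof -
      have "length (delete_nth j \<xi>s) \<noteq> length xs"
        unfolding length_delete_nth[OF that] using \<open>length \<xi>s \<noteq> Suc (length xs)\<close> that by arith
      then show ?thesis using Cons unfolding supported_def by blast
    qed
    then show ?thesis using True by (auto simp: wedge_def ext_mult_def intro!: sum.neutral)
  qed
  then show ?case unfolding supported_def by blast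
qed

lemma wedge_1: "linfun a \<Longrightarrow> wedge sc [x] [a] = a x"
  by (simp add: wedge_def ext_mult_def)

lemma wedge_2: "linfun a \<Longrightarrow> linfun b \<Longrightarrow> wedge sc [x, y] [a, b] = a x * b y - b x * a y"
  by (simp add: wedge_def ext_mult_def lessThan_Suc algebra_simps)

lemma wedge_3: "linfun a \<Longrightarrow> linfun b \<Longrightarrow> linfun c \<Longrightarrow>
    wedge sc [x, y, z] [a, b, c] = skew3 (\<lambda>a b c. a x * b y * c z) a b c"
  by (simp add: wedge_def ext_mult_def lessThan_Suc skew3_def algebra_simps)

lemma wedge_in_ext_power: "wedge sc xs \<in> ext_power sc (length xs)"
  unfolding ext_power_def by (auto intro!: exI[of _ "[xs]"])

lemma ext_power_zero: "0 \<in> ext_power sc k"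
  unfolding ext_power_def by (auto intro!: exI[of _ "[]"])

lemma ext_power_add: "P \<in> ext_power sc k \<Longrightarrow> Q \<in> ext_power sc k \<Longrightarrow> P + Q \<in> ext_power sc k"
  unfolding ext_power_def
proof clarsimp
  fix F G :: "'v list list"
  assume "\<forall>xs\<in>set F. length xs = k" "\<forall>xs\<in>set G. length xs = k"
  then show "\<exists>Fa. (\<forall>xs\<in>set Fa. length xs = k) \<and>
        (\<Sum>xs\<leftarrow>F. wedge sc xs) + (\<Sum>xs\<leftarrow>G. wedge sc xs) = (\<Sum>xs\<leftarrow>Fa. wedge sc xs)"
    by (intro exI[of _ "F @ G"]) auto
qed

lemma ext_power_sum: "(\<And>i. i \<in> I \<Longrightarrow> P i \<in> ext_power sc k) \<Longrightarrow> (\<Sum>i\<in>I. P i) \<in> ext_power sc k"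
  by (induction I rule: infinite_finite_induct) (auto simp: ext_power_zero ext_power_add)

lemma bivector_wedge: "wedge sc [x, y] \<in> ext_power sc 2"
  using wedge_in_ext_power[of "[x, y]"] by (simp add: numeral_2_eq_2)

lemma bivector_decompose:
  assumes "P \<in> ext_power sc 2"
  obtains n x y where "P = (\<Sum>i<(n::nat). wedge sc [x i, y i])"
proof -
  obtain F where F: "\<forall>xs\<in>set F. length xs = 2" "P = (\<Sum>xs\<leftarrow>F. wedge sc xs)"
    using assms by (auto simp: ext_power_def)
  have "F ! i = [F ! i ! 0, F ! i ! 1]" if "i < length F" for i
    using length_2_cases[of "F ! i"] F(1) that by (metis nth_mem nth_Cons_0 nth_Cons_Suc One_nat_def)
  then have "P = (\<Sum>i<length F. wedge sc [F ! i ! 0, F ! i ! 1])"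
    unfolding F(2) sum_list_map_nth by (intro sum.cong) auto
  then show thesis by (rule that)
qed

lemma bivector_supported: assumes "P \<in> ext_power sc 2" shows "supported 2 P"
proof -
  obtain n x y where P: "P = (\<Sum>i<(n::nat). wedge sc [x i, y i])" by (rule bivector_decompose[OF assms])
  have "supported 2 (wedge sc [x, y])" for x y using supported_wedge[of "[x, y]"] by (simp add: numeral_2_eq_2)
  then show ?thesis unfolding P by (intro supported_sum)
qed

text \<open>For a bivector this is the induced map from the dual space to the space, with
  \<open>\<xi>\<close> in the second slot. The coordinate formula is linear in \<open>P\<close> by
  construction and mentions no decomposition of \<open>P\<close>.\<close>

definition contr :: "'v tensor \<Rightarrow> ('v \<Rightarrow> complex) \<Rightarrow> 'v" where
  "contr P \<xi> = (\<Sum>e\<in>basis. sc (P [\<lambda>v. representation basis v e, \<xi>]) e)"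

definition contr_left :: "'v tensor \<Rightarrow> ('v \<Rightarrow> complex) \<Rightarrow> 'v" where
  "contr_left P \<xi> = (\<Sum>e\<in>basis. sc (P [\<xi>, \<lambda>v. representation basis v e]) e)"

lemma linfun_rep: "linfun (\<lambda>v. representation basis v e)"
  by (rule linear_representation[OF independent_basis span_basis])

lemma basis_expand: "(\<Sum>e\<in>basis. sc (representation basis v e) e) = v"
  using span_expand[OF independent_basis, of v] span_basis by simp

lemma contr_add: "contr (P + Q) \<xi> = contr P \<xi> + contr Q \<xi>"
  by (simp add: contr_def scale_left_distrib sum.distrib)

lemma contr_sum: "contr (\<Sum>i\<in>I. P i) \<xi> = (\<Sum>i\<in>I. contr (P i) \<xi>)"
  by (simp add: contr_def sum_fun_apply scale_sum_left sum.swap[of _ I])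

lemma contr_left_sum: "contr_left (\<Sum>i\<in>I. P i) \<xi> = (\<Sum>i\<in>I. contr_left (P i) \<xi>)"
  by (simp add: contr_left_def sum_fun_apply scale_sum_left sum.swap[of _ I])

lemma contr_wedge: "linfun \<xi> \<Longrightarrow> contr (wedge sc [x, y]) \<xi> = sc (\<xi> y) x - sc (\<xi> x) y"
proof -
  assume \<xi>: "linfun \<xi>"
  have "contr (wedge sc [x, y]) \<xi> = (\<Sum>e\<in>basis. sc (\<xi> y) (sc (representation basis x e) e) - sc (\<xi> x) (sc (representation basis y e) e))"
    unfolding contr_def by (simp add: wedge_2[OF linfun_rep \<xi>] scale_left_diff_distrib mult.commute)
  also have "\<dots> = sc (\<xi> y) x - sc (\<xi> x) y"
    by (simp add: sum_subtractf scale_sum_right[symmetric] basis_expand del: scale_scale)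
  finally show ?thesis .
qed

lemma tensor_prod_2: "linfun a \<Longrightarrow> linfun b \<Longrightarrow> tensor_prod sc [x, y] [a, b] = a x * b y"
  by (simp add: tensor_prod_def lessThan_Suc)

lemma contr_tensor_prod: "linfun \<xi> \<Longrightarrow> contr (tensor_prod sc [x, y]) \<xi> = sc (\<xi> y) x"
  unfolding contr_def
  by (simp add: tensor_prod_2[OF linfun_rep] mult.commute[of _ "\<xi> y"] scale_scale[symmetric] scale_sum_right[symmetric]
      basis_expand del: scale_scale)

lemma contr_left_tensor_prod: "linfun \<xi> \<Longrightarrow> contr_left (tensor_prod sc [x, y]) \<xi> = sc (\<xi> x) y"
  unfolding contr_left_def
  by (simp add: tensor_prod_2[OF _ linfun_rep] scale_scale[symmetric] scale_sum_right[symmetric]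
      basis_expand del: scale_scale)

lemma contr_eval:
  assumes P: "P \<in> ext_power sc 2" and a: "linfun a" and b: "linfun b"
  shows "a (contr P b) = P [a, b]"
proof -
  obtain n x y where P: "P = (\<Sum>i<(n::nat). wedge sc [x i, y i])" by (rule bivector_decompose[OF P])
  show ?thesis unfolding P contr_sum
    by (simp add: lin_sum[OF a] sum_fun_apply contr_wedge[OF b] wedge_2[OF a b] lin_diff[OF a] lin_scale[OF a] mult.commute)
qed

lemma bivector_antisym:
  assumes P: "P \<in> ext_power sc 2" and a: "linfun a" and b: "linfun b"
  shows "P [a, b] = - P [b, a]"
proof -
  obtain n x y where P: "P = (\<Sum>i<(n::nat). wedge sc [x i, y i])" by (rule bivector_decompose[OF P])
  show ?thesis unfolding P
    by (simp add: sum_fun_apply wedge_2 a b sum_negf[symmetric])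
qed

lemma linfun_0: "linfun (\<lambda>_. 0)"
  by (simp add: Vector_Spaces.linear_iff vector_space_axioms vector_space_times)

lemma bivector_eqI:
  assumes "P \<in> ext_power sc 2" "Q \<in> ext_power sc 2"
    "\<And>a b. linfun a \<Longrightarrow> linfun b \<Longrightarrow> P [a, b] = Q [a, b]"
  shows "P = Q"
proof (rule supported_eqI[OF bivector_supported[OF assms(1)] bivector_supported[OF assms(2)]])
  fix \<xi>s :: "('v \<Rightarrow> complex) list" assume "length \<xi>s = 2" "\<forall>\<xi>\<in>set \<xi>s. linfun \<xi>"
  then show "P \<xi>s = Q \<xi>s" using length_2_cases[of \<xi>s] assms(3) by auto
qed

definition form2 :: "(('v \<Rightarrow> complex) \<Rightarrow> ('v \<Rightarrow> complex) \<Rightarrow> complex) \<Rightarrow> 'v tensor" where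
  "form2 K = (\<lambda>\<xi>s. if length \<xi>s = 2 \<and> (\<forall>\<xi>\<in>set \<xi>s. linfun \<xi>) then K (\<xi>s ! 0) (\<xi>s ! 1) else 0)"

definition form3 :: "(('v \<Rightarrow> complex) \<Rightarrow> ('v \<Rightarrow> complex) \<Rightarrow> ('v \<Rightarrow> complex) \<Rightarrow> complex) \<Rightarrow> 'v tensor" where
  "form3 K = (\<lambda>\<xi>s. if length \<xi>s = 3 \<and> (\<forall>\<xi>\<in>set \<xi>s. linfun \<xi>) then K (\<xi>s ! 0) (\<xi>s ! 1) (\<xi>s ! 2) else 0)"

lemma supported_form2: "supported 2 (form2 K)" and supported_form3: "supported 3 (form3 K')"
  by (auto simp: supported_def form2_def form3_def)

lemma form2_eval [simp]: "linfun a \<Longrightarrow> linfun b \<Longrightarrow> form2 K [a, b] = K a b"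
  and form3_eval [simp]: "linfun a \<Longrightarrow> linfun b \<Longrightarrow> linfun c \<Longrightarrow> form3 K' [a, b, c] = K' a b c"
  by (auto simp: form2_def form3_def)

lemma eq_form2I:
  assumes "supported 2 T" "\<And>a b. linfun a \<Longrightarrow> linfun b \<Longrightarrow> T [a, b] = K a b"
  shows "T = form2 K"
proof (rule supported_eqI[OF assms(1) supported_form2])
  fix \<xi>s :: "('v \<Rightarrow> complex) list" assume "length \<xi>s = 2" "\<forall>\<xi>\<in>set \<xi>s. linfun \<xi>"
  then show "T \<xi>s = form2 K \<xi>s" using length_2_cases[of \<xi>s] assms(2) by auto
qed

lemma eq_form3I:
  assumes "supported 3 T" "\<And>a b c. linfun a \<Longrightarrow> linfun b \<Longrightarrow> linfun c \<Longrightarrow> T [a, b, c] = K a b c"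
  shows "T = form3 K"
proof (rule supported_eqI[OF assms(1) supported_form3])
  fix \<xi>s :: "('v \<Rightarrow> complex) list" assume "length \<xi>s = 3" "\<forall>\<xi>\<in>set \<xi>s. linfun \<xi>"
  then show "T \<xi>s = form3 K \<xi>s" using length_3_cases[of \<xi>s] assms(2) by auto
qed

lemma supported_3_eq_0_iff:
  assumes "supported 3 T"
  shows "(\<forall>\<xi>s. T \<xi>s = 0) \<longleftrightarrow> (\<forall>a b c. linfun a \<longrightarrow> linfun b \<longrightarrow> linfun c \<longrightarrow> T [a, b, c] = 0)"
proof (intro iffI allI)
  fix \<xi>s assume 0: "\<forall>a b c. linfun a \<longrightarrow> linfun b \<longrightarrow> linfun c \<longrightarrow> T [a, b, c] = 0"
  have "T = form3 (\<lambda>_ _ _. 0)" by (rule eq_form3I[OF assms]) (use 0 in blast)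
  then show "T \<xi>s = 0" by (simp add: form3_def)
qed blast

end

section \<open>Algebraic brackets in closed form\<close>

context complex_lie_algebra
begin

text \<open>Contracting \<open>[x, y]\<close> with a functional produces a signed combination of
  \<open>x\<close> and \<open>y\<close>, so a single bracket of contractions already contains the
  four brackets of the Schouten formula with their signs.\<close>

lemma schouten_term_22:
  fixes x y x' y' :: 'g
  defines "T \<equiv> (\<Sum>i<2. \<Sum>j<2. (let T = wedge sc (br ([x, y] ! i) ([x', y'] ! j) # delete_nth i [x, y] @ delete_nth j [x', y'])
        in if even (i + j) then T else - T))"
  shows "supported 3 T"
    and "linfun a \<Longrightarrow> linfun b \<Longrightarrow> linfun c \<Longrightarrow>
      T [a, b, c] = skew3 (\<lambda>a b c. a (br (contr (wedge sc [x, y]) b) (contr (wedge sc [x', y']) c))) a b c"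
proof -
  have T: "T = wedge sc [br x x', y, y'] - wedge sc [br x y', y, x']
      - wedge sc [br y x', x, y'] + wedge sc [br y y', x, x']"
    unfolding T_def by (simp add: numeral_2_eq_2 lessThan_Suc algebra_simps)
  have s: "supported 3 (wedge sc [x, y, z])" for x y z
    using supported_wedge[of "[x, y, z]"] by (simp add: numeral_3_eq_3)
  then show "supported 3 T" unfolding T by (simp add: supported_def)
  assume a: "linfun a" and b: "linfun b" and c: "linfun c"
  show "T [a, b, c] = skew3 (\<lambda>a b c. a (br (contr (wedge sc [x, y]) b) (contr (wedge sc [x', y']) c))) a b c"
    unfolding T
    by (simp add: wedge_3 a b c contr_wedge skew3_def br_left br_right lin_diff[OF a] lin_diff[OF b] lin_diff[OF c]
        lin_scale[OF a] lin_scale[OF b] lin_scale[OF c] algebra_simps)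
qed

definition schouten_form :: "'g tensor \<Rightarrow> 'g tensor \<Rightarrow> ('g \<Rightarrow> complex) \<Rightarrow> ('g \<Rightarrow> complex) \<Rightarrow> ('g \<Rightarrow> complex) \<Rightarrow> complex" where
  "schouten_form P Q = skew3 (\<lambda>a b c. a (br (contr P b) (contr Q c)))"

text \<open>The formula for wedges is biadditive in the contractions, and these depend on
  \<open>P\<close> and \<open>Q\<close> only. This is independence of the decomposition.\<close>

lemma schouten_alg_22:
  assumes P: "P \<in> ext_power sc 2" and Q: "Q \<in> ext_power sc 2"
  shows "schouten_alg sc br 2 2 P Q = form3 (schouten_form P Q)"
proof -
  obtain F0 G0 where 0: "\<forall>xs\<in>set F0. length xs = 2" "P = (\<Sum>xs\<leftarrow>F0. wedge sc xs)"
    "\<forall>xs\<in>set G0. length xs = 2" "Q = (\<Sum>xs\<leftarrow>G0. wedge sc xs)"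
    using P Q by (auto simp: ext_power_def)
  show ?thesis
  proof (rule schouten_eqI[of F0 _ _ G0])
    fix F G :: "'g list list"
    assume F: "\<forall>xs\<in>set F. length xs = 2 \<and> set xs \<subseteq> UNIV" and G: "\<forall>xs\<in>set G. length xs = 2 \<and> set xs \<subseteq> UNIV"
      and PF: "P = (\<Sum>xs\<leftarrow>F. wedge sc xs)" and QG: "Q = (\<Sum>xs\<leftarrow>G. wedge sc xs)"
    define T where "T xs ys = (\<Sum>i<2. \<Sum>j<2. (let T = wedge sc (br (xs ! i) (ys ! j) # delete_nth i xs @ delete_nth j ys)
        in if even (i + j) then T else - T))" for xs ys
    have T: "supported 3 (T (F ! i) (G ! j))"
      "linfun a \<Longrightarrow> linfun b \<Longrightarrow> linfun c \<Longrightarrow>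
        T (F ! i) (G ! j) [a, b, c] = skew3 (\<lambda>a b c. a (br (contr (wedge sc (F ! i)) b) (contr (wedge sc (G ! j)) c))) a b c"
      if ij: "i < length F" "j < length G" for i j a b c
    proof -
      obtain x y where xy: "F ! i = [x, y]" using length_2_cases F ij by (meson nth_mem)
      obtain x' y' where xy': "G ! j = [x', y']" using length_2_cases G ij by (meson nth_mem)
      show "supported 3 (T (F ! i) (G ! j))" unfolding T_def xy xy' by (rule schouten_term_22)
      show "linfun a \<Longrightarrow> linfun b \<Longrightarrow> linfun c \<Longrightarrow>
        T (F ! i) (G ! j) [a, b, c] = skew3 (\<lambda>a b c. a (br (contr (wedge sc (F ! i)) b) (contr (wedge sc (G ! j)) c))) a b c"
        unfolding T_def xy xy' by (rule schouten_term_22)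
    qed
    have "(\<Sum>i<length F. \<Sum>j<length G. T (F ! i) (G ! j)) = form3 (schouten_form P Q)"
    proof (rule eq_form3I)
      show "supported 3 (\<Sum>i<length F. \<Sum>j<length G. T (F ! i) (G ! j))"
        by (intro supported_sum T) auto
      fix a b c assume abc: "linfun a" "linfun b" "linfun c"
      have brs: "br (\<Sum>i<length F. u i) (\<Sum>j<length G. v j) = (\<Sum>i<length F. \<Sum>j<length G. br (u i) (v j))" for u v
        unfolding lin_sum[OF linear_left] lin_sum[OF linear_right] by (rule sum.swap)
      have K: "p (br (contr P q) (contr Q r)) =
          (\<Sum>i<length F. \<Sum>j<length G. p (br (contr (wedge sc (F ! i)) q) (contr (wedge sc (G ! j)) r)))"
        if p: "linfun p" for p q r
        unfolding PF QG sum_list_map_nth contr_sum brs by (simp add: lin_sum[OF p])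
      have "(\<Sum>i<length F. \<Sum>j<length G. T (F ! i) (G ! j)) [a, b, c] =
          (\<Sum>i<length F. \<Sum>j<length G. T (F ! i) (G ! j) [a, b, c])" by (simp add: sum_fun_apply)
      also have "\<dots> = (\<Sum>i<length F. \<Sum>j<length G.
          skew3 (\<lambda>a b c. a (br (contr (wedge sc (F ! i)) b) (contr (wedge sc (G ! j)) c))) a b c)"
        by (intro sum.cong refl T abc) auto
      also have "\<dots> = schouten_form P Q a b c"
        unfolding schouten_form_def by (simp add: skew3_def K abc sum.distrib sum_subtractf)
      finally show "(\<Sum>i<length F. \<Sum>j<length G. T (F ! i) (G ! j)) [a, b, c] = schouten_form P Q a b c" .
    qed
    then show "(\<Sum>xs\<leftarrow>F. \<Sum>ys\<leftarrow>G. \<Sum>i<2. \<Sum>j<2.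
       (let T = wedge sc (br (xs ! i) (ys ! j) # delete_nth i xs @ delete_nth j ys)
        in if even (i + j) then T else - T)) = form3 (schouten_form P Q)"
      unfolding T_def sum_list_map_nth by simp
  qed (use 0 in auto)
qed

text \<open>The two terms are the action of \<open>t\<close> on the first and on the second leg of
  \<open>Q\<close>; the minus sign comes from antisymmetry of \<open>Q\<close>.\<close>

definition adj_form :: "'g \<Rightarrow> 'g tensor \<Rightarrow> ('g \<Rightarrow> complex) \<Rightarrow> ('g \<Rightarrow> complex) \<Rightarrow> complex" where
  "adj_form t Q a b = a (br t (contr Q b)) - b (br t (contr Q a))"

lemma schouten_alg_12:
  assumes Q: "Q \<in> ext_power sc 2"
  shows "schouten_alg sc br 1 2 (wedge sc [t]) Q = form2 (adj_form t Q)"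
proof -
  obtain G0 where 0: "\<forall>xs\<in>set G0. length xs = 2" "Q = (\<Sum>xs\<leftarrow>G0. wedge sc xs)"
    using Q by (auto simp: ext_power_def)
  show ?thesis
  proof (rule schouten_eqI[of "[[t]]" _ _ G0])
    fix F G :: "'g list list"
    assume F: "\<forall>xs\<in>set F. length xs = 1 \<and> set xs \<subseteq> UNIV" and G: "\<forall>xs\<in>set G. length xs = 2 \<and> set xs \<subseteq> UNIV"
      and PF: "wedge sc [t] = (\<Sum>xs\<leftarrow>F. wedge sc xs)" and QG: "Q = (\<Sum>xs\<leftarrow>G. wedge sc xs)"
    have Fi: "F ! i = [F ! i ! 0]" if "i < length F" for i
      using F that by (metis One_nat_def length_0_conv length_Suc_conv nth_Cons_0 nth_mem)
    \<comment> \<open>Even the one-vector \<open>t\<close> may be presented as a sum of several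
      vectors; functionals recover \<open>t\<close> from such a sum.\<close>
    have t: "t = (\<Sum>i<length F. F ! i ! 0)"
    proof (rule functionals_separate)
      fix f assume f: "linfun f"
      have "f t = (\<Sum>xs\<leftarrow>F. wedge sc xs) [f]" using PF wedge_1[OF f, of t] by simp
      also have "\<dots> = (\<Sum>i<length F. wedge sc (F ! i) [f])" by (simp add: sum_list_map_nth sum_fun_apply)
      also have "\<dots> = (\<Sum>i<length F. f (F ! i ! 0))"
        using wedge_1[OF f] Fi by (metis (no_types, lifting) lessThan_iff sum.cong)
      finally show "f t = f (\<Sum>i<length F. F ! i ! 0)" by (simp add: lin_sum[OF f])
    qed
    define T where "T xs ys = (\<Sum>i<1. \<Sum>j<2. (let T = wedge sc (br (xs ! i) (ys ! j) # delete_nth i xs @ delete_nth j ys)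
        in if even (i + j) then T else - T))" for xs ys
    have Tx: "T [u] [x, y] = wedge sc [br u x, y] - wedge sc [br u y, x]" for u x y
      unfolding T_def by (simp add: numeral_2_eq_2 lessThan_Suc algebra_simps)
    have T: "supported 2 (T (F ! i) (G ! j)) \<and> (linfun a \<longrightarrow> linfun b \<longrightarrow>
        T (F ! i) (G ! j) [a, b] = adj_form (F ! i ! 0) (wedge sc (G ! j)) a b)"
      if ij: "i < length F" "j < length G" for i j a b
    proof -
      obtain u where u: "F ! i = [u]" using Fi ij by blast
      obtain x y where xy: "G ! j = [x, y]" using length_2_cases G ij by (meson nth_mem)
      have "supported 2 (wedge sc [x, y])" for x y using bivector_supported bivector_wedge by blast
      then show ?thesis unfolding u xy Tx
        by (auto simp: supported_def wedge_2 adj_form_def contr_wedge br_right lin_diff lin_scale algebra_simps)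
    qed
    have "(\<Sum>i<length F. \<Sum>j<length G. T (F ! i) (G ! j)) = form2 (adj_form t Q)"
    proof (rule eq_form2I)
      show "supported 2 (\<Sum>i<length F. \<Sum>j<length G. T (F ! i) (G ! j))"
        by (intro supported_sum) (use T in auto)
      fix a b assume ab: "linfun a" "linfun b"
      have brs: "br (\<Sum>i<length F. u i) (\<Sum>j<length G. v j) = (\<Sum>i<length F. \<Sum>j<length G. br (u i) (v j))" for u v
        unfolding lin_sum[OF linear_left] lin_sum[OF linear_right] by (rule sum.swap)
      have K: "p (br t (contr Q r)) =
          (\<Sum>i<length F. \<Sum>j<length G. p (br (F ! i ! 0) (contr (wedge sc (G ! j)) r)))"
        if p: "linfun p" for p r
        unfolding t QG sum_list_map_nth contr_sum brs by (simp add: lin_sum[OF p])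
      have "(\<Sum>i<length F. \<Sum>j<length G. T (F ! i) (G ! j)) [a, b] =
          (\<Sum>i<length F. \<Sum>j<length G. T (F ! i) (G ! j) [a, b])" by (simp add: sum_fun_apply)
      also have "\<dots> = (\<Sum>i<length F. \<Sum>j<length G. adj_form (F ! i ! 0) (wedge sc (G ! j)) a b)"
        by (intro sum.cong refl) (use T ab in auto)
      also have "\<dots> = adj_form t Q a b"
        by (simp add: adj_form_def K ab sum_subtractf)
      finally show "(\<Sum>i<length F. \<Sum>j<length G. T (F ! i) (G ! j)) [a, b] = adj_form t Q a b" .
    qed
    then show "(\<Sum>xs\<leftarrow>F. \<Sum>ys\<leftarrow>G. \<Sum>i<1. \<Sum>j<2.
       (let T = wedge sc (br (xs ! i) (ys ! j) # delete_nth i xs @ delete_nth j ys)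
        in if even (i + j) then T else - T)) = form2 (adj_form t Q)"
      unfolding T_def sum_list_map_nth by simp
  qed (use 0 in auto)
qed

text \<open>Contracting the outer legs leaves the bracket of the inner ones, evaluated by the middle
  functional, whatever the two presentations are.\<close>

lemma comm_12_23_eq:
  assumes S: "S = (\<Sum>(a, b)\<leftarrow>F0. tensor_prod sc [a, b])" and T: "T = (\<Sum>(c, d)\<leftarrow>G0. tensor_prod sc [c, d])"
  shows "comm_12_23 sc br S T = form3 (\<lambda>a b c. b (br (contr_left S a) (contr T c)))"
proof -
  have val: "(\<Sum>(a, b)\<leftarrow>F. \<Sum>(c, d)\<leftarrow>G. tensor_prod sc [a, br b c, d]) =
      form3 (\<lambda>a b c. b (br (contr_left S a) (contr T c)))"
    if S: "S = (\<Sum>(a, b)\<leftarrow>F. tensor_prod sc [a, b])" and T: "T = (\<Sum>(c, d)\<leftarrow>G. tensor_prod sc [c, d])" for F G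
  proof -
    have S': "S = (\<Sum>i<length F. tensor_prod sc [fst (F ! i), snd (F ! i)])"
      and T': "T = (\<Sum>i<length G. tensor_prod sc [fst (G ! i), snd (G ! i)])"
      unfolding S T sum_list_map_nth by (simp_all add: case_prod_beta)
    have "(\<Sum>i<length F. \<Sum>j<length G. tensor_prod sc [fst (F ! i), br (snd (F ! i)) (fst (G ! j)), snd (G ! j)])
      = form3 (\<lambda>a b c. b (br (contr_left S a) (contr T c)))" (is "?L = _")
    proof (rule eq_form3I)
      show "supported 3 ?L" by (intro supported_sum) (simp add: supported_def tensor_prod_def)
      fix a b c assume abc: "linfun a" "linfun b" "linfun c"
      have "?L [a, b, c] = (\<Sum>i<length F. \<Sum>j<length G. a (fst (F ! i)) * b (br (snd (F ! i)) (fst (G ! j))) * c (snd (G ! j)))"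
        by (simp add: sum_fun_apply tensor_prod_def abc lessThan_Suc eval_nat_numeral algebra_simps)
      also have "\<dots> = b (br (contr_left S a) (contr T c))"
        unfolding S' T' contr_left_sum contr_sum lin_sum[OF linear_left] lin_sum[OF linear_right] lin_sum[OF abc(2)]
        by (subst sum.swap, intro sum.cong refl)
          (simp add: contr_tensor_prod contr_left_tensor_prod abc br_left br_right lin_scale[OF abc(2)])
      finally show "?L [a, b, c] = b (br (contr_left S a) (contr T c))" .
    qed
    then show ?thesis by (simp add: sum_list_map_nth case_prod_beta)
  qed
  show ?thesis unfolding comm_12_23_def
  proof (rule the_equality)
    show "\<exists>F G. S = (\<Sum>(a, b)\<leftarrow>F. tensor_prod sc [a, b]) \<and> T = (\<Sum>(c, d)\<leftarrow>G. tensor_prod sc [c, d]) \<and>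
      form3 (\<lambda>a b c. b (br (contr_left S a) (contr T c))) = (\<Sum>(a, b)\<leftarrow>F. \<Sum>(c, d)\<leftarrow>G. tensor_prod sc [a, br b c, d])"
      using val[OF S T] S T by metis
  qed (use val in blast)
qed

end

section \<open>The self-bracket of the standard bivector and the Casimir element\<close>

context positive_root_algebra
begin

abbreviation "r0 \<equiv> r_zero sc P E"

lemma r0_bivector: "r0 \<in> ext_power sc 2"
  unfolding r_zero_def by (intro ext_power_sum bivector_wedge)

lemma contr_r0: "linfun \<xi> \<Longrightarrow> contr r0 \<xi> = (\<Sum>a\<in>P. sc (\<xi> (E (- a))) (E a) - sc (\<xi> (E a)) (E (- a)))"
  unfolding r_zero_def contr_sum by (simp add: contr_wedge)

lemma contr_r0_kf: "contr r0 (kf y) = rho y"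
  by (simp add: contr_r0 linfun_kf rho_def)

text \<open>Each \<open>E l \<and> E (- l)\<close> has weight zero: the two legs scale by opposite
  factors, so \<open>K\<close> is symmetric in \<open>p\<close> and \<open>q\<close> and its
  antisymmetrization vanishes.\<close>

lemma adj_form_r0: assumes t: "t \<in> H" and ab: "linfun a" "linfun b" shows "adj_form t r0 a b = 0"
proof -
  have K: "p (br t (contr r0 q)) = (\<Sum>l\<in>P. l t * (q (E (- l)) * p (E l) + q (E l) * p (E (- l))))"
    if p: "linfun p" "linfun q" for p q
  proof -
    have "br t (contr r0 q) = (\<Sum>l\<in>P. sc (l t) (sc (q (E (- l))) (E l) + sc (q (E l)) (E (- l))))"
      unfolding contr_r0[OF p(2)] lin_sum[OF linear_right]
      by (rule sum.cong[OF refl])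
        (simp add: br_right br_E[OF P_R t] br_E[OF R_uminus[OF P_R] t] scale_right_distrib mult.commute)
    then show ?thesis by (simp add: lin_sum[OF p(1)] lin_scale[OF p(1)] lin_add[OF p(1)])
  qed
  show ?thesis by (simp add: adj_form_def K ab algebra_simps)
qed

lemma casimir_eq: "casimir sc br = (\<Sum>x\<in>basis. tensor_prod sc [x, dual_vec x])"
  by (simp add: casimir_def dual_vec_def Let_def)

lemma comm_casimir:
  "comm_12_23 sc br (casimir sc br) (casimir sc br) =
    form3 (\<lambda>a b c. b (br (contr_left (casimir sc br) a) (contr (casimir sc br) c)))"
proof -
  obtain bs where bs: "set bs = basis" "distinct bs" using finite_distinct_list[OF finite_basis] by blast
  let ?F = "map (\<lambda>x. (x, dual_vec x)) bs"
  have "casimir sc br = (\<Sum>(a, b)\<leftarrow>?F. tensor_prod sc [a, b])"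
    unfolding casimir_eq bs(1)[symmetric]
    by (simp add: sum_list_distinct_conv_sum_set[OF bs(2), symmetric] comp_def)
  then show ?thesis by (intro comm_12_23_eq)
qed

text \<open>Written with \<open>kf x\<close>, \<open>kf y\<close>, \<open>kf z\<close>, the six
  terms of the bracket pair up into twice the cyclic sum of \<open>rho_cyclic\<close>, which the
  factor 1/2 reduces to the Casimir value.\<close>

lemma schouten_r0_r0:
  assumes abc: "linfun a" "linfun b" "linfun c"
  shows "1/2 * schouten_form r0 r0 a b c = comm_12_23 sc br (casimir sc br) (casimir sc br) [a, b, c]"
proof -
  obtain x y z where xyz: "a = kf x" "b = kf y" "c = kf z" using kf_riesz abc by blast
  have 1: "contr_left (casimir sc br) (kf x) = x"
    unfolding casimir_eq contr_left_sum
    using dual_vec_expand[of x] by (simp add: contr_left_tensor_prod linfun_kf)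
  have 2: "contr (casimir sc br) (kf z) = z"
    unfolding casimir_eq contr_sum
    using dual_vec_expand'[of z] by (simp add: contr_tensor_prod linfun_kf)
  have R: "comm_12_23 sc br (casimir sc br) (casimir sc br) [a, b, c] = kf y (br x z)"
    unfolding comm_casimir xyz by (simp add: linfun_kf 1 2)
  have "br (rho z) (rho y) = - br (rho y) (rho z)" "br (rho x) (rho z) = - br (rho z) (rho x)"
      "br (rho y) (rho x) = - br (rho x) (rho y)" by (rule br_antisym)+
  then have "schouten_form r0 r0 a b c =
      2 * (kf x (br (rho y) (rho z)) + kf y (br (rho z) (rho x)) + kf z (br (rho x) (rho y)))"
    unfolding schouten_form_def skew3_def xyz contr_r0_kf by (simp add: kf_right)
  then show ?thesis using R rho_cyclic[of x y z] by simp
qed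

end

section \<open>The gauge Lie algebroid\<close>

definition dderiv :: "(complex ^ 'n::finite \<Rightarrow> complex) \<Rightarrow> complex ^ 'n \<Rightarrow> complex ^ 'n \<Rightarrow> complex" where
  "dderiv f v z = deriv (\<lambda>t. f (z + t *s v)) 0"

lemma bounded_linear_vector_scaleC: "bounded_linear (\<lambda>t::complex. t *s v)" for v :: "complex ^ 'n::finite"
  unfolding linear_conv_bounded_linear[symmetric]
  by (rule Real_Vector_Spaces.linearI) (simp_all add: vec_eq_iff algebra_simps)

lemma holo_funE:
  assumes "holo_fun V f" "z \<in> V"
  obtains D where "(f has_derivative D) (at z)" "\<forall>c v. D (c *s v) = c * D v"
proof -
  have "\<exists>D. (f has_derivative D) (at z) \<and> (\<forall>c v. D (c *s v) = c * D v)"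
    using assms by (simp add: holo_fun_def)
  then obtain D where D: "(f has_derivative D) (at z)" "\<forall>c v. D (c *s v) = c * D v" by blast
  show thesis by (rule that[OF D])
qed

lemma
  assumes f: "holo_fun V f" and z: "z \<in> V"
  shows dderiv_has: "((\<lambda>t. f (z + t *s v)) has_field_derivative dderiv f v z) (at 0)"
    and dderiv_linear: "Vector_Spaces.linear (*s) (*) (\<lambda>v. dderiv f v z)"
proof -
  obtain D where D: "(f has_derivative D) (at z)" "\<forall>c v. D (c *s v) = c * D v"
    by (rule holo_funE[OF f z])
  have h: "((\<lambda>t. f (z + t *s v)) has_field_derivative D v) (at 0)" for v
  proof -
    have "((\<lambda>t. z + t *s v) has_derivative (\<lambda>t. t *s v)) (at 0)"
      using has_derivative_add[OF has_derivative_const bounded_linear_imp_has_derivative[OF bounded_linear_vector_scaleC]]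
      by simp
    moreover have "(f has_derivative D) (at (z + 0 *s v))" using D(1) by simp
    ultimately have "((\<lambda>t. f (z + t *s v)) has_derivative (\<lambda>t. D (t *s v))) (at 0)"
      by (rule has_derivative_compose)
    then show ?thesis unfolding has_field_derivative_def by (simp add: D(2) mult.commute[of _ "D v"] )
  qed
  then have dderiv: "dderiv f v z = D v" for v unfolding dderiv_def by (rule DERIV_imp_deriv)
  then show "((\<lambda>t. f (z + t *s v)) has_field_derivative dderiv f v z) (at 0)" using h by simp
  have "D (u + v) = D u + D v" for u v using has_derivative_linear[OF D(1)] by (rule linear_add)
  then show "Vector_Spaces.linear (*s) (*) (\<lambda>v. dderiv f v z)"
    unfolding dderiv by (auto simp: Vector_Spaces.linear_iff D(2) vector_space_times vec.vector_space_axioms)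
qed

lemma dderiv_eqI: "((\<lambda>t. f (z + t *s v)) has_field_derivative d) (at 0) \<Longrightarrow> dderiv f v z = d"
  unfolding dderiv_def by (rule DERIV_imp_deriv)

lemma dderiv_const [simp]: "dderiv (\<lambda>_. c) v z = 0"
  by (rule dderiv_eqI) simp

lemma dderiv_cmult: "holo_fun V f \<Longrightarrow> z \<in> V \<Longrightarrow> dderiv (\<lambda>w. c * f w) v z = c * dderiv f v z"
  by (intro dderiv_eqI DERIV_cmult dderiv_has)

lemma dderiv_add: "holo_fun V f \<Longrightarrow> holo_fun V g \<Longrightarrow> z \<in> V \<Longrightarrow> dderiv (\<lambda>w. f w + g w) v z = dderiv f v z + dderiv g v z"
  by (intro dderiv_eqI DERIV_add dderiv_has)

lemma dderiv_diff: "holo_fun V f \<Longrightarrow> holo_fun V g \<Longrightarrow> z \<in> V \<Longrightarrow> dderiv (\<lambda>w. f w - g w) v z = dderiv f v z - dderiv g v z"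
  by (intro dderiv_eqI DERIV_diff dderiv_has)

lemma dderiv_mult:
  assumes "holo_fun V f" "holo_fun V g" "z \<in> V"
  shows "dderiv (\<lambda>w. f w * g w) v z = dderiv f v z * g z + f z * dderiv g v z"
  using DERIV_mult[OF dderiv_has[OF assms(1,3), of v] dderiv_has[OF assms(2,3), of v]]
  by (intro dderiv_eqI) (simp add: algebra_simps)

lemma dderiv_sum:
  assumes "\<And>i. i \<in> I \<Longrightarrow> holo_fun V (f i)" "z \<in> V"
  shows "dderiv (\<lambda>w. \<Sum>i\<in>I. f i w) v z = (\<Sum>i\<in>I. dderiv (f i) v z)"
  by (intro dderiv_eqI DERIV_sum dderiv_has) (use assms in auto)

lemma dderiv_cong:
  assumes V: "open V" "z \<in> V" and fg: "\<And>w. w \<in> V \<Longrightarrow> f w = g w"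
  shows "dderiv f v z = dderiv g v z"
  unfolding dderiv_def
proof (rule deriv_cong_ev)
  have "continuous (at 0) (\<lambda>t::complex. z + t *s v)"
    by (intro continuous_add continuous_const linear_continuous_at bounded_linear_vector_scaleC)
  then have "((\<lambda>t::complex. z + t *s v) \<longlongrightarrow> z + 0 *s v) (nhds 0)"
    unfolding continuous_at by (rule tendsto_at_iff_tendsto_nhds[THEN iffD1])
  then have "((\<lambda>t::complex. z + t *s v) \<longlongrightarrow> z) (nhds 0)" by simp
  then have "\<forall>\<^sub>F t in nhds 0. z + t *s v \<in> V" using V topological_tendstoD by blast
  then show "\<forall>\<^sub>F t in nhds 0. f (z + t *s v) = g (z + t *s v)"
    by (rule eventually_mono) (rule fg)
qed simp

lemma holo_fun_const: "holo_fun V (\<lambda>_. c)"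
  unfolding holo_fun_def by (auto intro!: exI[of _ "\<lambda>_. 0"])

lemma holo_fun_add: assumes "holo_fun V f" "holo_fun V g" shows "holo_fun V (\<lambda>z. f z + g z)"
  unfolding holo_fun_def
proof
  fix z assume z: "z \<in> V"
  obtain D D' where D: "(f has_derivative D) (at z)" "\<forall>c v. D (c *s v) = c * D v"
    "(g has_derivative D') (at z)" "\<forall>c v. D' (c *s v) = c * D' v"
    using holo_funE[OF assms(1) z] holo_funE[OF assms(2) z] by metis
  show "\<exists>D. ((\<lambda>z. f z + g z) has_derivative D) (at z) \<and> (\<forall>c v. D (c *s v) = c * D v)"
    using has_derivative_add[OF D(1,3)] D(2,4)
    by (intro exI[of _ "\<lambda>v. D v + D' v"]) (simp add: distrib_left)
qed

lemma holo_fun_mult: assumes "holo_fun V f" "holo_fun V g" shows "holo_fun V (\<lambda>z. f z * g z)"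
  unfolding holo_fun_def
proof
  fix z assume z: "z \<in> V"
  obtain D D' where D: "(f has_derivative D) (at z)" "\<forall>c v. D (c *s v) = c * D v"
    "(g has_derivative D') (at z)" "\<forall>c v. D' (c *s v) = c * D' v"
    using holo_funE[OF assms(1) z] holo_funE[OF assms(2) z] by metis
  show "\<exists>D. ((\<lambda>z. f z * g z) has_derivative D) (at z) \<and> (\<forall>c v. D (c *s v) = c * D v)"
    using has_derivative_mult[OF D(1,3)] D(2,4)
    by (intro exI[of _ "\<lambda>v. f z * D' v + D v * g z"]) (simp add: algebra_simps)
qed

lemma holo_fun_cmult: "holo_fun V f \<Longrightarrow> holo_fun V (\<lambda>z. c * f z)"
  by (rule holo_fun_mult[OF holo_fun_const])

lemma holo_fun_diff: "holo_fun V f \<Longrightarrow> holo_fun V g \<Longrightarrow> holo_fun V (\<lambda>z. f z - g z)"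
  using holo_fun_add[of V f "\<lambda>z. - 1 * g z"] holo_fun_cmult[of V g "- 1"] by simp

lemma holo_mapD: "holo_map s V f \<Longrightarrow> Vector_Spaces.linear s (*) \<xi> \<Longrightarrow> holo_fun V (\<lambda>z. \<xi> (f z))"
  by (simp add: holo_map_def comp_def)

lemma fin_dim_cspace_vec: "fin_dim_cspace ((*s) :: complex \<Rightarrow> complex ^ 'n::finite \<Rightarrow> complex ^ 'n)"
proof (unfold_locales)
  show "\<exists>B. finite B \<and> vec.span B = (UNIV :: (complex ^ 'n) set)"
    using vec.finite_Basis vec.span_Basis by blast
qed

section \<open>Vector-valued derivatives and holomorphic decompositions\<close>

context fin_dim_cspace
begin

text \<open>The vector of coordinate derivatives has the defining property of
  \<open>dir_deriv\<close>, and functionals separate points, so it is the only one.\<close>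

lemma dir_deriv_eval:
  assumes f: "holo_map sc V f" and z: "z \<in> V" and \<xi>: "linfun \<xi>"
  shows "\<xi> (dir_deriv sc f v z) = dderiv (\<lambda>w. \<xi> (f w)) v z"
proof -
  define w where "w = (\<Sum>e\<in>basis. sc (dderiv (\<lambda>u. representation basis (f u) e) v z) e)"
  have hw: "dderiv (\<lambda>u. \<xi> (f u)) v z = \<xi> w" if \<xi>: "linfun \<xi>" for \<xi>
  proof -
    have "\<xi> (f u) = (\<Sum>e\<in>basis. \<xi> e * representation basis (f u) e)" for u
    proof -
      have "\<xi> (f u) = \<xi> (\<Sum>e\<in>basis. sc (representation basis (f u) e) e)" by (simp add: basis_expand)
      then show ?thesis by (simp add: lin_sum[OF \<xi>] lin_scale[OF \<xi>] mult.commute)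
    qed
    then have "dderiv (\<lambda>u. \<xi> (f u)) v z = dderiv (\<lambda>u. \<Sum>e\<in>basis. \<xi> e * representation basis (f u) e) v z" by simp
    also have "\<dots> = (\<Sum>e\<in>basis. \<xi> e * dderiv (\<lambda>u. representation basis (f u) e) v z)"
      using z by (subst dderiv_sum[of _ V]) (auto intro!: holo_fun_cmult holo_mapD[OF f linfun_rep] dderiv_cmult sum.cong)
    also have "\<dots> = \<xi> w" by (simp add: w_def lin_sum[OF \<xi>] lin_scale[OF \<xi>] mult.commute)
    finally show ?thesis .
  qed
  have "dir_deriv sc f v z = w"
    unfolding dir_deriv_def
  proof (rule the_equality)
    show "\<forall>\<xi>. linfun \<xi> \<longrightarrow> ((\<lambda>t. \<xi> (f (z + t *s v))) has_field_derivative \<xi> w) (at 0)"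
      using dderiv_has[OF holo_mapD[OF f] z] hw by metis
    fix w' assume w': "\<forall>\<xi>. linfun \<xi> \<longrightarrow> ((\<lambda>t. \<xi> (f (z + t *s v))) has_field_derivative \<xi> w') (at 0)"
    show "w' = w"
    proof (rule functionals_separate)
      fix \<xi> assume \<xi>: "linfun \<xi>"
      then have "dderiv (\<lambda>u. \<xi> (f u)) v z = \<xi> w'" using w' by (intro dderiv_eqI) blast
      then show "\<xi> w' = \<xi> w" using hw[OF \<xi>] by simp
    qed
  qed
  then show ?thesis using hw[OF \<xi>] by simp
qed

lemma holo_map_scaled: "holo_fun V f \<Longrightarrow> holo_map sc V (\<lambda>z. sc (f z) x)"
  unfolding holo_map_def comp_def by (auto simp: lin_scale intro!: holo_fun_mult holo_fun_const)

lemma holo_map_const: "holo_map sc V (\<lambda>z. x)"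
  unfolding holo_map_def comp_def by (simp add: holo_fun_const)

text \<open>The sum runs over ordered pairs, so every pair of distinct basis vectors occurs twice;
  hence the division by 2. The coefficient sits inside the first factor, ready to become a
  coefficient function of a section.\<close>

lemma bivector_expand:
  assumes P: "P \<in> ext_power sc 2"
  shows "P = (\<Sum>(e, f)\<in>basis \<times> basis. wedge sc
    [sc (P [\<lambda>v. representation basis v e, \<lambda>v. representation basis v f] / 2) e, f])"
proof (rule bivector_eqI[OF P])
  let ?r = "\<lambda>e v. representation basis v e"
  show "(\<Sum>(e, f)\<in>basis \<times> basis. wedge sc [sc (P [?r e, ?r f] / 2) e, f]) \<in> ext_power sc 2"
    by (intro ext_power_sum) (auto intro: bivector_wedge)
  fix a b assume ab: "linfun a" "linfun b"
  have S: "(\<Sum>e\<in>basis. \<Sum>f\<in>basis. P [?r e, ?r f] * (a e * b f)) = P [a, b]" if ab: "linfun a" "linfun b" for a b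
  proof -
    have "(\<Sum>e\<in>basis. \<Sum>f\<in>basis. P [?r e, ?r f] * (a e * b f)) = (\<Sum>f\<in>basis. b f * (\<Sum>e\<in>basis. P [?r e, ?r f] * a e))"
      by (subst sum.swap) (simp add: sum_distrib_left algebra_simps)
    also have "\<dots> = (\<Sum>f\<in>basis. b f * a (contr P (?r f)))"
      by (simp add: contr_def lin_sum[OF ab(1)] lin_scale[OF ab(1)])
    also have "\<dots> = - (\<Sum>f\<in>basis. P [?r f, a] * b f)"
      unfolding sum_negf[symmetric]
      by (rule sum.cong[OF refl])
        (simp add: contr_eval[OF P ab(1) linfun_rep] bivector_antisym[OF P ab(1) linfun_rep])
    also have "\<dots> = - b (contr P a)" by (simp add: contr_def lin_sum[OF ab(2)] lin_scale[OF ab(2)])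
    also have "\<dots> = P [a, b]" using contr_eval[OF P ab(2,1)] bivector_antisym[OF P ab] by simp
    finally show ?thesis .
  qed
  have "(\<Sum>(e, f)\<in>basis \<times> basis. wedge sc [sc (P [?r e, ?r f] / 2) e, f]) [a, b] =
     (\<Sum>e\<in>basis. \<Sum>f\<in>basis. P [?r e, ?r f] / 2 * (a e * b f) - P [?r e, ?r f] / 2 * (b e * a f))"
    unfolding sum_fun_apply sum.cartesian_product
    by (intro sum.cong refl) (auto simp: wedge_2 ab lin_scale[OF ab(1)] lin_scale[OF ab(2)] algebra_simps)
  also have "\<dots> = (P [a, b] - P [b, a]) / 2"
    unfolding S[OF ab, symmetric] S[OF ab(2,1), symmetric]
    by (simp add: sum_subtractf sum_divide_distrib diff_divide_distrib)
  also have "\<dots> = P [a, b]" using bivector_antisym[OF P ab] by simp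
  finally show "P [a, b] = (\<Sum>(e, f)\<in>basis \<times> basis. wedge sc [sc (P [?r e, ?r f] / 2) e, f]) [a, b]" by simp
qed

text \<open>The coefficients are values of \<open>P\<close> on fixed functionals and thus
  holomorphic. This supplies the existence half of the definite description.\<close>

lemma holo_bivector_decompose:
  assumes P: "holo_multivector sc 2 V P"
  shows "\<exists>G. (\<forall>Xs\<in>set G. length Xs = 2 \<and> set Xs \<subseteq> {X. holo_map sc V X}) \<and>
    (\<forall>z\<in>V. P z = (\<Sum>Xs\<leftarrow>G. wedge sc (map (\<lambda>X. X z) Xs)))"
proof -
  let ?r = "\<lambda>e v. representation basis v e"
  obtain bs where bs: "set bs = basis \<times> basis" "distinct bs"
    using finite_distinct_list[of "basis \<times> basis"] finite_basis by blast
  define G where "G = map (\<lambda>(e, f). [\<lambda>z. sc (P z [?r e, ?r f] / 2) e, \<lambda>z. f]) bs"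
  have h: "holo_fun V (\<lambda>z. P z \<xi>s / 2)" for \<xi>s
  proof -
    have "holo_fun V (\<lambda>z. 1 / 2 * P z \<xi>s)" using P by (intro holo_fun_cmult) (auto simp: holo_multivector_def)
    then show ?thesis by simp
  qed
  have "length Xs = 2 \<and> set Xs \<subseteq> {X. holo_map sc V X}" if "Xs \<in> set G" for Xs
    using that h by (auto simp: G_def intro!: holo_map_scaled holo_map_const)
  moreover have "P z = (\<Sum>Xs\<leftarrow>G. wedge sc (map (\<lambda>X. X z) Xs))" if "z \<in> V" for z
  proof -
    have "P z \<in> ext_power sc 2" using P that by (simp add: holo_multivector_def)
    then have "P z = (\<Sum>(e, f)\<in>basis \<times> basis. wedge sc [sc (P z [?r e, ?r f] / 2) e, f])"
      by (rule bivector_expand)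
    also have "\<dots> = (\<Sum>(e, f)\<leftarrow>bs. wedge sc [sc (P z [?r e, ?r f] / 2) e, f])"
      unfolding bs(1)[symmetric] by (rule sum_list_distinct_conv_sum_set[OF bs(2), symmetric])
    also have "\<dots> = (\<Sum>Xs\<leftarrow>G. wedge sc (map (\<lambda>X. X z) Xs))"
      unfolding G_def by (simp add: comp_def case_prod_unfold)
    finally show ?thesis .
  qed
  ultimately show ?thesis by blast
qed

lemma vector_space_fibre: "vector_space (fibre_scale sc :: complex \<Rightarrow> (complex ^ 'n::finite) \<times> 'v \<Rightarrow> _)"
  by unfold_locales (auto simp: fibre_scale_def scale_right_distrib scale_left_distrib algebra_simps
      vec.scale_right_distrib vec.scale_left_distrib)

lemma fin_dim_cspace_fibre: "fin_dim_cspace (fibre_scale sc :: complex \<Rightarrow> (complex ^ 'n::finite) \<times> 'v \<Rightarrow> _)"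
proof -
  let ?fs = "fibre_scale sc :: complex \<Rightarrow> (complex ^ 'n) \<times> 'v \<Rightarrow> _"
  interpret F: vector_space ?fs by (rule vector_space_fibre)
  let ?A = "range (\<lambda>i. (axis i 1, 0)) :: ((complex ^ 'n) \<times> 'v) set" and ?B = "Pair 0 ` basis :: ((complex ^ 'n) \<times> 'v) set"
  have "(u, x) \<in> F.span (?A \<union> ?B)" for u x
  proof -
    have "(u, 0) = (\<Sum>i\<in>UNIV. ?fs (u $ i) (axis i 1, 0))"
      by (simp add: prod_eq_iff fst_sum snd_sum fibre_scale_def basis_expansion)
    also have "\<dots> \<in> F.span (?A \<union> ?B)" by (intro F.span_sum F.span_scale F.span_base) auto
    finally have 1: "(u, 0) \<in> F.span (?A \<union> ?B)" .
    have "x \<in> span basis" by (simp add: span_basis)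
    then have "(0, x) \<in> F.span (?A \<union> ?B)"
    proof (induction rule: span_induct_alt)
      case base
      then show ?case using F.span_zero by (simp add: zero_prod_def)
    next
      case (step c b y)
      have "(0, sc c b + y) = ?fs c (0, b) + (0, y)" by (simp add: fibre_scale_def)
      moreover have "(0, b) \<in> F.span (?A \<union> ?B)" by (rule F.span_base) (use step in auto)
      ultimately show ?case using step by (simp only: F.span_add F.span_scale)
    qed
    then have "(u, 0) + (0, x) \<in> F.span (?A \<union> ?B)" using 1 F.span_add by blast
    then show ?thesis by simp
  qed
  then have "F.span (?A \<union> ?B) = UNIV" by auto
  moreover have "finite (?A \<union> ?B)" using finite_basis by simp
  ultimately show ?thesis
    by (intro fin_dim_cspace.intro vector_space_fibre fin_dim_cspace_axioms.intro) blast
qed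

end

section \<open>The Schouten bracket of bivector fields on the gauge algebroid\<close>

locale gauge_algebroid = complex_lie_algebra sc br
  for sc :: "complex \<Rightarrow> 'g::ab_group_add \<Rightarrow> 'g" and br :: "'g \<Rightarrow> 'g \<Rightarrow> 'g" +
  fixes V :: "(complex ^ 'n::finite) set"
  assumes open_V: "open V"
begin

abbreviation fs :: "complex \<Rightarrow> (complex ^ 'n) \<times> 'g \<Rightarrow> (complex ^ 'n) \<times> 'g" where "fs \<equiv> fibre_scale sc"

sublocale F: fin_dim_cspace fs by (rule fin_dim_cspace_fibre)

abbreviation "flin a \<equiv> Vector_Spaces.linear fs (*) a"

definition ver :: "((complex ^ 'n) \<times> 'g \<Rightarrow> complex) \<Rightarrow> 'g \<Rightarrow> complex" where "ver a x = a (0, x)"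
definition hor :: "((complex ^ 'n) \<times> 'g \<Rightarrow> complex) \<Rightarrow> complex ^ 'n \<Rightarrow> complex" where "hor a u = a (u, 0)"

lemma fs_Pair: "fs c (u, x) = (c *s u, sc c x)" by (simp add: fibre_scale_def)

lemma fst_fs: "fst (fs c w) = c *s fst w" and snd_fs: "snd (fs c w) = sc c (snd w)"
  by (cases w; simp add: fibre_scale_def)+

lemma linfun_ver: "flin a \<Longrightarrow> linfun (ver a)"
proof -
  assume a: "flin a"
  have "ver a (x + y) = ver a x + ver a y" for x y using lin_add[OF a, of "(0, x)" "(0, y)"] by (simp add: ver_def)
  moreover have "ver a (sc c x) = c * ver a x" for c x using lin_scale[OF a, of c "(0, x)"] by (simp add: ver_def fs_Pair)
  ultimately show ?thesis by (simp add: Vector_Spaces.linear_iff vector_space_axioms vector_space_times)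
qed

lemma linear_hor: "flin a \<Longrightarrow> Vector_Spaces.linear (*s) (*) (hor a)"
proof -
  assume a: "flin a"
  have "hor a (x + y) = hor a x + hor a y" for x y using lin_add[OF a, of "(x, 0)" "(y, 0)"] by (simp add: hor_def)
  moreover have "hor a (c *s x) = c * hor a x" for c x using lin_scale[OF a, of c "(x, 0)"] by (simp add: hor_def fs_Pair)
  ultimately show ?thesis by (simp add: Vector_Spaces.linear_iff vec.vector_space_axioms vector_space_times)
qed

lemma flin_split: "flin a \<Longrightarrow> a w = hor a (fst w) + ver a (snd w)"
  using lin_add[of fs "(*)" a "(fst w, 0)" "(0, snd w)"] by (simp add: hor_def ver_def)

lemma flin_fst: "Vector_Spaces.linear (*s) (*) p \<Longrightarrow> flin (\<lambda>w. p (fst w))"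
  by (simp add: Vector_Spaces.linear_iff F.vector_space_axioms fst_fs)

lemma flin_snd: "linfun p \<Longrightarrow> flin (\<lambda>w. p (snd w))"
  by (simp add: Vector_Spaces.linear_iff F.vector_space_axioms snd_fs)

abbreviation "sections \<equiv> gauge_sections sc V"

lemma section_holo: "X \<in> sections \<Longrightarrow> flin a \<Longrightarrow> holo_fun V (\<lambda>z. a (X z))"
  unfolding gauge_sections_def by (auto intro: holo_mapD)

text \<open>After applying a functional, the derivatives of the tangent and the Lie algebra
  components merge into derivatives of \<open>a (Y w)\<close> and \<open>a (X w)\<close>, and only
  the pointwise bracket treats the components separately.\<close>

lemma gauge_bracket_eval:
  assumes X: "X \<in> sections" and Y: "Y \<in> sections" and z: "z \<in> V" and a: "flin a"
  shows "a (gauge_bracket sc br X Y z) = ver a (br (snd (X z)) (snd (Y z)))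
    + dderiv (\<lambda>w. a (Y w)) (fst (X z)) z - dderiv (\<lambda>w. a (X w)) (fst (Y z)) z"
proof -
  interpret C: fin_dim_cspace "(*s) :: complex \<Rightarrow> complex ^ 'n \<Rightarrow> complex ^ 'n" by (rule fin_dim_cspace_vec)
  have h: "holo_map (*s) V (fst \<circ> X)" "holo_map sc V (snd \<circ> X)" if X: "X \<in> sections" for X
    unfolding holo_map_def comp_def using section_holo[OF X] flin_fst flin_snd by auto
  have d: "hor a (dir_deriv (*s) (fst \<circ> X) v z) + ver a (dir_deriv sc (snd \<circ> X) v z) = dderiv (\<lambda>w. a (X w)) v z"
    if X: "X \<in> sections" for X v
  proof -
    have "hor a (dir_deriv (*s) (fst \<circ> X) v z) = dderiv (\<lambda>w. hor a (fst (X w))) v z"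
      using C.dir_deriv_eval[OF h(1)[OF X] z linear_hor[OF a]] by simp
    moreover have "ver a (dir_deriv sc (snd \<circ> X) v z) = dderiv (\<lambda>w. ver a (snd (X w))) v z"
      using dir_deriv_eval[OF h(2)[OF X] z linfun_ver[OF a]] by simp
    moreover have "dderiv (\<lambda>w. a (X w)) v z = dderiv (\<lambda>w. hor a (fst (X w)) + ver a (snd (X w))) v z"
      using flin_split[OF a] by simp
    moreover have "\<dots> = dderiv (\<lambda>w. hor a (fst (X w))) v z + dderiv (\<lambda>w. ver a (snd (X w))) v z"
      by (rule dderiv_add[OF _ _ z])
        (rule section_holo[OF X flin_fst[OF linear_hor[OF a]]] section_holo[OF X flin_snd[OF linfun_ver[OF a]]])+
    ultimately show ?thesis by simp
  qed
  show ?thesis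
    unfolding gauge_bracket_def flin_split[OF a, of "(_, _)"] fst_conv snd_conv
    by (simp add: lin_diff[OF linear_hor[OF a]] lin_diff[OF linfun_ver[OF a]] lin_add[OF linfun_ver[OF a]] d[OF X, symmetric] d[OF Y, symmetric])
qed

definition cyc :: "('a \<Rightarrow> 'a \<Rightarrow> 'a \<Rightarrow> complex) \<Rightarrow> 'a \<Rightarrow> 'a \<Rightarrow> 'a \<Rightarrow> complex" where
  "cyc K a b c = K a b c + K b c a + K c a b"

text \<open>The tensorial part of the bracket, which involves the two bivectors at one point
  only.\<close>

definition alg_part ::
  "((complex ^ 'n) \<times> 'g) tensor \<Rightarrow> ((complex ^ 'n) \<times> 'g) tensor \<Rightarrow> _ \<Rightarrow> _ \<Rightarrow> _ \<Rightarrow> complex" where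
  "alg_part P Q = skew3 (\<lambda>a b c. ver a (br (snd (F.contr P b)) (snd (F.contr Q c))))"

text \<open>The derivatives of the sections in the Schouten bracket combine, by the Leibniz rule, into derivatives
  of the components of the bivectors; this is why the bracket does not depend on the decompositions.\<close>
definition der_part ::
  "(complex ^ 'n \<Rightarrow> ((complex ^ 'n) \<times> 'g) tensor) \<Rightarrow> (complex ^ 'n \<Rightarrow> ((complex ^ 'n) \<times> 'g) tensor) \<Rightarrow>
   complex ^ 'n \<Rightarrow> _ \<Rightarrow> _ \<Rightarrow> _ \<Rightarrow> complex" where
  "der_part P Q z = cyc (\<lambda>a b c. dderiv (\<lambda>w. Q w [a, c]) (fst (F.contr (P z) b)) z
     - dderiv (\<lambda>w. P w [a, b]) (fst (F.contr (Q z) c)) z)"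

definition gauge_form ::
  "(complex ^ 'n \<Rightarrow> ((complex ^ 'n) \<times> 'g) tensor) \<Rightarrow> (complex ^ 'n \<Rightarrow> ((complex ^ 'n) \<times> 'g) tensor) \<Rightarrow>
   complex ^ 'n \<Rightarrow> _ \<Rightarrow> _ \<Rightarrow> _ \<Rightarrow> complex" where
  "gauge_form P Q z a b c = alg_part (P z) (Q z) a b c + der_part P Q z a b c"

abbreviation wsec :: "(complex ^ 'n \<Rightarrow> (complex ^ 'n) \<times> 'g) list \<Rightarrow> complex ^ 'n \<Rightarrow> ((complex ^ 'n) \<times> 'g) tensor" where
  "wsec Xs \<equiv> (\<lambda>z. wedge fs (map (\<lambda>X. X z) Xs))"

lemma wsec_holo:
  assumes "x \<in> sections" "y \<in> sections" "flin a" "flin b"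
  shows "holo_fun V (\<lambda>w. wsec [x, y] w [a, b])"
  by (simp add: F.wedge_2 assms holo_fun_diff holo_fun_mult section_holo)

lemma dderiv_wsec:
  assumes "x \<in> sections" "y \<in> sections" "flin a" "flin b" "z \<in> V"
  shows "dderiv (\<lambda>w. wsec [x, y] w [a, b]) v z =
    dderiv (\<lambda>w. a (x w)) v z * b (y z) + a (x z) * dderiv (\<lambda>w. b (y w)) v z
    - (dderiv (\<lambda>w. b (x w)) v z * a (y z) + b (x z) * dderiv (\<lambda>w. a (y w)) v z)"
proof -
  have "dderiv (\<lambda>w. wsec [x, y] w [a, b]) v z = dderiv (\<lambda>w. a (x w) * b (y w) - b (x w) * a (y w)) v z"
    by (simp add: F.wedge_2 assms)
  also have "\<dots> = dderiv (\<lambda>w. a (x w) * b (y w)) v z - dderiv (\<lambda>w. b (x w) * a (y w)) v z"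
    using assms by (intro dderiv_diff[of V] holo_fun_mult section_holo)
  also have "\<dots> = dderiv (\<lambda>w. a (x w)) v z * b (y z) + a (x z) * dderiv (\<lambda>w. b (y w)) v z
    - (dderiv (\<lambda>w. b (x w)) v z * a (y z) + b (x z) * dderiv (\<lambda>w. a (y w)) v z)"
    by (simp only: dderiv_mult[OF section_holo section_holo] assms)
  finally show ?thesis .
qed

lemma dderiv_wsec_contr:
  assumes S: "x \<in> sections" "y \<in> sections" and pr: "flin p" "flin r" and z: "z \<in> V" and q: "flin q"
  shows "dderiv (\<lambda>w. wsec [x, y] w [p, r]) (fst (F.contr (wsec [u, v] z) q)) z =
      q (v z) * (dderiv (\<lambda>w. p (x w)) (fst (u z)) z * r (y z) + p (x z) * dderiv (\<lambda>w. r (y w)) (fst (u z)) z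
        - (dderiv (\<lambda>w. r (x w)) (fst (u z)) z * p (y z) + r (x z) * dderiv (\<lambda>w. p (y w)) (fst (u z)) z))
      - q (u z) * (dderiv (\<lambda>w. p (x w)) (fst (v z)) z * r (y z) + p (x z) * dderiv (\<lambda>w. r (y w)) (fst (v z)) z
        - (dderiv (\<lambda>w. r (x w)) (fst (v z)) z * p (y z) + r (x z) * dderiv (\<lambda>w. p (y w)) (fst (v z)) z))"
proof -
  note l = dderiv_linear[OF wsec_holo[OF S pr] z]
  have c: "fst (F.contr (wsec [u, v] z) q) = q (v z) *s fst (u z) - q (u z) *s fst (v z)"
    by (simp add: F.contr_wedge[OF q] fst_fs)
  show ?thesis unfolding c lin_diff[OF l] lin_scale[OF l] by (simp only: dderiv_wsec[OF S pr z])
qed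

text \<open>Expanding \<open>der_part\<close> by the Leibniz rule yields derivatives of all four
  sections. In the cyclic sum they regroup into the antisymmetrized derivative terms of the four
  brackets, while \<open>alg_part\<close> matches the pointwise brackets.\<close>

lemma gauge_term:
  assumes S: "x \<in> sections" "y \<in> sections" "x' \<in> sections" "y' \<in> sections" and z: "z \<in> V"
    and abc: "flin a" "flin b" "flin c"
  shows "wsec [gauge_bracket sc br x x', y, y'] z [a, b, c] - wsec [gauge_bracket sc br x y', y, x'] z [a, b, c]
      - wsec [gauge_bracket sc br y x', x, y'] z [a, b, c] + wsec [gauge_bracket sc br y y', x, x'] z [a, b, c]
    = gauge_form (wsec [x, y]) (wsec [x', y']) z a b c"
proof -
  have alg: "alg_part (wsec [x, y] z) (wsec [x', y'] z) a b c =
     skew3 (\<lambda>a b c. ver a (br (snd (x z)) (snd (x' z))) * b (y z) * c (y' z)) a b c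
     - skew3 (\<lambda>a b c. ver a (br (snd (x z)) (snd (y' z))) * b (y z) * c (x' z)) a b c
     - skew3 (\<lambda>a b c. ver a (br (snd (y z)) (snd (x' z))) * b (x z) * c (y' z)) a b c
     + skew3 (\<lambda>a b c. ver a (br (snd (y z)) (snd (y' z))) * b (x z) * c (x' z)) a b c"
    unfolding alg_part_def
    by (simp add: skew3_def F.contr_wedge abc snd_fs br_left br_right lin_diff[OF linfun_ver] lin_scale[OF linfun_ver]
        algebra_simps)
  note e1 = dderiv_wsec_contr[OF S(3,4) _ _ z] and e2 = dderiv_wsec_contr[OF S(1,2) _ _ z]
  have der: "der_part (wsec [x, y]) (wsec [x', y']) z a b c =
     skew3 (\<lambda>a b c. (dderiv (\<lambda>w. a (x' w)) (fst (x z)) z - dderiv (\<lambda>w. a (x w)) (fst (x' z)) z) * b (y z) * c (y' z)) a b c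
     - skew3 (\<lambda>a b c. (dderiv (\<lambda>w. a (y' w)) (fst (x z)) z - dderiv (\<lambda>w. a (x w)) (fst (y' z)) z) * b (y z) * c (x' z)) a b c
     - skew3 (\<lambda>a b c. (dderiv (\<lambda>w. a (x' w)) (fst (y z)) z - dderiv (\<lambda>w. a (y w)) (fst (x' z)) z) * b (x z) * c (y' z)) a b c
     + skew3 (\<lambda>a b c. (dderiv (\<lambda>w. a (y' w)) (fst (y z)) z - dderiv (\<lambda>w. a (y w)) (fst (y' z)) z) * b (x z) * c (x' z)) a b c"
    \<comment> \<open>What remains is a polynomial identity in the values and derivatives of the
      sections, all treated as indeterminates.\<close>
    unfolding der_part_def cyc_def e1[OF abc(1,3,2)] e1[OF abc(2,1,3)] e1[OF abc(3,2,1)]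
      e2[OF abc(1,2,3)] e2[OF abc(2,3,1)] e2[OF abc(3,1,2)] skew3_def
    by algebra
  have W: "wsec [gauge_bracket sc br u u', v, v'] z [a, b, c] =
      skew3 (\<lambda>a b c. ver a (br (snd (u z)) (snd (u' z))) * b (v z) * c (v' z)) a b c
      + skew3 (\<lambda>a b c. (dderiv (\<lambda>w. a (u' w)) (fst (u z)) z - dderiv (\<lambda>w. a (u w)) (fst (u' z)) z) * b (v z) * c (v' z)) a b c"
    if u: "u \<in> sections" "u' \<in> sections" for u u' v v'
    by (simp add: F.wedge_3 abc skew3_def gauge_bracket_eval[OF u z] algebra_simps)
  show ?thesis unfolding gauge_form_def alg der W[OF S(1,3)] W[OF S(1,4)] W[OF S(2,3)] W[OF S(2,4)] by simp
qed

text \<open>\<open>P\<close> only supplies a direction, so its decomposition at the point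
  \<open>z\<close> suffices. \<open>Q\<close> is differentiated and needs its decomposition on the
  open set \<open>V\<close>.\<close>

lemma dderiv_wsec_sum:
  assumes P: "P z = (\<Sum>i<(m::nat). wsec [x i, y i] z)" and Q: "\<And>w. w \<in> V \<Longrightarrow> Q w = (\<Sum>j<(n::nat). wsec [x' j, y' j] w)"
    and S: "\<And>j. j < n \<Longrightarrow> x' j \<in> sections \<and> y' j \<in> sections" and z: "z \<in> V" and pr: "flin p" "flin r"
  shows "dderiv (\<lambda>w. Q w [p, r]) (fst (F.contr (P z) q)) z = (\<Sum>i<m. \<Sum>j<n.
    dderiv (\<lambda>w. wsec [x' j, y' j] w [p, r]) (fst (F.contr (wsec [x i, y i] z) q)) z)"
proof -
  have h: "holo_fun V (\<lambda>w. wsec [x' j, y' j] w [p, r])" if "j < n" for j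
    using wsec_holo S that pr by blast
  have "dderiv (\<lambda>w. Q w [p, r]) v z = (\<Sum>j<n. dderiv (\<lambda>w. wsec [x' j, y' j] w [p, r]) v z)" for v
  proof -
    have "dderiv (\<lambda>w. Q w [p, r]) v z = dderiv (\<lambda>w. \<Sum>j<n. wsec [x' j, y' j] w [p, r]) v z"
      by (rule dderiv_cong[OF open_V z]) (simp add: Q sum_fun_apply)
    also have "\<dots> = (\<Sum>j<n. dderiv (\<lambda>w. wsec [x' j, y' j] w [p, r]) v z)"
      by (rule dderiv_sum[OF _ z]) (use h in auto)
    finally show ?thesis .
  qed
  moreover have "dderiv (\<lambda>w. wsec [x' j, y' j] w [p, r]) (fst (F.contr (P z) q)) z = (\<Sum>i<m.
    dderiv (\<lambda>w. wsec [x' j, y' j] w [p, r]) (fst (F.contr (wsec [x i, y i] z) q)) z)" if "j < n" for j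
    unfolding P F.contr_sum fst_sum by (rule lin_sum[OF dderiv_linear[OF h[OF that] z]])
  ultimately show ?thesis by (subst sum.swap) simp
qed

lemma gauge_form_sum:
  assumes P: "\<And>w. w \<in> V \<Longrightarrow> P w = (\<Sum>i<(m::nat). wsec [x i, y i] w)" and Q: "\<And>w. w \<in> V \<Longrightarrow> Q w = (\<Sum>j<(n::nat). wsec [x' j, y' j] w)"
    and S: "\<And>i. i < m \<Longrightarrow> x i \<in> sections \<and> y i \<in> sections" "\<And>j. j < n \<Longrightarrow> x' j \<in> sections \<and> y' j \<in> sections"
    and z: "z \<in> V" and abc: "flin a" "flin b" "flin c"
  shows "gauge_form P Q z a b c = (\<Sum>i<m. \<Sum>j<n. gauge_form (wsec [x i, y i]) (wsec [x' j, y' j]) z a b c)"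
proof -
  have A: "ver p (br (snd (F.contr (P z) q)) (snd (F.contr (Q z) r))) = (\<Sum>i<m. \<Sum>j<n.
      ver p (br (snd (F.contr (wsec [x i, y i] z) q)) (snd (F.contr (wsec [x' j, y' j] z) r))))" if p: "flin p" for p q r
    unfolding P[OF z] Q[OF z] F.contr_sum snd_sum lin_sum[OF linear_left] lin_sum[OF linear_right] lin_sum[OF linfun_ver[OF p]]
    by (rule sum.swap)
  have "alg_part (P z) (Q z) a b c = (\<Sum>i<m. \<Sum>j<n. alg_part (wsec [x i, y i] z) (wsec [x' j, y' j] z) a b c)"
    unfolding alg_part_def by (simp add: skew3_def A abc sum.distrib sum_subtractf)
  moreover note D1 = dderiv_wsec_sum[where P = P and Q = Q and x = x and y = y and x' = x' and y' = y', OF P[OF z] Q S(2) z]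
  have D2: "dderiv (\<lambda>w. P w [p, r]) (fst (F.contr (Q z) q)) z = (\<Sum>i<m. \<Sum>j<n.
      dderiv (\<lambda>w. wsec [x i, y i] w [p, r]) (fst (F.contr (wsec [x' j, y' j] z) q)) z)" if "flin p" "flin r" for p q r
    by (subst sum.swap) (rule dderiv_wsec_sum[where P = Q and Q = P and x = x' and y = y' and x' = x and y' = y, OF Q[OF z] P S(1) z that])
  have "der_part P Q z a b c = (\<Sum>i<m. \<Sum>j<n. der_part (wsec [x i, y i]) (wsec [x' j, y' j]) z a b c)"
    unfolding der_part_def cyc_def by (simp only: D1 D2 abc sum.distrib sum_subtractf)
  ultimately show ?thesis by (simp add: gauge_form_def sum.distrib)
qed

text \<open>\<open>gauge_term\<close> evaluates the bracket for single wedges and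
  \<open>gauge_form_sum\<close> adds the results up for arbitrary decompositions; off
  \<open>V\<close> both sides are zero by \<open>on_dom\<close>.\<close>

lemma gauge_schouten_22:
  assumes P: "holo_multivector fs 2 V P" and Q: "holo_multivector fs 2 V Q"
  shows "gauge_schouten sc br V 2 2 P Q = on_dom V (\<lambda>z. F.form3 (gauge_form P Q z))"
proof -
  let ?w = "\<lambda>Xs. on_dom V (\<lambda>z. wedge fs (map (\<lambda>X. X z) Xs))"
  have dec: "\<exists>G. (\<forall>Xs\<in>set G. length Xs = 2 \<and> set Xs \<subseteq> sections) \<and> on_dom V P = (\<Sum>Xs\<leftarrow>G. ?w Xs)"
    if P: "holo_multivector fs 2 V P" for P
  proof -
    obtain G where G: "\<forall>Xs\<in>set G. length Xs = 2 \<and> set Xs \<subseteq> sections"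
      "\<forall>z\<in>V. P z = (\<Sum>Xs\<leftarrow>G. wedge fs (map (\<lambda>X. X z) Xs))"
      using F.holo_bivector_decompose[OF P] unfolding gauge_sections_def by blast
    have "on_dom V P = (\<Sum>Xs\<leftarrow>G. ?w Xs)"
      by (rule ext) (simp add: on_dom_def sum_list_map_nth sum_fun_apply G(2))
    then show ?thesis using G(1) by blast
  qed
  obtain F0 where F0: "\<forall>Xs\<in>set F0. length Xs = 2 \<and> set Xs \<subseteq> sections" "on_dom V P = (\<Sum>Xs\<leftarrow>F0. ?w Xs)"
    using dec[OF P] by blast
  obtain G0 where G0: "\<forall>Xs\<in>set G0. length Xs = 2 \<and> set Xs \<subseteq> sections" "on_dom V Q = (\<Sum>Xs\<leftarrow>G0. ?w Xs)"
    using dec[OF Q] by blast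
  show ?thesis unfolding gauge_schouten_def
  proof (rule schouten_eqI[OF F0(1) G0(1) F0(2) G0(2)])
    fix F G assume F: "\<forall>xs\<in>set F. length xs = 2 \<and> set xs \<subseteq> sections" and G: "\<forall>xs\<in>set G. length xs = 2 \<and> set xs \<subseteq> sections"
      and PF: "on_dom V P = (\<Sum>xs\<leftarrow>F. ?w xs)" and QG: "on_dom V Q = (\<Sum>xs\<leftarrow>G. ?w xs)"
    define x y where "x i = F ! i ! 0" and "y i = F ! i ! 1" for i
    define x' y' where "x' i = G ! i ! 0" and "y' i = G ! i ! 1" for i
    have Fi: "F ! i = [x i, y i]" "x i \<in> sections \<and> y i \<in> sections" if "i < length F" for i
    proof -
      show "F ! i = [x i, y i]" using length_2_cases[of "F ! i"] F that unfolding x_def y_def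
        by (metis nth_mem nth_Cons_0 nth_Cons_Suc One_nat_def)
      then show "x i \<in> sections \<and> y i \<in> sections" using F nth_mem[OF that] by auto
    qed
    have Gi: "G ! i = [x' i, y' i]" "x' i \<in> sections \<and> y' i \<in> sections" if "i < length G" for i
    proof -
      show "G ! i = [x' i, y' i]" using length_2_cases[of "G ! i"] G that unfolding x'_def y'_def
        by (metis nth_mem nth_Cons_0 nth_Cons_Suc One_nat_def)
      then show "x' i \<in> sections \<and> y' i \<in> sections" using G nth_mem[OF that] by auto
    qed
    have Pw: "P w = (\<Sum>i<length F. wsec [x i, y i] w)" if "w \<in> V" for w
      using fun_cong[OF PF, of w] that Fi(1) by (simp add: on_dom_def sum_list_map_nth sum_fun_apply)
    have Qw: "Q w = (\<Sum>i<length G. wsec [x' i, y' i] w)" if "w \<in> V" for w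
      using fun_cong[OF QG, of w] that Gi(1) by (simp add: on_dom_def sum_list_map_nth sum_fun_apply)
    define T where "T xs ys = (\<Sum>i<2. \<Sum>j<2. (let T = ?w (gauge_bracket sc br (xs ! i) (ys ! j) # delete_nth i xs @ delete_nth j ys)
        in if even (i + j) then T else - T))" for xs ys
    have T: "T (F ! i) (G ! j) = ?w [gauge_bracket sc br (x i) (x' j), y i, y' j] - ?w [gauge_bracket sc br (x i) (y' j), y i, x' j]
      - ?w [gauge_bracket sc br (y i) (x' j), x i, y' j] + ?w [gauge_bracket sc br (y i) (y' j), x i, x' j]"
      if "i < length F" "j < length G" for i j
      unfolding T_def Fi(1)[OF that(1)] Gi(1)[OF that(2)] by (simp add: numeral_2_eq_2 lessThan_Suc algebra_simps)
    have "(\<Sum>i<length F. \<Sum>j<length G. T (F ! i) (G ! j)) = on_dom V (\<lambda>z. F.form3 (gauge_form P Q z))"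
    proof
      fix z
      have s: "F.supported 3 (wedge fs [x, y, z])" for x y z
        using F.supported_wedge[of "[x, y, z]"] by (simp add: numeral_3_eq_3)
      show "(\<Sum>i<length F. \<Sum>j<length G. T (F ! i) (G ! j)) z = on_dom V (\<lambda>z. F.form3 (gauge_form P Q z)) z"
      proof (cases "z \<in> V")
        case False
        then show ?thesis by (simp add: sum_fun_apply T on_dom_def)
      next
        case True
        have Tz: "T (F ! i) (G ! j) z = wsec [gauge_bracket sc br (x i) (x' j), y i, y' j] z - wsec [gauge_bracket sc br (x i) (y' j), y i, x' j] z
            - wsec [gauge_bracket sc br (y i) (x' j), x i, y' j] z + wsec [gauge_bracket sc br (y i) (y' j), x i, x' j] z"
          if "i < length F" "j < length G" for i j
          using True by (simp add: T[OF that] on_dom_def)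
        have "(\<Sum>i<length F. \<Sum>j<length G. T (F ! i) (G ! j) z) = F.form3 (gauge_form P Q z)"
        proof (rule F.eq_form3I)
          have "F.supported 3 (T (F ! i) (G ! j) z)" if "i < length F" "j < length G" for i j
            unfolding Tz[OF that] using s by (simp add: F.supported_def)
          then show "F.supported 3 (\<Sum>i<length F. \<Sum>j<length G. T (F ! i) (G ! j) z)"
            by (intro F.supported_sum) auto
          fix a b c assume abc: "flin a" "flin b" "flin c"
          have "T (F ! i) (G ! j) z [a, b, c] = gauge_form (wsec [x i, y i]) (wsec [x' j, y' j]) z a b c"
            if "i < length F" "j < length G" for i j
            unfolding Tz[OF that] minus_apply plus_fun_apply fun_diff_def
            using gauge_term[of "x i" "y i" "x' j" "y' j", OF _ _ _ _ True abc] Fi(2)[OF that(1)] Gi(2)[OF that(2)] by simp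
          then show "(\<Sum>i<length F. \<Sum>j<length G. T (F ! i) (G ! j) z) [a, b, c] = gauge_form P Q z a b c"
            using gauge_form_sum[OF Pw Qw Fi(2) Gi(2) True abc] by (simp add: sum_fun_apply)
        qed
        then show ?thesis using True by (simp add: sum_fun_apply on_dom_def)
      qed
    qed
    then show "(\<Sum>xs\<leftarrow>F. \<Sum>ys\<leftarrow>G. \<Sum>i<2. \<Sum>j<2.
       (let T = ?w (gauge_bracket sc br (xs ! i) (ys ! j) # delete_nth i xs @ delete_nth j ys)
        in if even (i + j) then T else - T)) = on_dom V (\<lambda>z. F.form3 (gauge_form P Q z))"
      unfolding T_def sum_list_map_nth by simp
  qed
qed

end

section \<open>Hamiltonian operators and dynamical r-matrices\<close>

locale dynamical_setting = positive_root_algebra sc br H E P + gauge_algebroid sc br V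
  for sc :: "complex \<Rightarrow> 'g::ab_group_add \<Rightarrow> 'g" and br :: "'g \<Rightarrow> 'g \<Rightarrow> 'g" and H E P
    and V :: "(complex ^ 'n::finite) set" +
  fixes h :: "'n \<Rightarrow> 'g" and T :: "complex ^ 'n \<Rightarrow> 'g tensor"
  assumes span_h: "span (range h) = H"
    and holo_T: "holo_multivector sc 2 V T"
begin

lemma T_bivector: "z \<in> V \<Longrightarrow> T z \<in> ext_power sc 2"
  and T_holo: "holo_fun V (\<lambda>z. T z \<xi>s)"
  using holo_T by (auto simp: holo_multivector_def)

lemma h_H: "h i \<in> H" using span_h span_base[of "h i" "range h"] by blast

abbreviation "\<Theta> \<equiv> (\<lambda>z. theta sc h z + to_gauge sc (T z))"

lemma to_gauge_eval: "flin a \<Longrightarrow> flin b \<Longrightarrow> to_gauge sc Q [a, b] = Q [ver a, ver b]"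
  by (simp add: to_gauge_def tensor_map_def comp_def ver_def[abs_def])

lemma to_gauge_sum: "to_gauge sc (\<Sum>i\<in>I. Q i) = (\<Sum>i\<in>I. to_gauge sc (Q i))"
proof -
  have "(if C then \<Sum>i\<in>I. f i else 0) = (\<Sum>i\<in>I. if C then f i else (0 :: complex))" for C f
    by (cases C) simp_all
  then show ?thesis by (intro ext) (simp only: to_gauge_def tensor_map_def sum_fun_apply)
qed

lemma to_gauge_wedge: "to_gauge sc (wedge sc [x, y]) = wedge fs [(0, x), (0, y)]"
proof (rule F.supported_eqI)
  show "F.supported 2 (wedge fs [(0, x), (0, y)])" by (rule F.bivector_supported[OF F.bivector_wedge])
  have "supported 2 (wedge sc [x, y])" by (rule bivector_supported[OF bivector_wedge])
  then show "F.supported 2 (to_gauge sc (wedge sc [x, y]))"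
    by (auto simp: F.supported_def supported_def to_gauge_def tensor_map_def)
  fix \<xi>s :: "((complex ^ 'n) \<times> 'g \<Rightarrow> complex) list" assume "length \<xi>s = 2" "\<forall>\<xi>\<in>set \<xi>s. flin \<xi>"
  then obtain a b where "\<xi>s = [a, b]" "flin a" "flin b" using length_2_cases[of \<xi>s] by auto
  then show "to_gauge sc (wedge sc [x, y]) \<xi>s = wedge fs [(0, x), (0, y)] \<xi>s"
    by (simp add: to_gauge_eval wedge_2 linfun_ver F.wedge_2 ver_def)
qed

lemma to_gauge_bivector: assumes Q: "Q \<in> ext_power sc 2" shows "to_gauge sc Q \<in> ext_power fs 2"
proof -
  obtain n x y where Qd: "Q = (\<Sum>i<(n::nat). wedge sc [x i, y i])" by (rule bivector_decompose[OF Q])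
  show ?thesis unfolding Qd to_gauge_sum to_gauge_wedge by (intro F.ext_power_sum F.bivector_wedge)
qed

lemma contr_to_gauge:
  assumes Q: "Q \<in> ext_power sc 2" and b: "flin b"
  shows "F.contr (to_gauge sc Q) b = (0, contr Q (ver b))"
proof -
  obtain n x y where Qd: "Q = (\<Sum>i<(n::nat). wedge sc [x i, y i])" by (rule bivector_decompose[OF Q])
  show ?thesis unfolding Qd to_gauge_sum to_gauge_wedge F.contr_sum contr_sum
    by (simp add: F.contr_wedge[OF b] contr_wedge[OF linfun_ver[OF b]] fs_Pair ver_def prod_eq_iff fst_sum snd_sum)
qed

text \<open>The minus sign of the tangent component arises because the coordinate field is the
  second factor of each wedge in \<open>theta\<close>.\<close>

lemma contr_theta:
  assumes b: "flin b"
  shows "F.contr (theta sc h z) b =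
    (- (\<Sum>i\<in>UNIV. ver b (h i) *s axis i 1), \<Sum>i\<in>UNIV. sc (hor b (axis i 1)) (h i))"
  unfolding theta_def F.contr_sum
  by (simp add: F.contr_wedge[OF b] fs_Pair ver_def hor_def prod_eq_iff fst_sum snd_sum sum_negf)

lemma theta_bivector: "theta sc h z \<in> ext_power fs 2"
  unfolding theta_def by (intro F.ext_power_sum F.bivector_wedge)

lemma Theta_holo: "holo_multivector fs 2 V \<Theta>"
  unfolding holo_multivector_def
proof (intro conjI ballI allI)
  show "\<Theta> z \<in> ext_power fs 2" if "z \<in> V" for z
    by (intro F.ext_power_add theta_bivector to_gauge_bivector T_bivector that)
  show "holo_fun V (\<lambda>z. \<Theta> z \<xi>s)" for \<xi>s
  proof -
    have "holo_fun V (\<lambda>z. theta sc h z \<xi>s)" unfolding theta_def by (rule holo_fun_const)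
    moreover have "holo_fun V (\<lambda>z. to_gauge sc (T z) \<xi>s)"
    proof -
      have "holo_fun V (\<lambda>z. if C then f z else 0)" if "holo_fun V f" for C f
        using that by (cases C) (simp_all add: holo_fun_const)
      then show ?thesis unfolding to_gauge_def tensor_map_def using T_holo by blast
    qed
    ultimately show ?thesis by (simp add: holo_fun_add)
  qed
qed

lemma r0_gauge_holo: "holo_multivector fs 2 V (\<lambda>_. to_gauge sc r0)"
  unfolding holo_multivector_def using to_gauge_bivector[OF r0_bivector] holo_fun_const by blast

lemma contr_Theta:
  assumes z: "z \<in> V" and b: "flin b"
  shows "fst (F.contr (\<Theta> z) b) = - (\<Sum>i\<in>UNIV. ver b (h i) *s axis i 1)"
    and "snd (F.contr (\<Theta> z) b) = (\<Sum>i\<in>UNIV. sc (hor b (axis i 1)) (h i)) + contr (T z) (ver b)"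
  unfolding F.contr_add contr_theta[OF b] contr_to_gauge[OF T_bivector[OF z] b] by simp_all

definition dT :: "'n \<Rightarrow> complex ^ 'n \<Rightarrow> ('g \<Rightarrow> complex) \<Rightarrow> ('g \<Rightarrow> complex) \<Rightarrow> complex" where
  "dT i z a b = dderiv (\<lambda>w. T w [a, b]) (axis i 1) z"

lemma dT_antisym: assumes "z \<in> V" "linfun a" "linfun b" shows "dT i z a b = - dT i z b a"
proof -
  have "dT i z a b = dderiv (\<lambda>w. - 1 * T w [b, a]) (axis i 1) z"
    unfolding dT_def using bivector_antisym[OF T_bivector assms(2,3)]
    by (intro dderiv_cong[OF open_V assms(1)]) auto
  also have "\<dots> = - 1 * dT i z b a" unfolding dT_def by (rule dderiv_cmult[OF T_holo assms(1)])
  finally show ?thesis by simp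
qed

text \<open>\<open>theta\<close> is constant in these coordinates, so only \<open>T\<close> is
  differentiated, while the direction comes from \<open>theta\<close> alone.\<close>

lemma dderiv_Theta:
  assumes z: "z \<in> V" and abc: "flin a" "flin b" "flin c"
  shows "dderiv (\<lambda>w. \<Theta> w [a, c]) (fst (F.contr (\<Theta> z) b)) z = - (\<Sum>i\<in>UNIV. ver b (h i) * dT i z (ver a) (ver c))"
proof -
  have "dderiv (\<lambda>w. \<Theta> w [a, c]) v z = dderiv (\<lambda>w. T w [ver a, ver c]) v z" for v
  proof -
    have "dderiv (\<lambda>w. \<Theta> w [a, c]) v z = dderiv (\<lambda>w. theta sc h z [a, c] + T w [ver a, ver c]) v z"
      by (simp add: to_gauge_eval abc theta_def)
    also have "\<dots> = dderiv (\<lambda>w. T w [ver a, ver c]) v z"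
      by (subst dderiv_add[OF holo_fun_const T_holo z]) simp
    finally show ?thesis .
  qed
  then show ?thesis unfolding contr_Theta(1)[OF z abc(2)] dT_def
    by (simp add: lin_neg[OF dderiv_linear[OF T_holo z]] lin_sum[OF dderiv_linear[OF T_holo z]]
        lin_scale[OF dderiv_linear[OF T_holo z]])
qed

definition alt_T :: "complex ^ 'n \<Rightarrow> ('g \<Rightarrow> complex) \<Rightarrow> ('g \<Rightarrow> complex) \<Rightarrow> ('g \<Rightarrow> complex) \<Rightarrow> complex" where
  "alt_T z a b c = (\<Sum>i\<in>UNIV. a (h i) * dT i z b c + b (h i) * dT i z c a + c (h i) * dT i z a b)"

definition obstruction :: "complex ^ 'n \<Rightarrow> ('g \<Rightarrow> complex) \<Rightarrow> ('g \<Rightarrow> complex) \<Rightarrow> ('g \<Rightarrow> complex) \<Rightarrow> complex" where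
  "obstruction z a b c = alt_T z a b c + schouten_form r0 (T z) a b c + 1/2 * schouten_form (T z) (T z) a b c"

text \<open>Each of the two derivative terms in \<open>der_part\<close> yields one copy of
  \<open>alt_T\<close> after the cyclic sum, up to antisymmetry of \<open>dT\<close>.\<close>

lemma der_part_Theta:
  assumes z: "z \<in> V" and abc: "flin a" "flin b" "flin c"
  shows "der_part \<Theta> \<Theta> z a b c = 2 * alt_T z (ver a) (ver b) (ver c)"
proof -
  note l = linfun_ver[OF abc(1)] linfun_ver[OF abc(2)] linfun_ver[OF abc(3)]
  note an = dT_antisym[OF z l(1) l(3)] dT_antisym[OF z l(2) l(1)] dT_antisym[OF z l(3) l(2)]
  have "der_part \<Theta> \<Theta> z a b c =
    (\<Sum>i\<in>UNIV. 2 * (ver a (h i) * dT i z (ver b) (ver c) + ver b (h i) * dT i z (ver c) (ver a)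
      + ver c (h i) * dT i z (ver a) (ver b)))"
    unfolding der_part_def cyc_def dderiv_Theta[OF z abc(1,2,3)] dderiv_Theta[OF z abc(2,3,1)] dderiv_Theta[OF z abc(3,1,2)]
      dderiv_Theta[OF z abc(1,3,2)] dderiv_Theta[OF z abc(2,1,3)] dderiv_Theta[OF z abc(3,2,1)]
    by (simp add: an sum.distrib sum_negf sum_distrib_left algebra_simps)
  then show ?thesis by (simp add: alt_T_def sum_distrib_left)
qed

text \<open>Every summand carries a horizontal value of one functional, and its coefficient is the
  action of some \<open>h i\<close> on \<open>T z\<close>. It vanishes on purely vertical
  functionals.\<close>

definition tangential :: "complex ^ 'n \<Rightarrow> ((complex ^ 'n) \<times> 'g \<Rightarrow> complex) \<Rightarrow> _ \<Rightarrow> _ \<Rightarrow> complex" where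
  "tangential z a b c = (\<Sum>i\<in>UNIV. hor a (axis i 1) * adj_form (h i) (T z) (ver c) (ver b)
     + hor b (axis i 1) * adj_form (h i) (T z) (ver a) (ver c)
     + hor c (axis i 1) * adj_form (h i) (T z) (ver b) (ver a))"

lemma br_hh: "br (\<Sum>i\<in>UNIV. sc (f i) (h i)) (\<Sum>i\<in>UNIV. sc (g i) (h i)) = 0"
proof -
  have "(\<Sum>i\<in>UNIV. sc (f i) (h i)) \<in> H" for f
    using h_H subspace_H by (intro subspace_sum subspace_scale) auto
  then show ?thesis using H_abelian by blast
qed

text \<open>The bracket of the two \<open>theta\<close> contributions is zero by
  \<open>br_hh\<close>. The mixed terms occur once with \<open>theta\<close> on the left and once on
  the right, whence the factor 2.\<close>

lemma alg_part_Theta: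
  assumes z: "z \<in> V" and abc: "flin a" "flin b" "flin c"
  shows "alg_part (\<Theta> z) (\<Theta> z) a b c = schouten_form (T z) (T z) (ver a) (ver b) (ver c) + 2 * tangential z a b c"
proof -
  have K: "ver p (br (snd (F.contr (\<Theta> z) q)) (snd (F.contr (\<Theta> z) r))) =
     ver p (br (contr (T z) (ver q)) (contr (T z) (ver r)))
     + (\<Sum>i\<in>UNIV. hor q (axis i 1) * ver p (br (h i) (contr (T z) (ver r))))
     - (\<Sum>i\<in>UNIV. hor r (axis i 1) * ver p (br (h i) (contr (T z) (ver q))))"
    if p: "flin p" "flin q" "flin r" for p q r
  proof -
    have an: "br (contr (T z) (ver q)) (\<Sum>i\<in>UNIV. sc (hor r (axis i 1)) (h i)) =
      - br (\<Sum>i\<in>UNIV. sc (hor r (axis i 1)) (h i)) (contr (T z) (ver q))" by (rule br_antisym)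
    show ?thesis
      unfolding contr_Theta(2)[OF z p(2)] contr_Theta(2)[OF z p(3)] br_left br_right br_hh an
      by (simp add: lin_diff[OF linfun_ver[OF p(1)]] lin_add[OF linfun_ver[OF p(1)]] lin_neg[OF linfun_ver[OF p(1)]] lin_sum[OF linear_left]
          lin_sum[OF linfun_ver[OF p(1)]] br_left lin_scale[OF linfun_ver[OF p(1)]])
  qed
  show ?thesis
    unfolding alg_part_def schouten_form_def tangential_def adj_form_def
    by (simp add: skew3_def K abc sum.distrib sum_distrib_left sum_subtractf algebra_simps)
qed

text \<open>\<open>r0\<close> is constant and has no tangent component, so nothing is
  differentiated. The mixed terms with \<open>theta\<close> cancel in pairs because
  \<open>r0\<close> is invariant under \<open>H\<close>.\<close>

lemma gauge_form_r0:
  assumes z: "z \<in> V" and abc: "flin a" "flin b" "flin c"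
  shows "gauge_form (\<lambda>_. to_gauge sc r0) \<Theta> z a b c = schouten_form r0 (T z) (ver a) (ver b) (ver c)"
proof -
  have c0: "F.contr (to_gauge sc r0) q = (0, contr r0 (ver q))" if "flin q" for q
    by (rule contr_to_gauge[OF r0_bivector that])
  have "holo_fun V (\<lambda>w. \<Theta> w \<xi>s)" for \<xi>s using Theta_holo by (simp add: holo_multivector_def)
  then have D0: "dderiv (\<lambda>w. \<Theta> w \<xi>s) 0 z = 0" for \<xi>s by (rule lin_zero[OF dderiv_linear[OF _ z]])
  have der: "der_part (\<lambda>_. to_gauge sc r0) \<Theta> z a b c = 0"
    unfolding der_part_def cyc_def c0[OF abc(1)] c0[OF abc(2)] c0[OF abc(3)] fst_conv D0 by simp
  have K: "ver p (br (snd (F.contr (to_gauge sc r0) q)) (snd (F.contr (\<Theta> z) r))) =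
     ver p (br (contr r0 (ver q)) (contr (T z) (ver r)))
     - (\<Sum>i\<in>UNIV. hor r (axis i 1) * ver p (br (h i) (contr r0 (ver q))))"
    if p: "flin p" "flin q" "flin r" for p q r
  proof -
    have an: "br (contr r0 (ver q)) (\<Sum>i\<in>UNIV. sc (hor r (axis i 1)) (h i)) =
      - br (\<Sum>i\<in>UNIV. sc (hor r (axis i 1)) (h i)) (contr r0 (ver q))" by (rule br_antisym)
    show ?thesis
      unfolding contr_Theta(2)[OF z p(3)] c0[OF p(2)] snd_conv br_left br_right an
      by (simp add: lin_add[OF linfun_ver[OF p(1)]] lin_diff[OF linfun_ver[OF p(1)]] lin_neg[OF linfun_ver[OF p(1)]] lin_sum[OF linear_left]
          lin_sum[OF linfun_ver[OF p(1)]] br_left lin_scale[OF linfun_ver[OF p(1)]])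
  qed
  \<comment> \<open>Invariance of \<open>r0\<close> in the form of a symmetry in \<open>p\<close>
    and \<open>q\<close>, which the antisymmetrization in \<open>skew3\<close> annihilates.\<close>
  have s: "ver p (br (h i) (contr r0 (ver q))) = ver q (br (h i) (contr r0 (ver p)))" if "flin p" "flin q" for p q i
    using adj_form_r0[OF h_H linfun_ver[OF that(1)] linfun_ver[OF that(2)], of i] by (simp add: adj_form_def)
  have "alg_part (to_gauge sc r0) (\<Theta> z) a b c = schouten_form r0 (T z) (ver a) (ver b) (ver c)"
    unfolding alg_part_def schouten_form_def
    by (simp add: skew3_def K abc s[OF abc(2) abc(1)] s[OF abc(3) abc(1)] s[OF abc(3) abc(2)])
  then show ?thesis by (simp add: gauge_form_def der)
qed

lemma hamiltonian_iff:
  "hamiltonian_operator sc br r0 V \<Theta> \<longleftrightarrow>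
    (\<forall>z\<in>V. \<forall>a b c. flin a \<longrightarrow> flin b \<longrightarrow> flin c \<longrightarrow>
      obstruction z (ver a) (ver b) (ver c) + tangential z a b c = 0)"
proof -
  have val: "gauge_form (\<lambda>_. to_gauge sc r0) \<Theta> z a b c + gauge_form \<Theta> \<Theta> z a b c / 2 =
      obstruction z (ver a) (ver b) (ver c) + tangential z a b c"
    if z: "z \<in> V" and abc: "flin a" "flin b" "flin c" for z a b c
    unfolding gauge_form_r0[OF z abc]
    unfolding gauge_form_def alg_part_Theta[OF z abc] der_part_Theta[OF z abc] obstruction_def by simp
  have "hamiltonian_operator sc br r0 V \<Theta> \<longleftrightarrow>
    (\<forall>z\<in>V. \<forall>\<xi>s. F.form3 (gauge_form (\<lambda>_. to_gauge sc r0) \<Theta> z) \<xi>s + 1/2 * F.form3 (gauge_form \<Theta> \<Theta> z) \<xi>s = 0)"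
    unfolding hamiltonian_operator_def d_star_def gauge_schouten_22[OF r0_gauge_holo Theta_holo]
      gauge_schouten_22[OF Theta_holo Theta_holo] using Theta_holo by (simp add: on_dom_def)
  also have "\<dots> \<longleftrightarrow> (\<forall>z\<in>V. \<forall>a b c. flin a \<longrightarrow> flin b \<longrightarrow> flin c \<longrightarrow>
      obstruction z (ver a) (ver b) (ver c) + tangential z a b c = 0)"
  proof (rule ball_cong[OF refl])
    fix z assume z: "z \<in> V"
    show "(\<forall>\<xi>s. F.form3 (gauge_form (\<lambda>_. to_gauge sc r0) \<Theta> z) \<xi>s + 1/2 * F.form3 (gauge_form \<Theta> \<Theta> z) \<xi>s = 0) \<longleftrightarrow>
      (\<forall>a b c. flin a \<longrightarrow> flin b \<longrightarrow> flin c \<longrightarrow> obstruction z (ver a) (ver b) (ver c) + tangential z a b c = 0)"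
      by (subst F.supported_3_eq_0_iff) (auto simp: F.supported_def F.form3_def val[OF z])
  qed
  finally show ?thesis .
qed

section \<open>Components of the dynamical r-matrix condition\<close>

lemma schouten_form_r:
  assumes abc: "linfun a" "linfun b" "linfun c"
  shows "schouten_form (r0 + T z) (r0 + T z) a b c =
    schouten_form r0 r0 a b c + 2 * schouten_form r0 (T z) a b c + schouten_form (T z) (T z) a b c"
proof -
  have an: "p (br (contr (T z) q) (contr r0 r)) = - p (br (contr r0 r) (contr (T z) q))" if "linfun p" for p q r
    using br_antisym[of "contr (T z) q" "contr r0 r"] by (simp add: lin_neg[OF that])
  show ?thesis
    unfolding schouten_form_def
    by (simp add: skew3_def contr_add br_left br_right lin_add[OF abc(1)] lin_add[OF abc(2)] lin_add[OF abc(3)] an abc)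
qed

lemma r_holo: "holo_multivector sc 2 V (\<lambda>z. r0 + T z)"
  unfolding holo_multivector_def using T_bivector T_holo r0_bivector
  by (auto intro!: ext_power_add holo_fun_add holo_fun_const)

lemma partial_r: "z \<in> V \<Longrightarrow> partial_tensor (\<lambda>z. r0 + T z) i z \<xi>s = dderiv (\<lambda>w. T w \<xi>s) (axis i 1) z"
  unfolding partial_tensor_def
  using dderiv_add[OF holo_fun_const[of V "r0 \<xi>s"] T_holo[of \<xi>s], of z "axis i 1"] by (simp add: dderiv_def)

lemma Alt_d_r: assumes z: "z \<in> V" shows "Alt_d sc h (\<lambda>z. r0 + T z) z = form3 (alt_T z)"
proof (rule eq_form3I)
  have s: "supported 3 (ext_mult sc x (\<lambda>\<xi>s. dderiv (\<lambda>w. T w \<xi>s) (axis i 1) z))" for x i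
    unfolding supported_def
  proof (intro allI impI)
    fix \<xi>s :: "('g \<Rightarrow> complex) list" assume n: "\<not> (length \<xi>s = 3 \<and> (\<forall>\<xi>\<in>set \<xi>s. linfun \<xi>))"
    show "ext_mult sc x (\<lambda>\<xi>s. dderiv (\<lambda>w. T w \<xi>s) (axis i 1) z) \<xi>s = 0"
    proof (cases "\<forall>\<xi>\<in>set \<xi>s. linfun \<xi>")
      case True
      have "dderiv (\<lambda>w. T w (delete_nth j \<xi>s)) (axis i 1) z = 0" if j: "j < length \<xi>s" for j
      proof -
        \<comment> \<open>A list of the wrong length remains of the wrong length for a bivector
          after one deletion. \<open>T\<close> then vanishes on all of \<open>V\<close>, and so does
          its derivative.\<close>
        have "length (delete_nth j \<xi>s) \<noteq> 2" unfolding length_delete_nth[OF j] using n True j by auto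
        then have "T w (delete_nth j \<xi>s) = 0" if "w \<in> V" for w
          using bivector_supported[OF T_bivector[OF that]] unfolding supported_def by blast
        then have "dderiv (\<lambda>w. T w (delete_nth j \<xi>s)) (axis i 1) z = dderiv (\<lambda>_. 0) (axis i 1) z"
          by (rule dderiv_cong[OF open_V z])
        then show ?thesis by simp
      qed
      then show ?thesis using True by (simp add: ext_mult_def)
    qed (auto simp: ext_mult_def)
  qed
  have eq: "Alt_d sc h (\<lambda>z. r0 + T z) z = (\<Sum>i\<in>UNIV. ext_mult sc (h i) (\<lambda>\<xi>s. dderiv (\<lambda>w. T w \<xi>s) (axis i 1) z))"
    unfolding Alt_d_def using partial_r[OF z] by presburger
  show "supported 3 (Alt_d sc h (\<lambda>z. r0 + T z) z)" unfolding eq by (intro supported_sum s)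
  fix a b c assume abc: "linfun a" "linfun b" "linfun c"
  have "ext_mult sc (h i) (\<lambda>\<xi>s. dderiv (\<lambda>w. T w \<xi>s) (axis i 1) z) [a, b, c] =
      a (h i) * dT i z b c + b (h i) * dT i z c a + c (h i) * dT i z a b" for i
    \<comment> \<open>The expansion along \<open>h i\<close> has a minus sign at the middle
      functional; antisymmetry turns it into the cyclic form of \<open>alt_T\<close>.\<close>
    using dT_antisym[OF z abc(3,1), of i]
    by (simp add: ext_mult_def abc lessThan_Suc dT_def algebra_simps)
  then show "Alt_d sc h (\<lambda>z. r0 + T z) z [a, b, c] = alt_T z a b c"
    unfolding eq by (simp add: sum_fun_apply alt_T_def)
qed

text \<open>Invariance of \<open>r0\<close> removes it from the first condition, and
  \<open>schouten_r0_r0\<close> cancels its self-bracket against the Casimir term. Both sides of the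
  theorem are then expressed by \<open>adj_form\<close> and \<open>obstruction\<close> of
  \<open>T\<close>.\<close>

lemma dynamical_iff:
  "dynamical_r_matrix sc br H h V (\<lambda>z. r0 + T z) \<longleftrightarrow>
    (\<forall>t\<in>H. \<forall>z\<in>V. \<forall>a b. linfun a \<longrightarrow> linfun b \<longrightarrow> adj_form t (T z) a b = 0) \<and>
    (\<forall>z\<in>V. \<forall>a b c. linfun a \<longrightarrow> linfun b \<longrightarrow> linfun c \<longrightarrow> obstruction z a b c = 0)"
proof -
  have rz: "r0 + T z \<in> ext_power sc 2" if "z \<in> V" for z using r0_bivector T_bivector[OF that] by (rule ext_power_add)
  have adj: "schouten_alg sc br 1 2 (wedge sc [t]) (r0 + T z) = 0 \<longleftrightarrow>
      (\<forall>a b. linfun a \<longrightarrow> linfun b \<longrightarrow> adj_form t (T z) a b = 0)" if t: "t \<in> H" and z: "z \<in> V" for t z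
  proof -
    have e: "adj_form t (r0 + T z) a b = adj_form t (T z) a b" if ab: "linfun a" "linfun b" for a b
      using adj_form_r0[OF t ab]
      by (simp add: adj_form_def contr_add br_right lin_add[OF ab(1)] lin_add[OF ab(2)] algebra_simps)
    show ?thesis unfolding schouten_alg_12[OF rz[OF z]]
    proof
      assume 0: "form2 (adj_form t (r0 + T z)) = 0"
      show "\<forall>a b. linfun a \<longrightarrow> linfun b \<longrightarrow> adj_form t (T z) a b = 0"
      proof (intro allI impI)
        fix a b assume ab: "linfun a" "linfun b"
        show "adj_form t (T z) a b = 0" using fun_cong[OF 0, of "[a, b]"] e[OF ab] ab by simp
      qed
    next
      assume 0: "\<forall>a b. linfun a \<longrightarrow> linfun b \<longrightarrow> adj_form t (T z) a b = 0"
      have "(0 :: 'g tensor) = form2 (adj_form t (r0 + T z))"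
        by (rule eq_form2I) (auto simp: supported_def e 0)
      then show "form2 (adj_form t (r0 + T z)) = 0" by simp
    qed
  qed
  have ob: "(\<forall>\<xi>s. Alt_d sc h (\<lambda>z. r0 + T z) z \<xi>s + 1/2 * schouten_alg sc br 2 2 (r0 + T z) (r0 + T z) \<xi>s
        = comm_12_23 sc br (casimir sc br) (casimir sc br) \<xi>s) \<longleftrightarrow>
      (\<forall>a b c. linfun a \<longrightarrow> linfun b \<longrightarrow> linfun c \<longrightarrow> obstruction z a b c = 0)" if z: "z \<in> V" for z
  proof -
    have v: "alt_T z a b c + schouten_form (r0 + T z) (r0 + T z) a b c / 2
        = comm_12_23 sc br (casimir sc br) (casimir sc br) [a, b, c] + obstruction z a b c"
      if abc: "linfun a" "linfun b" "linfun c" for a b c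
      unfolding schouten_form_r[OF abc] schouten_r0_r0[OF abc, symmetric] obstruction_def by (simp add: algebra_simps)
    show ?thesis unfolding Alt_d_r[OF z] schouten_alg_22[OF rz[OF z] rz[OF z]] eq_iff_diff_eq_0[of "_ + _"]
      by (subst supported_3_eq_0_iff)
        (auto simp: v supported_def form3_def comm_casimir)
  qed
  show ?thesis unfolding dynamical_r_matrix_def using r_holo adj ob by auto
qed

lemma hamiltonian_iff_dynamical:
  "hamiltonian_operator sc br r0 V \<Theta> \<longleftrightarrow> dynamical_r_matrix sc br H h V (\<lambda>z. r0 + T z)"
  unfolding hamiltonian_iff dynamical_iff
proof
  assume A: "(\<forall>t\<in>H. \<forall>z\<in>V. \<forall>a b. linfun a \<longrightarrow> linfun b \<longrightarrow> adj_form t (T z) a b = 0) \<and>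
    (\<forall>z\<in>V. \<forall>a b c. linfun a \<longrightarrow> linfun b \<longrightarrow> linfun c \<longrightarrow> obstruction z a b c = 0)"
  show "\<forall>z\<in>V. \<forall>a b c. flin a \<longrightarrow> flin b \<longrightarrow> flin c \<longrightarrow>
      obstruction z (ver a) (ver b) (ver c) + tangential z a b c = 0"
    using A h_H linfun_ver by (simp add: tangential_def)
next
  assume A: "\<forall>z\<in>V. \<forall>a b c. flin a \<longrightarrow> flin b \<longrightarrow> flin c \<longrightarrow>
      obstruction z (ver a) (ver b) (ver c) + tangential z a b c = 0"
  \<comment> \<open>The pullback along the projection to the Lie algebra. It is purely vertical, so
    \<open>tangential\<close> drops out and \<open>obstruction\<close> remains.\<close>
  define up where "up a w = a (snd w)" for a :: "'g \<Rightarrow> complex" and w :: "(complex ^ 'n) \<times> 'g"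
  have up: "flin (up a)" "ver (up a) = a" "hor (up a) u = 0" if "linfun a" for a u
    using flin_snd[OF that] lin_zero[OF that] by (auto simp: up_def[abs_def] ver_def hor_def)
  have ob: "obstruction z a b c = 0" if "z \<in> V" "linfun a" "linfun b" "linfun c" for z a b c
    using A[rule_format, OF that(1) up(1)[OF that(2)] up(1)[OF that(3)] up(1)[OF that(4)]] up that
    by (simp add: tangential_def)
  have adj_h: "adj_form (h i) (T z) a c = 0" if z: "z \<in> V" and ac: "linfun a" "linfun c" for i z a c
  proof -
    \<comment> \<open>The coordinate differential belonging to \<open>i\<close>, a purely horizontal
      functional: its vertical part is zero, so \<open>obstruction\<close> vanishes and a single
      summand of \<open>tangential\<close> survives.\<close>
    define b where "b w = fst w $ i" for w :: "(complex ^ 'n) \<times> 'g"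
    have b: "flin b" "ver b = (\<lambda>_. 0)" "hor b (axis j 1) = (if j = i then 1 else 0)" for j
      by (auto simp: b_def ver_def[abs_def] hor_def axis_def Vector_Spaces.linear_iff F.vector_space_axioms
          vector_space_times fst_fs)
    have "tangential z (up a) b (up c) = 0"
      using A[rule_format, OF z up(1)[OF ac(1)] b(1) up(1)[OF ac(2)]] ob[OF z ac(1) linfun_0 ac(2)] up[OF ac(1)] up[OF ac(2)] b(2)
      by simp
    moreover have "tangential z (up a) b (up c) = (\<Sum>j\<in>UNIV. if j = i then adj_form (h i) (T z) a c else 0)"
      unfolding tangential_def by (rule sum.cong[OF refl]) (simp add: up ac b)
    ultimately show ?thesis by simp
  qed
  have "adj_form t (T z) a c = 0" if t: "t \<in> H" and z: "z \<in> V" and ac: "linfun a" "linfun c" for t z a c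
  proof -
    have "t \<in> span (range h)" using t span_h by simp
    then show ?thesis
    proof (induction rule: span_induct_alt)
      case base
      show ?case by (simp add: adj_form_def br_left lin_zero[OF ac(1)] lin_zero[OF ac(2)])
    next
      case (step k x y)
      then have "adj_form x (T z) a c = 0" using adj_h[OF z ac] by blast
      moreover have "adj_form (sc k x + y) (T z) a c = k * adj_form x (T z) a c + adj_form y (T z) a c"
        by (simp add: adj_form_def br_left lin_add[OF ac(1)] lin_add[OF ac(2)] lin_scale[OF ac(1)] lin_scale[OF ac(2)]
            algebra_simps)
      ultimately show ?case using step by simp
    qed
  qed
  then show "(\<forall>t\<in>H. \<forall>z\<in>V. \<forall>a b. linfun a \<longrightarrow> linfun b \<longrightarrow> adj_form t (T z) a b = 0) \<and>
    (\<forall>z\<in>V. \<forall>a b c. linfun a \<longrightarrow> linfun b \<longrightarrow> linfun c \<longrightarrow> obstruction z a b c = 0)"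
    using ob by blast
qed

end

section \<open>Coordinates on the dual of the Cartan subalgebra and the final assembly\<close>

lemma coord_point_preimage_open:
  fixes h :: "'n::finite \<Rightarrow> 'g::ab_group_add"
  assumes vs: "vector_space sc" and sp: "module.span sc (range h) = H"
    and U: "openin (top_of_set (dual_of sc H)) U"
  shows "open (coord_point sc H h -` U)"
proof -
  interpret vector_space sc by (rule vs)
  let ?\<phi> = "coord_point sc H h"
  obtain W where W: "open W" "U = dual_of sc H \<inter> W" using U by (auto simp: openin_open)
  show ?thesis
  proof (cases "independent (range h)")
    case True
    have d: "dual_basis sc H h i \<in> dual_of sc H" for i
      unfolding dual_basis_def dual_of_def sp[symmetric]
      by (auto simp: representation_add[OF True] representation_scale[OF True] span_add span_scale)
    have "?\<phi> z \<in> dual_of sc H" for z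
      using d unfolding coord_point_def dual_of_def
      by (auto simp: distrib_left sum.distrib sum_distrib_left mult.left_commute)
    then have "?\<phi> -` U = ?\<phi> -` W" using W(2) by auto
    moreover have "continuous_on UNIV ?\<phi>"
      unfolding coord_point_def by (intro continuous_on_coordinatewise_then_product continuous_intros)
    ultimately show ?thesis using open_vimage[OF W(1)] by simp
  next
    case False \<comment> \<open>then \<open>representation\<close> is zero by convention\<close>
    then have "?\<phi> z = (\<lambda>_. 0)" for z
      by (auto simp: coord_point_def dual_basis_def representation_def fun_eq_iff intro!: sum.neutral)
    then have "?\<phi> -` U = UNIV \<or> ?\<phi> -` U = {}" by auto
    then show ?thesis by auto
  qed
qed

text \<open>By invariance the radical of the Killing form is an ideal. One nonzero value of the form
  excludes that it is everything.\<close>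

lemma simple_lie_algebra_nondegenerate:
  assumes s: "simple_lie_algebra sc br" and ne: "killing sc br u v \<noteq> 0" and x: "\<And>y. killing sc br x y = 0"
  shows "x = 0"
proof -
  interpret complex_lie_algebra sc br using s by (simp add: simple_lie_algebra_def)
  define I where "I = {x. \<forall>y. kf x y = 0}"
  have "lie_ideal sc br I"
    unfolding lie_ideal_def
  proof (intro conjI allI ballI)
    show "subspace I" by (auto simp: I_def subspace_def kf_left kf_left')
    fix w y assume y: "y \<in> I"
    have "kf (br w y) z = 0" for z
    proof -
      have "kf (br w y) z = - kf (br y w) z" using br_antisym[of w y] by (simp add: kf_left')
      then show ?thesis using y by (simp add: kf_invariant I_def)
    qed
    then show "br w y \<in> I" by (simp add: I_def)
  qed
  then have "I = {0} \<or> I = UNIV" using s by (simp add: simple_lie_algebra_def)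
  moreover have "u \<notin> I" using ne by (auto simp: I_def)
  ultimately have "I = {0}" by auto
  then show ?thesis using x by (auto simp: I_def)
qed

theorem theorem3p1:
  fixes sc :: "complex \<Rightarrow> 'g::ab_group_add \<Rightarrow> 'g"
    and br :: "'g \<Rightarrow> 'g \<Rightarrow> 'g"
    and H :: "'g set"
    and P :: "('g \<Rightarrow> complex) set"
    and \<alpha> :: "'n::finite \<Rightarrow> 'g \<Rightarrow> complex"
    and E :: "('g \<Rightarrow> complex) \<Rightarrow> 'g"
    and U :: "('g \<Rightarrow> complex) set"
    and \<tau> :: "('g \<Rightarrow> complex) \<Rightarrow> 'g tensor"
  defines "h \<equiv> simple_coroot br E \<alpha>"
  defines "r0 \<equiv> r_zero sc P E"
  defines "\<phi> \<equiv> coord_point sc H h"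
  defines "V \<equiv> \<phi> -` U"
  assumes "simple_lie_algebra sc br"
    and "cartan_subalgebra sc br H"
    and "positive_system (roots sc br H) P"
    and "bij_betw \<alpha> UNIV (simple_roots P)"
    and "root_vectors sc br H E"
    and "openin (top_of_set (dual_of sc H)) U"
    and "connected U"
    and "holo_multivector sc 2 V (\<lambda>z. \<tau> (\<phi> z))"
  shows "hamiltonian_operator sc br r0 V (\<lambda>z. theta sc h z + to_gauge sc (\<tau> (\<phi> z)))
    \<longleftrightarrow> dynamical_r_matrix sc br H h V (\<lambda>z. r0 + \<tau> (\<phi> z))"
proof -
  have \<alpha>: "range \<alpha> = simple_roots P" using assms(8) by (simp add: bij_betw_def)
  have "\<alpha> i \<in> roots sc br H" for i
  proof -
    have "\<alpha> i \<in> P" using \<alpha> by (auto simp: simple_roots_def)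
    then show ?thesis using assms(7) by (auto simp: positive_system_def)
  qed
  then have "killing sc br (E (\<alpha> i)) (E (- \<alpha> i)) = 1" for i using assms(9) by (simp add: root_vectors_def)
  \<comment> \<open>The index type \<open>'n\<close> is inhabited, so a simple root exists; the
    normalization of its root vectors gives the nonzero value of the Killing form from which
    nondegeneracy follows.\<close>
  then have ne: "killing sc br (E (\<alpha> i)) (E (- \<alpha> i)) \<noteq> 0" for i by simp
  interpret complex_lie_algebra sc br using assms(5) by (simp add: simple_lie_algebra_def)
  interpret positive_root_algebra sc br H E P
    by unfold_locales
      (use assms(6,7,9) simple_lie_algebra_nondegenerate[OF assms(5) ne] in blast)+
  have "range h = coroot ` simple_roots P"
    unfolding \<alpha>[symmetric] h_def image_image by (simp add: simple_coroot_def coroot_def fun_eq_iff)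
  then have span_h: "span (range h) = H" using span_simple_coroots by simp
  have "open V"
    unfolding V_def \<phi>_def by (rule coord_point_preimage_open[OF vector_space_axioms span_h assms(10)])
  then interpret dynamical_setting sc br H E P V h "\<lambda>z. \<tau> (\<phi> z)"
    by unfold_locales (use span_h assms(12) in auto)
  show ?thesis unfolding r0_def by (rule hamiltonian_iff_dynamical)
qed

end
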